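(* Let $r=1$ or $r=2$. If an $n$-dimensional statistical manifold $(M,g,\nabla)$ admits a local affine embedding to $\mathbb{R}^{n+r}$, then it is locally embeddable to a flat statistical manifold of dimension $n+r$.
   Context: All objects are $C^\infty$. A statistical manifold $(M,g,\nabla)$ is a manifold $M$ with a Riemannian metric $g$ and a torsion-free affine connection $\nabla$ such that $\nabla g$ is a totally symmetric $3$-tensor. It is called flat if the curvature of $\nabla$ vanishes ($g$ need not be a flat metric). An embedding $f\colon M\to\mathcal{S}$ between statistical manifolds $(M,g,\nabla)$ and $(\mathcal{S},G,D)$ is a statistical embedding if $g(X,Y)=G(f_*X,f_*Y)$ and $g(\nabla_XY,Z)=G(D_X(f_*Y),f_*Z)$ for all $X,Y,Z\in\Gamma(TM)$, where $D$ also denotes the pulled-back connection on $f^*T\mathcal{S}$. $(M,g,\nabla)$ is locally embeddable to a flat statistical manifold of dimension $N$ if for every $x\in M$ there exist an open neighborhood $U$ of $x$, an $N$-dimensional flat statistical manifold $(\mathcal{S},G,D)$ and a statistical embedding $f\colon U\to\mathcal{S}$. Affine embeddings. Let $D$ denote the canonical flat connection on $f^*T\mathbb{R}^{n+r}$. Codimension $1$: $(M,g,\nabla)$ admits an affine embedding to $\mathbb{R}^{n+1}$ if there are an embedding $f\colon M\to\mathbb{R}^{n+1}$ and a vector field $\xi\in\Gamma(f^*T\mathbb{R}^{n+1})$ transverse to $f_*TM$ (so $f^*T\mathbb{R}^{n+1}=f_*TM\oplus\mathbb{R}\xi$) such that for all $X,Y\in\Gamma(TM)$ $$D_X(f_*Y)=f_*(\nabla_XY)-g(X,Y)\xi,\qquad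 D_X\xi=f_*(S(X))+\tau(X)\xi,\qquad \tau=0,$$ where $S$ is some endomorphism of $TM$ and $\tau$ a $1$-form on $M$. Codimension $2$: $(M,g,\nabla)$ admits an affine embedding to $\mathbb{R}^{n+2}$ if there are an embedding $f\colon M\to\mathbb{R}^{n+2}$ such that the position vector field $\eta=x^A(\partial/\partial x^A)\in\Gamma(f^*T\mathbb{R}^{n+2})$ is transverse to $f_*TM$, and a further vector field $\xi\in\Gamma(f^*T\mathbb{R}^{n+2})$ with $f^*T\mathbb{R}^{n+2}=f_*TM\oplus\mathbb{R}\xi\oplus\mathbb{R}\eta$, such that for all $X,Y\in\Gamma(TM)$ $$D_X(f_*Y)=f_*(\nabla_XY)-g(X,Y)\xi-k(X,Y)\eta,\qquad D_X\xi=f_*(S(X))+\tau(X)\xi+\mu(X)\eta,\qquad \tau=0,$$ where $k$ is some $2$-tensor, $S$ some endomorphism of $TM$, and $\tau,\mu$ are $1$-forms on $M$ (and automatically $D_X\eta=f_*X$). "Admits a local affine embedding" means that every point of $M$ has an open neighborhood which, with the restriction of $(g,\nabla)$, admits an affine embedding. *)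

theory Defs
  imports "HOL-Analysis.Analysis"
begin

section \<open>Smooth maps between open subsets of Euclidean spaces\<close>

primrec ck_on ::
    "nat \<Rightarrow> ('e::euclidean_space \<Rightarrow> 'f::euclidean_space) \<Rightarrow> 'e set \<Rightarrow> bool" where
  "ck_on 0 F U \<longleftrightarrow> continuous_on U F"
| "ck_on (Suc k) F U \<longleftrightarrow>
     (\<forall>x\<in>U. F differentiable (at x)) \<and>
     (\<forall>v. ck_on k (\<lambda>x. frechet_derivative F (at x) v) U)"

text \<open>Only used for open sets U.\<close>

definition smooth_on :: "('e::euclidean_space \<Rightarrow> 'f::euclidean_space) \<Rightarrow> 'e set \<Rightarrow> bool" where
  "smooth_on F U \<longleftrightarrow> (\<forall>k. ck_on k F U)"

section \<open>Smooth manifolds\<close>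

text \<open>
  Points have type 'a and charts take values in the Euclidean space 'e, so the dimension is DIM('e).
  A chart is a pair of an open domain and a coordinate map, whose values outside the domain are
  irrelevant.  The topology is an abstract one, so that the points of a manifold need not
  exhaust the type 'a and their topology is not fixed by 'a.
\<close>

record ('a, 'e) manifold =
  mtop :: "'a topology"
  atlas :: "('a set \<times> ('a \<Rightarrow> 'e)) set"

abbreviation points :: "('a, 'e) manifold \<Rightarrow> 'a set" where
  "points M \<equiv> topspace (mtop M)"

definition smooth_manifold :: "('a, 'e::euclidean_space) manifold \<Rightarrow> bool" where
  "smooth_manifold M \<longleftrightarrow>
     Hausdorff_space (mtop M) \<and> second_countable (mtop M) \<and>
     (\<Union>(V, \<phi>)\<in>atlas M. V) = points M \<and>
     (\<forall>(V, \<phi>)\<in>atlas M. openin (mtop M) V \<and> open (\<phi> ` V) \<and>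
        homeomorphic_map (subtopology (mtop M) V) (top_of_set (\<phi> ` V)) \<phi>) \<and>
     (\<forall>(V, \<phi>)\<in>atlas M. \<forall>(V', \<psi>)\<in>atlas M.
        smooth_on (\<psi> \<circ> inv_into V \<phi>) (\<phi> ` (V \<inter> V')))"

definition restrict_manifold ::
    "('a, 'e) manifold \<Rightarrow> 'a set \<Rightarrow> ('a, 'e) manifold" where
  "restrict_manifold M U =
     \<lparr>mtop = subtopology (mtop M) U, atlas = {(V \<inter> U, \<phi>) | V \<phi>. (V, \<phi>) \<in> atlas M}\<rparr>"

definition euclid :: "('f::euclidean_space, 'f) manifold" where
  "euclid = \<lparr>mtop = euclidean, atlas = {(UNIV, \<lambda>y. y)}\<rparr>"

definition smooth_fun ::
    "('a, 'e::euclidean_space) manifold \<Rightarrow> 'a set \<Rightarrow> ('a \<Rightarrow> real) \<Rightarrow> bool" where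
  "smooth_fun M W h \<longleftrightarrow> openin (mtop M) W \<and>
     (\<forall>(V, \<phi>)\<in>atlas M. smooth_on (h \<circ> inv_into V \<phi>) (\<phi> ` (V \<inter> W)))"

definition smooth_fun_at ::
    "('a, 'e::euclidean_space) manifold \<Rightarrow> 'a \<Rightarrow> ('a \<Rightarrow> real) \<Rightarrow> bool" where
  "smooth_fun_at M p h \<longleftrightarrow> (\<exists>W. p \<in> W \<and> smooth_fun M W h)"

definition smooth_map ::
    "('a, 'e::euclidean_space) manifold \<Rightarrow> ('b, 'f::euclidean_space) manifold \<Rightarrow> ('a \<Rightarrow> 'b) \<Rightarrow> bool"
  where
  "smooth_map M N f \<longleftrightarrow> continuous_map (mtop M) (mtop N) f \<and>
     (\<forall>(V, \<phi>)\<in>atlas M. \<forall>(V', \<psi>)\<in>atlas N.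
        smooth_on (\<psi> \<circ> f \<circ> inv_into V \<phi>) (\<phi> ` (V \<inter> f -` V')))"

section \<open>Tangent vectors and vector fields\<close>

text \<open>
  Tangent vectors at p are the derivations at p on real functions that are smooth near p.
  They are made extensional by sending all other functions to 0.  That a derivation only
  depends on the germ of its argument follows from the Leibniz rule: if h and k agree on an open
  W around p, then h - k is its own product with the function that is 0 on W and 1 elsewhere, and
  this function is smooth near p.
\<close>

type_synonym 'a tvec = "('a \<Rightarrow> real) \<Rightarrow> real"

abbreviation tvec_comb :: "real \<Rightarrow> 'a tvec \<Rightarrow> real \<Rightarrow> 'a tvec \<Rightarrow> 'a tvec" where
  "tvec_comb a v b w \<equiv> (\<lambda>h. a * v h + b * w h)"

definition tangent_space :: "('a, 'e::euclidean_space) manifold \<Rightarrow> 'a \<Rightarrow> 'a tvec set" where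
  "tangent_space M p = {v.
     (\<forall>h. \<not> smooth_fun_at M p h \<longrightarrow> v h = 0) \<and>
     (\<forall>a b h k. smooth_fun_at M p h \<and> smooth_fun_at M p k \<longrightarrow>
        v (\<lambda>q. a * h q + b * k q) = a * v h + b * v k) \<and>
     (\<forall>h k. smooth_fun_at M p h \<and> smooth_fun_at M p k \<longrightarrow>
        v (\<lambda>q. h q * k q) = v h * k p + h p * v k)}"

definition pushforward ::
    "('b, 'f::euclidean_space) manifold \<Rightarrow> ('a \<Rightarrow> 'b) \<Rightarrow> 'a \<Rightarrow> 'a tvec \<Rightarrow> 'b tvec" where
  "pushforward N f p v = (\<lambda>h. if smooth_fun_at N (f p) h then v (h \<circ> f) else 0)"

definition embedding ::
    "('a, 'e::euclidean_space) manifold \<Rightarrow> ('b, 'f::euclidean_space) manifold \<Rightarrow> ('a \<Rightarrow> 'b) \<Rightarrow> bool"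
  where
  "embedding M N f \<longleftrightarrow> smooth_map M N f \<and>
     (\<forall>p\<in>points M. inj_on (pushforward N f p) (tangent_space M p)) \<and>
     embedding_map (mtop M) (mtop N) f"

text \<open>Smooth sections over W of the pull-back of TN along a smooth map f from M to N.\<close>

definition smooth_section ::
    "('a, 'e::euclidean_space) manifold \<Rightarrow> ('b, 'f::euclidean_space) manifold \<Rightarrow> ('a \<Rightarrow> 'b) \<Rightarrow>
     'a set \<Rightarrow> ('a \<Rightarrow> 'b tvec) \<Rightarrow> bool" where
  "smooth_section M N f W \<sigma> \<longleftrightarrow> openin (mtop M) W \<and>
     (\<forall>p\<in>W. \<sigma> p \<in> tangent_space N (f p)) \<and>
     (\<forall>V h. smooth_fun N V h \<longrightarrow> smooth_fun M {p\<in>W. f p \<in> V} (\<lambda>p. \<sigma> p h))"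

definition smooth_section_at ::
    "('a, 'e::euclidean_space) manifold \<Rightarrow> ('b, 'f::euclidean_space) manifold \<Rightarrow> ('a \<Rightarrow> 'b) \<Rightarrow>
     'a \<Rightarrow> ('a \<Rightarrow> 'b tvec) \<Rightarrow> bool" where
  "smooth_section_at M N f p \<sigma> \<longleftrightarrow> (\<exists>W. p \<in> W \<and> smooth_section M N f W \<sigma>)"

definition smooth_vf ::
    "('a, 'e::euclidean_space) manifold \<Rightarrow> 'a set \<Rightarrow> ('a \<Rightarrow> 'a tvec) \<Rightarrow> bool" where
  "smooth_vf M W X \<longleftrightarrow> smooth_section M M (\<lambda>p. p) W X"

definition vector_fields :: "('a, 'e::euclidean_space) manifold \<Rightarrow> ('a \<Rightarrow> 'a tvec) set" where
  "vector_fields M = {X. smooth_vf M (points M) X}"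

text \<open>The case distinction keeps the values extensional.\<close>

definition lie_bracket ::
    "('a, 'e::euclidean_space) manifold \<Rightarrow> ('a \<Rightarrow> 'a tvec) \<Rightarrow> ('a \<Rightarrow> 'a tvec) \<Rightarrow> 'a \<Rightarrow> 'a tvec" where
  "lie_bracket M X Y p =
     (\<lambda>h. if smooth_fun_at M p h then X p (\<lambda>q. Y q h) - Y p (\<lambda>q. X q h) else 0)"

section \<open>Tensor fields\<close>

definition one_form ::
    "('a, 'e::euclidean_space) manifold \<Rightarrow> ('a \<Rightarrow> 'a tvec \<Rightarrow> real) \<Rightarrow> bool" where
  "one_form M \<tau> \<longleftrightarrow>
     (\<forall>p\<in>points M. \<forall>v\<in>tangent_space M p. \<forall>w\<in>tangent_space M p. \<forall>a b.
        \<tau> p (tvec_comb a v b w) = a * \<tau> p v + b * \<tau> p w) \<and>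
     (\<forall>W X. smooth_vf M W X \<longrightarrow> smooth_fun M W (\<lambda>p. \<tau> p (X p)))"

definition two_tensor ::
    "('a, 'e::euclidean_space) manifold \<Rightarrow> ('a \<Rightarrow> 'a tvec \<Rightarrow> 'a tvec \<Rightarrow> real) \<Rightarrow> bool" where
  "two_tensor M k \<longleftrightarrow>
     (\<forall>p\<in>points M. \<forall>u\<in>tangent_space M p. \<forall>v\<in>tangent_space M p. \<forall>w\<in>tangent_space M p. \<forall>a b.
        k p (tvec_comb a v b w) u = a * k p v u + b * k p w u \<and>
        k p u (tvec_comb a v b w) = a * k p u v + b * k p u w) \<and>
     (\<forall>W X Y. smooth_vf M W X \<and> smooth_vf M W Y \<longrightarrow> smooth_fun M W (\<lambda>p. k p (X p) (Y p)))"

definition endomorphism ::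
    "('a, 'e::euclidean_space) manifold \<Rightarrow> ('a \<Rightarrow> 'a tvec \<Rightarrow> 'a tvec) \<Rightarrow> bool" where
  "endomorphism M S \<longleftrightarrow>
     (\<forall>p\<in>points M. \<forall>v\<in>tangent_space M p. \<forall>w\<in>tangent_space M p.
        S p v \<in> tangent_space M p \<and>
        (\<forall>a b. S p (tvec_comb a v b w) = tvec_comb a (S p v) b (S p w))) \<and>
     (\<forall>W X. smooth_vf M W X \<longrightarrow> smooth_vf M W (\<lambda>p. S p (X p)))"

definition riemannian_metric ::
    "('a, 'e::euclidean_space) manifold \<Rightarrow> ('a \<Rightarrow> 'a tvec \<Rightarrow> 'a tvec \<Rightarrow> real) \<Rightarrow> bool" where
  "riemannian_metric M g \<longleftrightarrow> two_tensor M g \<and>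
     (\<forall>p\<in>points M. \<forall>v\<in>tangent_space M p. \<forall>w\<in>tangent_space M p. g p v w = g p w v) \<and>
     (\<forall>p\<in>points M. \<forall>v\<in>tangent_space M p. v \<noteq> (\<lambda>h. 0) \<longrightarrow> g p v v > 0)"

section \<open>Connections\<close>

text \<open>
  A connection on the pull-back of TN along f assigns to a point p, a tangent vector v at p and a
  section defined near p the covariant derivative of the section in direction v.  Working with
  sections defined near p makes the restriction of a connection to an open set the same operator.
\<close>

type_synonym ('a, 'b) conn = "'a \<Rightarrow> 'a tvec \<Rightarrow> ('a \<Rightarrow> 'b tvec) \<Rightarrow> 'b tvec"

definition connection_along ::
    "('a, 'e::euclidean_space) manifold \<Rightarrow> ('b, 'f::euclidean_space) manifold \<Rightarrow> ('a \<Rightarrow> 'b) \<Rightarrow>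
     ('a, 'b) conn \<Rightarrow> bool" where
  "connection_along M N f E \<longleftrightarrow>
     (\<forall>p\<in>points M. \<forall>v\<in>tangent_space M p. \<forall>\<sigma>. smooth_section_at M N f p \<sigma> \<longrightarrow>
        E p v \<sigma> \<in> tangent_space N (f p) \<and>
        (\<forall>w\<in>tangent_space M p. \<forall>a b.
           E p (tvec_comb a v b w) \<sigma> = tvec_comb a (E p v \<sigma>) b (E p w \<sigma>)) \<and>
        (\<forall>\<rho>. smooth_section_at M N f p \<rho> \<longrightarrow>
           E p v (\<lambda>q h. \<sigma> q h + \<rho> q h) = (\<lambda>h. E p v \<sigma> h + E p v \<rho> h)) \<and>
        (\<forall>c. smooth_fun_at M p c \<longrightarrow>
           E p v (\<lambda>q h. c q * \<sigma> q h) = (\<lambda>h. v c * \<sigma> p h + c p * E p v \<sigma> h)) \<and>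
        (\<forall>W \<rho>. p \<in> W \<and> openin (mtop M) W \<and> (\<forall>q\<in>W. \<rho> q = \<sigma> q) \<longrightarrow> E p v \<rho> = E p v \<sigma>)) \<and>
     (\<forall>W X \<sigma>. smooth_vf M W X \<and> smooth_section M N f W \<sigma> \<longrightarrow>
        smooth_section M N f W (\<lambda>p. E p (X p) \<sigma>))"

definition affine_connection ::
    "('a, 'e::euclidean_space) manifold \<Rightarrow> ('a, 'a) conn \<Rightarrow> bool" where
  "affine_connection M nab \<longleftrightarrow> connection_along M M (\<lambda>p. p) nab"

text \<open>The axioms determine the pulled-back connection E uniquely on sections that are smooth
  near the point, since such a section is a combination of sections Z o f with smooth
  coefficients.\<close>

definition pullback_connection ::
    "('a, 'e::euclidean_space) manifold \<Rightarrow> ('b, 'f::euclidean_space) manifold \<Rightarrow> ('a \<Rightarrow> 'b) \<Rightarrow>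
     ('b, 'b) conn \<Rightarrow> ('a, 'b) conn \<Rightarrow> bool" where
  "pullback_connection M N f D E \<longleftrightarrow> connection_along M N f E \<and>
     (\<forall>p\<in>points M. \<forall>v\<in>tangent_space M p. \<forall>V Z. f p \<in> V \<and> smooth_vf N V Z \<longrightarrow>
        E p v (\<lambda>q. Z (f q)) = D (f p) (pushforward N f p v) Z)"

abbreviation cov :: "('a, 'b) conn \<Rightarrow> ('a \<Rightarrow> 'a tvec) \<Rightarrow> ('a \<Rightarrow> 'b tvec) \<Rightarrow> 'a \<Rightarrow> 'b tvec" where
  "cov nab X Y \<equiv> (\<lambda>p. nab p (X p) Y)"

definition torsion_free ::
    "('a, 'e::euclidean_space) manifold \<Rightarrow> ('a, 'a) conn \<Rightarrow> bool" where
  "torsion_free M nab \<longleftrightarrow>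
     (\<forall>X\<in>vector_fields M. \<forall>Y\<in>vector_fields M. \<forall>p\<in>points M. \<forall>h.
        cov nab X Y p h - cov nab Y X p h - lie_bracket M X Y p h = 0)"

definition curvature_free ::
    "('a, 'e::euclidean_space) manifold \<Rightarrow> ('a, 'a) conn \<Rightarrow> bool" where
  "curvature_free M nab \<longleftrightarrow>
     (\<forall>X\<in>vector_fields M. \<forall>Y\<in>vector_fields M. \<forall>Z\<in>vector_fields M. \<forall>p\<in>points M. \<forall>h.
        cov nab X (cov nab Y Z) p h - cov nab Y (cov nab X Z) p h
          - cov nab (lie_bracket M X Y) Z p h = 0)"

definition metric_derivative ::
    "('a \<Rightarrow> 'a tvec \<Rightarrow> 'a tvec \<Rightarrow> real) \<Rightarrow> ('a, 'a) conn \<Rightarrow>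
     ('a \<Rightarrow> 'a tvec) \<Rightarrow> ('a \<Rightarrow> 'a tvec) \<Rightarrow> ('a \<Rightarrow> 'a tvec) \<Rightarrow> 'a \<Rightarrow> real" where
  "metric_derivative g nab X Y Z p =
     X p (\<lambda>q. g q (Y q) (Z q)) - g p (cov nab X Y p) (Z p) - g p (Y p) (cov nab X Z p)"

section \<open>Statistical manifolds and statistical embeddings\<close>

text \<open>Total symmetry is stated for the two adjacent transpositions, which generate all
  permutations of the three arguments.\<close>

definition statistical_manifold ::
    "('a, 'e::euclidean_space) manifold \<Rightarrow> ('a \<Rightarrow> 'a tvec \<Rightarrow> 'a tvec \<Rightarrow> real) \<Rightarrow>
     ('a, 'a) conn \<Rightarrow> bool" where
  "statistical_manifold M g nab \<longleftrightarrow>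
     smooth_manifold M \<and> riemannian_metric M g \<and> affine_connection M nab \<and> torsion_free M nab \<and>
     (\<forall>X\<in>vector_fields M. \<forall>Y\<in>vector_fields M. \<forall>Z\<in>vector_fields M. \<forall>p\<in>points M.
        metric_derivative g nab X Y Z p = metric_derivative g nab Y X Z p \<and>
        metric_derivative g nab X Y Z p = metric_derivative g nab X Z Y p)"

definition flat_statistical_manifold ::
    "('a, 'e::euclidean_space) manifold \<Rightarrow> ('a \<Rightarrow> 'a tvec \<Rightarrow> 'a tvec \<Rightarrow> real) \<Rightarrow>
     ('a, 'a) conn \<Rightarrow> bool" where
  "flat_statistical_manifold M g nab \<longleftrightarrow> statistical_manifold M g nab \<and> curvature_free M nab"

definition statistical_embedding ::
    "('a, 'e::euclidean_space) manifold \<Rightarrow> ('a \<Rightarrow> 'a tvec \<Rightarrow> 'a tvec \<Rightarrow> real) \<Rightarrow> ('a, 'a) conn \<Rightarrow>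
     ('b, 'f::euclidean_space) manifold \<Rightarrow> ('b \<Rightarrow> 'b tvec \<Rightarrow> 'b tvec \<Rightarrow> real) \<Rightarrow> ('b, 'b) conn \<Rightarrow>
     ('a \<Rightarrow> 'b) \<Rightarrow> bool" where
  "statistical_embedding M g nab N G D f \<longleftrightarrow> embedding M N f \<and>
     (\<exists>E. pullback_connection M N f D E \<and>
       (\<forall>X\<in>vector_fields M. \<forall>Y\<in>vector_fields M. \<forall>Z\<in>vector_fields M. \<forall>p\<in>points M.
          g p (X p) (Y p) = G (f p) (pushforward N f p (X p)) (pushforward N f p (Y p)) \<and>
          g p (cov nab X Y p) (Z p) =
            G (f p) (cov E X (\<lambda>q. pushforward N f q (Y q)) p) (pushforward N f p (Z p))))"

text \<open>
  The dimension of the target is that of 'f.  Its points are also taken from the type 'f, which is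
  no restriction: a second countable Hausdorff manifold has at most the cardinality of the
  continuum, so its points can be renamed to elements of 'f, and the topology of S is not tied to
  that of 'f.
\<close>

definition locally_embeddable_flat ::
    "'f::euclidean_space itself \<Rightarrow> ('a, 'e::euclidean_space) manifold \<Rightarrow>
     ('a \<Rightarrow> 'a tvec \<Rightarrow> 'a tvec \<Rightarrow> real) \<Rightarrow> ('a, 'a) conn \<Rightarrow> bool" where
  "locally_embeddable_flat TYPE('f) M g nab \<longleftrightarrow>
     (\<forall>x\<in>points M. \<exists>U. openin (mtop M) U \<and> x \<in> U \<and>
       (\<exists>(S :: ('f, 'f) manifold) G D f.
          flat_statistical_manifold S G D \<and>
          statistical_embedding (restrict_manifold M U) g nab S G D f))"

section \<open>Affine embeddings\<close>

text \<open>
  Each tangent space of the vector space 'f is identified with 'f, so sections of the pull-back of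
  its tangent bundle along f are 'f-valued functions on M.  Under this identification
  the canonical flat connection differentiates the components of a section, the pushforward of v
  under f is the derivative of f along v, and the position vector field along f is f itself.
\<close>

definition deriv_along :: "'a tvec \<Rightarrow> ('a \<Rightarrow> 'f::euclidean_space) \<Rightarrow> 'f" where
  "deriv_along v F = (\<Sum>b\<in>Basis. v (\<lambda>q. F q \<bullet> b) *\<^sub>R b)"

abbreviation tangent_image ::
    "('a, 'e::euclidean_space) manifold \<Rightarrow> ('a \<Rightarrow> 'f::euclidean_space) \<Rightarrow> 'a \<Rightarrow> 'f set" where
  "tangent_image M f p \<equiv> (\<lambda>v. deriv_along v f) ` tangent_space M p"

definition affine_embedding_codim1 ::
    "('a, 'e::euclidean_space) manifold \<Rightarrow> ('a \<Rightarrow> 'a tvec \<Rightarrow> 'a tvec \<Rightarrow> real) \<Rightarrow> ('a, 'a) conn \<Rightarrow>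
     ('a \<Rightarrow> 'f::euclidean_space) \<Rightarrow> ('a \<Rightarrow> 'f) \<Rightarrow> bool" where
  "affine_embedding_codim1 M g nab f \<xi> \<longleftrightarrow>
     embedding M euclid f \<and> smooth_map M euclid \<xi> \<and>
     (\<forall>p\<in>points M. \<forall>w. \<exists>!(u, a). u \<in> tangent_image M f p \<and> w = u + a *\<^sub>R \<xi> p) \<and>
     (\<exists>S \<tau>. endomorphism M S \<and> one_form M \<tau> \<and>
       (\<forall>X\<in>vector_fields M. \<forall>Y\<in>vector_fields M. \<forall>p\<in>points M.
          deriv_along (X p) (\<lambda>q. deriv_along (Y q) f) =
            deriv_along (cov nab X Y p) f - g p (X p) (Y p) *\<^sub>R \<xi> p \<and>
          deriv_along (X p) \<xi> = deriv_along (S p (X p)) f + \<tau> p (X p) *\<^sub>R \<xi> p \<and>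
          \<tau> p (X p) = 0))"

definition affine_embedding_codim2 ::
    "('a, 'e::euclidean_space) manifold \<Rightarrow> ('a \<Rightarrow> 'a tvec \<Rightarrow> 'a tvec \<Rightarrow> real) \<Rightarrow> ('a, 'a) conn \<Rightarrow>
     ('a \<Rightarrow> 'f::euclidean_space) \<Rightarrow> ('a \<Rightarrow> 'f) \<Rightarrow> bool" where
  "affine_embedding_codim2 M g nab f \<xi> \<longleftrightarrow>
     embedding M euclid f \<and> smooth_map M euclid \<xi> \<and>
     (\<forall>p\<in>points M. f p \<notin> tangent_image M f p) \<and>
     (\<forall>p\<in>points M. \<forall>w. \<exists>!(u, a, b).
        u \<in> tangent_image M f p \<and> w = u + a *\<^sub>R \<xi> p + b *\<^sub>R f p) \<and>
     (\<exists>k S \<tau> \<mu>. two_tensor M k \<and> endomorphism M S \<and> one_form M \<tau> \<and> one_form M \<mu> \<and>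
       (\<forall>X\<in>vector_fields M. \<forall>Y\<in>vector_fields M. \<forall>p\<in>points M.
          deriv_along (X p) (\<lambda>q. deriv_along (Y q) f) =
            deriv_along (cov nab X Y p) f - g p (X p) (Y p) *\<^sub>R \<xi> p - k p (X p) (Y p) *\<^sub>R f p \<and>
          deriv_along (X p) \<xi> =
            deriv_along (S p (X p)) f + \<tau> p (X p) *\<^sub>R \<xi> p + \<mu> p (X p) *\<^sub>R f p \<and>
          \<tau> p (X p) = 0))"

text \<open>The ambient space is 'f, and r is the codimension.\<close>

definition admits_affine_embedding ::
    "'f::euclidean_space itself \<Rightarrow> nat \<Rightarrow> ('a, 'e::euclidean_space) manifold \<Rightarrow>
     ('a \<Rightarrow> 'a tvec \<Rightarrow> 'a tvec \<Rightarrow> real) \<Rightarrow> ('a, 'a) conn \<Rightarrow> bool" where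
  "admits_affine_embedding TYPE('f) r M g nab \<longleftrightarrow>
     (r = 1 \<and> (\<exists>(f :: 'a \<Rightarrow> 'f) \<xi>. affine_embedding_codim1 M g nab f \<xi>)) \<or>
     (r = 2 \<and> (\<exists>(f :: 'a \<Rightarrow> 'f) \<xi>. affine_embedding_codim2 M g nab f \<xi>))"

definition admits_local_affine_embedding ::
    "'f::euclidean_space itself \<Rightarrow> nat \<Rightarrow> ('a, 'e::euclidean_space) manifold \<Rightarrow>
     ('a \<Rightarrow> 'a tvec \<Rightarrow> 'a tvec \<Rightarrow> real) \<Rightarrow> ('a, 'a) conn \<Rightarrow> bool" where
  "admits_local_affine_embedding TYPE('f) r M g nab \<longleftrightarrow>
     (\<forall>x\<in>points M. \<exists>U. openin (mtop M) U \<and> x \<in> U \<and>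
        admits_affine_embedding TYPE('f) r (restrict_manifold M U) g nab)"

end

theory Submission
  imports Defs
begin

text \<open>
  Near a point, the affine embedding f is the zero section of the local diffeomorphism
  (q, t, s) \<mapsto> f q + t \<xi> q + s f q, where the last term occurs in codimension 2 only.  Let \<phi> be the
  function t + (t^2 + s^2) / 2 in these coordinates.  Along the image, d\<phi> kills the tangent vectors
  and the position vector and takes the value 1 on \<xi>.  Differentiating these identities and using
  the structure equations (with \<tau> = 0) shows that the Hessian of \<phi> restricts to g on the image
  and that the tangent space is orthogonal to the transverse vectors, on whose frame the Hessian is
  the identity matrix.  So the Hessian is positive definite nearby, and together with the canonical
  flat connection it is the required flat statistical structure.
\<close>

section \<open>Calculus of smooth maps\<close>

text \<open>Why a Hessian: for the flat connection D, the covariant derivative of Hess \<phi> is the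
  third derivative of \<phi>. Total symmetry thus reduces to commuting partial derivatives, and only
  positivity has to be arranged. The two parts of \<phi> have separate tasks. The linear term t
  produces g, because differentiating d\<phi>(Y) = 0 along X leaves Hess(X, Y) = -d\<phi>(D_X Y) =
  g(X, Y). The quadratic term has zero derivative along the image and makes the Hessian positive in
  the transverse directions. With a nonzero \<tau> the mixed entry Hess(X, \<xi>) would be
  -\<tau>(X), and the normal part of D_X Y would then disturb the second condition of a statistical
  embedding. Two obstacles shape the text. Tangent vectors are abstract derivations, so Hadamard's
  lemma is needed to compute with them as directional derivatives. The structure equations speak of
  fields on the whole manifold, whereas the argument works with single vectors and with fields on
  small sets; these are extended by bump functions pulled back along f. Smoothness of \<phi> rests
  on the C^\<infinity> form of the inverse function theorem.\<close>

abbreviation pd :: "('e::euclidean_space \<Rightarrow> 'f::euclidean_space) \<Rightarrow> 'e \<Rightarrow> 'e \<Rightarrow> 'f" where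
  "pd F v x \<equiv> frechet_derivative F (at x) v"

lemma ck_on_subset: "ck_on k F U \<Longrightarrow> V \<subseteq> U \<Longrightarrow> ck_on k F V"
  by (induction k arbitrary: F) (auto intro: continuous_on_subset)

text \<open>Openness of U carries the induction: a derivative at x depends on the values near x, so
  equality on U passes on to the directional derivatives.\<close>

lemma ck_on_cong:
  assumes "ck_on k F U" "open U" "\<And>x. x \<in> U \<Longrightarrow> F x = G x"
  shows "ck_on k G U"
  using assms
proof (induction k arbitrary: F G)
  case 0
  then show ?case using continuous_on_cong[of U U F G] by simp
next
  case (Suc k)
  have d: "F differentiable (at x)" if "x \<in> U" for x using Suc.prems that by simp
  have e: "pd F v x = pd G v x" if "x \<in> U" for x v
    using frechet_derivative_transform_within_open[OF d[OF that] Suc.prems(2) that Suc.prems(3)]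
    by metis
  have "G differentiable (at x)" if "x \<in> U" for x
    using has_derivative_transform_within_open[of F _ x UNIV U G] d[OF that] Suc.prems(2,3) that
    unfolding differentiable_def by auto
  moreover have "ck_on k (pd G v) U" for v
    by (rule Suc.IH[of "pd F v"]) (use Suc.prems e in auto)
  ultimately show ?case by simp
qed

lemma ck_on_SucD: "ck_on (Suc k) F U \<Longrightarrow> ck_on k F U"
proof (induction k arbitrary: F)
  case 0
  then show ?case
    by (auto intro!: continuous_at_imp_continuous_on differentiable_imp_continuous_within)
next
  case (Suc k)
  have "ck_on k (pd F v) U" for v
  proof (rule Suc.IH)
    show "ck_on (Suc k) (pd F v) U"
      using Suc.prems ck_on.simps(2)[of "Suc k" F U] by blast
  qed
  then show ?case using Suc.prems by simp
qed

text \<open>\<open>frechet_derivative\<close> is a choice operator. This rule replaces it by any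
  explicit derivative, so that later inductions on the order only need a formula that has order k in
  each fixed direction.\<close>

lemma ck_on_SucI:
  assumes "open U" "\<And>x. x \<in> U \<Longrightarrow> (F has_derivative F' x) (at x)" "\<And>v. ck_on k (\<lambda>x. F' x v) U"
  shows "ck_on (Suc k) F U"
proof -
  have e: "pd F v x = F' x v" if "x \<in> U" for x v
    using frechet_derivative_at[OF assms(2)[OF that]] by simp
  have "ck_on k (pd F v) U" for v
    by (rule ck_on_cong[OF assms(3)[of v] assms(1)]) (simp add: e)
  then show ?thesis using assms(2) by (auto simp: differentiable_def)
qed

lemma ck_on_has_derivative:
  "ck_on (Suc k) F U \<Longrightarrow> x \<in> U \<Longrightarrow> (F has_derivative frechet_derivative F (at x)) (at x)"
  by (simp add: frechet_derivative_works)

lemma ck_on_pd: "ck_on (Suc k) F U \<Longrightarrow> ck_on k (pd F v) U"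
  by simp

lemma ck_on_const: "open U \<Longrightarrow> ck_on k (\<lambda>x. c) U"
  by (induction k arbitrary: c) auto

lemma ck_on_bounded_linear:
  assumes "open U" "bounded_linear L" "ck_on k F U"
  shows "ck_on k (\<lambda>x. L (F x)) U"
  using assms(3)
proof (induction k arbitrary: F)
  case 0
  then show ?case using assms(2) by (auto intro: bounded_linear.continuous_on)
next
  case (Suc k)
  show ?case
  proof (rule ck_on_SucI[OF assms(1)])
    show "((\<lambda>x. L (F x)) has_derivative (\<lambda>v. L (pd F v x))) (at x)" if "x \<in> U" for x
      by (rule bounded_linear.has_derivative[OF assms(2) ck_on_has_derivative[OF Suc.prems that]])
    show "ck_on k (\<lambda>x. L (pd F v x)) U" for v
      using Suc by auto
  qed
qed

lemma ck_on_linear: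
  assumes "open U" "bounded_linear L"
  shows "ck_on k L U"
proof (cases k)
  case 0
  then show ?thesis using assms by (simp add: linear_continuous_on)
next
  case (Suc j)
  have "ck_on (Suc j) L U"
    by (rule ck_on_SucI[OF assms(1), of _ "\<lambda>x. L"])
       (use assms in \<open>auto intro: bounded_linear_imp_has_derivative ck_on_const\<close>)
  then show ?thesis using Suc by simp
qed

lemma ck_on_ident: "open U \<Longrightarrow> ck_on k (\<lambda>x. x) U"
  by (rule ck_on_linear) (auto intro: bounded_linear_ident)

lemma ck_on_add:
  assumes "open U" "ck_on k F U" "ck_on k G U"
  shows "ck_on k (\<lambda>x. F x + G x) U"
  using assms(2,3)
proof (induction k arbitrary: F G)
  case 0
  then show ?case by (auto intro: continuous_on_add)
next
  case (Suc k)
  show ?case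
  proof (rule ck_on_SucI[OF assms(1)])
    show "((\<lambda>x. F x + G x) has_derivative (\<lambda>v. pd F v x + pd G v x)) (at x)" if "x \<in> U" for x
      by (intro has_derivative_add ck_on_has_derivative[OF Suc.prems(1) that] ck_on_has_derivative[OF Suc.prems(2) that])
    show "ck_on k (\<lambda>x. pd F v x + pd G v x) U" for v
      using Suc.IH[of "pd F v" "pd G v"] Suc.prems by simp
  qed
qed

text \<open>Product rule: the derivative is a sum of two values of \<open>B\<close>, each with one
  differentiated argument, so the induction hypothesis must allow both arguments to change.\<close>

lemma ck_on_bilinear:
  assumes "open U" "bounded_bilinear B" "ck_on k F U" "ck_on k G U"
  shows "ck_on k (\<lambda>x. B (F x) (G x)) U"
  using assms(3,4)
proof (induction k arbitrary: F G)
  case 0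
  then show ?case using assms(2) by (auto intro: bounded_bilinear.continuous_on)
next
  case (Suc k)
  show ?case
  proof (rule ck_on_SucI[OF assms(1)])
    show "((\<lambda>x. B (F x) (G x)) has_derivative (\<lambda>v. B (F x) (pd G v x) + B (pd F v x) (G x))) (at x)"
      if "x \<in> U" for x
      by (rule bounded_bilinear.FDERIV[OF assms(2) ck_on_has_derivative[OF Suc.prems(1) that] ck_on_has_derivative[OF Suc.prems(2) that]])
    show "ck_on k (\<lambda>x. B (F x) (pd G v x) + B (pd F v x) (G x)) U" for v
      using Suc.IH[OF ck_on_SucD[OF Suc.prems(1)] ck_on_pd[OF Suc.prems(2), of v]]
        Suc.IH[OF ck_on_pd[OF Suc.prems(1), of v] ck_on_SucD[OF Suc.prems(2)]]
      by (rule ck_on_add[OF assms(1)])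
  qed
qed

lemmas ck_on_mult = ck_on_bilinear[OF _ bounded_bilinear_mult]
lemmas ck_on_scaleR = ck_on_bilinear[OF _ bounded_bilinear_scaleR]
lemmas ck_on_inner = ck_on_bilinear[OF _ bounded_bilinear_inner]

lemma ck_on_sum:
  assumes "open U" "\<And>i. i \<in> I \<Longrightarrow> ck_on k (F i) U"
  shows "ck_on k (\<lambda>x. \<Sum>i\<in>I. F i x) U"
  using assms(2)
  by (induction I rule: infinite_finite_induct) (auto intro: ck_on_const ck_on_add assms(1))

lemma ck_on_componentwise:
  fixes F :: "'e::euclidean_space \<Rightarrow> 'f::euclidean_space"
  assumes "open U" "\<And>b. b \<in> Basis \<Longrightarrow> ck_on k (\<lambda>x. F x \<bullet> b) U"
  shows "ck_on k F U"
proof -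
  have "ck_on k (\<lambda>x. \<Sum>b\<in>Basis. (F x \<bullet> b) *\<^sub>R b) U"
    by (intro ck_on_sum ck_on_scaleR ck_on_const assms)
  then show ?thesis by (simp add: euclidean_representation)
qed

text \<open>\<open>ck_on\<close> controls derivatives in fixed directions only. Expanding over the
  basis turns a derivative in a direction that moves with the point into a combination of such
  derivatives with varying coefficients.\<close>

lemma linear_expand:
  fixes L :: "'e::euclidean_space \<Rightarrow> 'f::real_vector"
  assumes "linear L"
  shows "L v = (\<Sum>b\<in>Basis. (v \<bullet> b) *\<^sub>R L b)"
proof -
  have "L v = L (\<Sum>b\<in>Basis. (v \<bullet> b) *\<^sub>R b)" by (simp add: euclidean_representation)
  also have "\<dots> = (\<Sum>b\<in>Basis. (v \<bullet> b) *\<^sub>R L b)"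
    by (simp add: linear_sum[OF assms] linear_scale[OF assms])
  finally show ?thesis .
qed

lemma ck_on_compose:
  assumes "open U" "open V" "F ` U \<subseteq> V" "ck_on k F U" "ck_on k G V"
  shows "ck_on k (\<lambda>x. G (F x)) U"
  using assms(4,5)
proof (induction k arbitrary: G)
  case 0
  then show ?case using assms(3) by (auto intro: continuous_on_compose2)
next
  case (Suc k)
  have hG: "(G has_derivative frechet_derivative G (at (F x))) (at (F x))" if "x \<in> U" for x
    using Suc.prems(2) assms(3) that by (intro ck_on_has_derivative) auto
  show ?case
  proof (rule ck_on_SucI[OF assms(1)])
    fix x assume x: "x \<in> U"
    have "((\<lambda>x. G (F x)) has_derivative (\<lambda>v. pd G (pd F v x) (F x))) (at x)"
      using has_derivative_compose[OF ck_on_has_derivative[OF Suc.prems(1) x] hG[OF x]] .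
    \<comment> \<open>The chain rule differentiates G in the direction \<open>pd F v x\<close>,
      which varies with x; after the expansion only partial derivatives of G in fixed directions
      remain, to which the induction hypothesis applies.\<close>
    moreover have "pd G (pd F v x) (F x) = (\<Sum>b\<in>Basis. (pd F v x \<bullet> b) *\<^sub>R pd G b (F x))" for v
      by (rule linear_expand[OF has_derivative_linear[OF hG[OF x]]])
    ultimately show "((\<lambda>x. G (F x)) has_derivative
        (\<lambda>v. \<Sum>b\<in>Basis. (pd F v x \<bullet> b) *\<^sub>R pd G b (F x))) (at x)"
      by simp
  next
    fix v
    show "ck_on k (\<lambda>x. \<Sum>b\<in>Basis. (pd F v x \<bullet> b) *\<^sub>R pd G b (F x)) U"
      using Suc.prems
      by (intro ck_on_sum ck_on_scaleR ck_on_inner ck_on_const assms(1) Suc.IH ck_on_pd)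
         (auto intro: ck_on_SucD)
  qed
qed

text \<open>The derivative of 1/h contains 1/h again and only one derivative of h, so the order of
  regularity of 1/h is raised one step at a time.\<close>

lemma ck_on_inverse:
  fixes h :: "'e::euclidean_space \<Rightarrow> real"
  assumes "open U" "ck_on k h U" "\<And>x. x \<in> U \<Longrightarrow> h x \<noteq> 0"
  shows "ck_on k (\<lambda>x. inverse (h x)) U"
  using assms(2)
proof (induction k)
  case 0
  then show ?case using assms(3) by (auto intro: continuous_on_inverse)
next
  case (Suc k)
  show ?case
  proof (rule ck_on_SucI[OF assms(1)])
    show "((\<lambda>x. inverse (h x)) has_derivative (\<lambda>v. - (inverse (h x) * pd h v x * inverse (h x)))) (at x)"
      if "x \<in> U" for x
      using Deriv.has_derivative_inverse[OF assms(3)[OF that] ck_on_has_derivative[OF Suc.prems that]] .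
    show "ck_on k (\<lambda>x. - (inverse (h x) * pd h v x * inverse (h x))) U" for v
      using Suc.IH[OF ck_on_SucD[OF Suc.prems]] ck_on_pd[OF Suc.prems, of v] assms(1)
      by (intro ck_on_bounded_linear[OF _ bounded_linear_minus[OF bounded_linear_ident]] ck_on_mult)
  qed
qed

lemma ck_on_local:
  assumes "\<And>x. x \<in> U \<Longrightarrow> \<exists>N. open N \<and> x \<in> N \<and> ck_on k F N"
  shows "ck_on k F U"
  using assms
proof (induction k arbitrary: F)
  case 0
  have "isCont F x" if "x \<in> U" for x
    using 0[OF that] continuous_on_eq_continuous_at[of _ F] by auto
  then show ?case by (simp add: continuous_at_imp_continuous_on)
next
  case (Suc k)
  have "F differentiable (at x)" if "x \<in> U" for x
    using Suc.prems[OF that] by auto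
  moreover have "ck_on k (pd F v) U" for v
  proof (rule Suc.IH)
    fix x assume "x \<in> U"
    then obtain N where "open N" "x \<in> N" "ck_on (Suc k) F N" using Suc.prems by blast
    then show "\<exists>N. open N \<and> x \<in> N \<and> ck_on k (pd F v) N" by (intro exI[of _ N]) simp
  qed
  ultimately show ?case by simp
qed

section \<open>C^\<infinity> maps: the rules for all finite orders at once\<close>

lemma smooth_on_subset: "smooth_on F U \<Longrightarrow> V \<subseteq> U \<Longrightarrow> smooth_on F V"
  unfolding smooth_on_def using ck_on_subset by blast

lemma smooth_on_cong:
  "smooth_on F U \<Longrightarrow> open U \<Longrightarrow> (\<And>x. x \<in> U \<Longrightarrow> F x = G x) \<Longrightarrow> smooth_on G U"
  unfolding smooth_on_def using ck_on_cong by blast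

lemma smooth_on_cong_iff:
  "open U \<Longrightarrow> (\<And>x. x \<in> U \<Longrightarrow> F x = G x) \<Longrightarrow> smooth_on F U \<longleftrightarrow> smooth_on G U"
  using smooth_on_cong[of F U G] smooth_on_cong[of G U F] by auto

lemma smooth_on_local:
  "(\<And>x. x \<in> U \<Longrightarrow> \<exists>N. open N \<and> x \<in> N \<and> smooth_on F N) \<Longrightarrow> smooth_on F U"
  unfolding smooth_on_def by (intro allI ck_on_local) blast

lemma smooth_on_pd: "smooth_on F U \<Longrightarrow> smooth_on (pd F v) U"
  unfolding smooth_on_def using ck_on_pd by blast

lemma smooth_on_has_derivative:
  "smooth_on F U \<Longrightarrow> x \<in> U \<Longrightarrow> (F has_derivative frechet_derivative F (at x)) (at x)"
  unfolding smooth_on_def using ck_on_has_derivative by blast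

lemma smooth_on_linear_pd: "smooth_on F U \<Longrightarrow> x \<in> U \<Longrightarrow> linear (\<lambda>v. pd F v x)"
  using has_derivative_linear[OF smooth_on_has_derivative] by auto

lemma smooth_on_continuous: "smooth_on F U \<Longrightarrow> continuous_on U F"
  unfolding smooth_on_def by (metis ck_on.simps(1))

lemma smooth_on_const: "open U \<Longrightarrow> smooth_on (\<lambda>x. c) U"
  by (simp add: smooth_on_def ck_on_const)

lemma smooth_on_linear: "open U \<Longrightarrow> bounded_linear L \<Longrightarrow> smooth_on L U"
  by (simp add: smooth_on_def ck_on_linear)

lemma smooth_on_ident: "open U \<Longrightarrow> smooth_on (\<lambda>x. x) U"
  by (simp add: smooth_on_def ck_on_ident)

lemma smooth_on_add: "open U \<Longrightarrow> smooth_on F U \<Longrightarrow> smooth_on G U \<Longrightarrow> smooth_on (\<lambda>x. F x + G x) U"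
  by (simp add: smooth_on_def ck_on_add)

lemma smooth_on_mult:
  fixes F G :: "'e::euclidean_space \<Rightarrow> real"
  shows "open U \<Longrightarrow> smooth_on F U \<Longrightarrow> smooth_on G U \<Longrightarrow> smooth_on (\<lambda>x. F x * G x) U"
  by (simp add: smooth_on_def ck_on_mult)

lemma smooth_on_scaleR: "open U \<Longrightarrow> smooth_on F U \<Longrightarrow> smooth_on G U \<Longrightarrow> smooth_on (\<lambda>x. F x *\<^sub>R G x) U"
  by (simp add: smooth_on_def ck_on_scaleR)

lemma smooth_on_inner: "open U \<Longrightarrow> smooth_on F U \<Longrightarrow> smooth_on G U \<Longrightarrow> smooth_on (\<lambda>x. F x \<bullet> G x) U"
  by (simp add: smooth_on_def ck_on_inner)

lemma smooth_on_sum: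
  "open U \<Longrightarrow> (\<And>i. i \<in> I \<Longrightarrow> smooth_on (F i) U) \<Longrightarrow> smooth_on (\<lambda>x. \<Sum>i\<in>I. F i x) U"
  by (simp add: smooth_on_def ck_on_sum)

lemma smooth_on_componentwise:
  "open U \<Longrightarrow> (\<And>b. b \<in> Basis \<Longrightarrow> smooth_on (\<lambda>x. F x \<bullet> b) U) \<Longrightarrow> smooth_on F U"
  by (simp add: smooth_on_def ck_on_componentwise)

lemma smooth_on_compose:
  "open U \<Longrightarrow> open V \<Longrightarrow> F ` U \<subseteq> V \<Longrightarrow> smooth_on F U \<Longrightarrow> smooth_on G V \<Longrightarrow> smooth_on (\<lambda>x. G (F x)) U"
  by (simp add: smooth_on_def ck_on_compose[of U V])

lemma smooth_on_inverse:
  fixes h :: "'e::euclidean_space \<Rightarrow> real"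
  shows "open U \<Longrightarrow> smooth_on h U \<Longrightarrow> (\<And>x. x \<in> U \<Longrightarrow> h x \<noteq> 0) \<Longrightarrow> smooth_on (\<lambda>x. inverse (h x)) U"
  by (simp add: smooth_on_def ck_on_inverse)

lemma smooth_on_bounded_linear:
  "open U \<Longrightarrow> bounded_linear L \<Longrightarrow> smooth_on F U \<Longrightarrow> smooth_on (\<lambda>x. L (F x)) U"
  by (simp add: smooth_on_def ck_on_bounded_linear)

lemmas smooth_on_intros =
  smooth_on_const smooth_on_ident smooth_on_add smooth_on_mult smooth_on_scaleR smooth_on_inner
  smooth_on_sum

subsection \<open>Symmetry of second derivatives\<close>

lemma smooth_on_line_deriv:
  assumes "smooth_on F U" "x + s *\<^sub>R v \<in> U"
  shows "((\<lambda>s. F (x + s *\<^sub>R v)) has_vector_derivative pd F v (x + s *\<^sub>R v)) (at s)"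
proof -
  have "((\<lambda>s. x + s *\<^sub>R v) has_derivative (\<lambda>h. h *\<^sub>R v)) (at s)"
    by (auto intro!: derivative_eq_intros)
  from has_derivative_compose[OF this smooth_on_has_derivative[OF assms]]
  show ?thesis
    using linear_scale[OF smooth_on_linear_pd[OF assms]]
    by (simp add: has_vector_derivative_def)
qed

text \<open>Two applications of the mean value theorem to the second difference over the
  parallelogram with sides s v and s w: in direction v to the increment in w, then in direction w to
  the derivative in v.\<close>

lemma mixed_mean_value:
  fixes F :: "'e::euclidean_space \<Rightarrow> real"
  assumes F: "smooth_on F U" and s: "s > 0"
    and sub: "\<And>a b. 0 \<le> a \<Longrightarrow> a \<le> s \<Longrightarrow> 0 \<le> b \<Longrightarrow> b \<le> s \<Longrightarrow> x + a *\<^sub>R v + b *\<^sub>R w \<in> U"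
  shows "\<exists>a b. 0 \<le> a \<and> a \<le> s \<and> 0 \<le> b \<and> b \<le> s \<and>
    F (x + s *\<^sub>R v + s *\<^sub>R w) - F (x + s *\<^sub>R v) - F (x + s *\<^sub>R w) + F x =
      s * s * pd (pd F v) w (x + a *\<^sub>R v + b *\<^sub>R w)"
proof -
  define G where "G a = F ((x + s *\<^sub>R w) + a *\<^sub>R v) - F (x + a *\<^sub>R v)" for a
  have 1: "(G has_field_derivative (pd F v ((x + s *\<^sub>R w) + a *\<^sub>R v) - pd F v (x + a *\<^sub>R v))) (at a)"
    if "0 \<le> a" "a \<le> s" for a
    unfolding G_def has_real_derivative_iff_has_vector_derivative
    by (intro has_vector_derivative_diff smooth_on_line_deriv[OF F])
       (use sub[of a s] sub[of a 0] that s in \<open>auto simp: algebra_simps\<close>)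
  obtain a where a: "0 < a" "a < s"
      "G s - G 0 = (s - 0) * (pd F v ((x + s *\<^sub>R w) + a *\<^sub>R v) - pd F v (x + a *\<^sub>R v))"
    using MVT2[OF s 1] by blast
  define H where "H b = pd F v ((x + a *\<^sub>R v) + b *\<^sub>R w)" for b
  have 2: "(H has_field_derivative (pd (pd F v) w ((x + a *\<^sub>R v) + b *\<^sub>R w))) (at b)"
    if "0 \<le> b" "b \<le> s" for b
    unfolding H_def has_real_derivative_iff_has_vector_derivative
    by (intro smooth_on_line_deriv[OF smooth_on_pd[OF F]]) (use sub[of a b] a that in auto)
  obtain b where b: "0 < b" "b < s" "H s - H 0 = (s - 0) * pd (pd F v) w ((x + a *\<^sub>R v) + b *\<^sub>R w)"
    using MVT2[OF s 2] by blast
  have "F (x + s *\<^sub>R v + s *\<^sub>R w) - F (x + s *\<^sub>R v) - F (x + s *\<^sub>R w) + F x = G s - G 0"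
    by (simp add: G_def algebra_simps)
  also have "\<dots> = s * (H s - H 0)" using a(3) by (simp add: H_def algebra_simps)
  also have "\<dots> = s * s * pd (pd F v) w (x + a *\<^sub>R v + b *\<^sub>R w)" using b(3) by simp
  finally show ?thesis using a b by (intro exI[of _ a] exI[of _ b]) auto
qed

text \<open>The second difference is symmetric in v and w, so in every small parallelogram at x the
  two mixed derivatives take a common value, possibly at different points. Continuity carries both
  points to x.\<close>

lemma pd_commute:
  fixes F :: "'e::euclidean_space \<Rightarrow> real"
  assumes U: "open U" and F: "smooth_on F U" and x: "x \<in> U"
  shows "pd (pd F v) w x = pd (pd F w) v x"
proof (rule ccontr)
  assume ne: "\<not> ?thesis"
  \<comment> \<open>Half of the supposed gap: a common value within e of both numbers puts them at
    distance less than 2e, which is the gap itself.\<close>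
  define e where "e = \<bar>pd (pd F v) w x - pd (pd F w) v x\<bar> / 2"
  have e: "e > 0" using ne by (simp add: e_def)
  have c: "continuous_on U (pd (pd F a) b)" for a b
    by (intro smooth_on_continuous smooth_on_pd F)
  obtain d1 where d1: "d1 > 0" "\<And>y. y \<in> U \<Longrightarrow> dist y x < d1 \<Longrightarrow> dist (pd (pd F v) w y) (pd (pd F v) w x) < e"
    using c[of v w] x e unfolding continuous_on_iff by blast
  obtain d2 where d2: "d2 > 0" "\<And>y. y \<in> U \<Longrightarrow> dist y x < d2 \<Longrightarrow> dist (pd (pd F w) v y) (pd (pd F w) v x) < e"
    using c[of w v] x e unfolding continuous_on_iff by blast
  obtain d3 where d3: "d3 > 0" "ball x d3 \<subseteq> U" using U x openE by blast
  define d where "d = min d1 (min d2 d3)"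
  \<comment> \<open>Keeps the whole parallelogram within distance d of x; the summand 1 covers the
    case v = w = 0.\<close>
  define s where "s = d / (norm v + norm w + 1)"
  have d: "d > 0" using d1 d2 d3 by (simp add: d_def)
  have n: "norm v + norm w + 1 > 0" by (smt (verit) norm_ge_zero)
  have s: "s > 0" using d n by (simp add: s_def)
  have near: "dist (x + a *\<^sub>R v + b *\<^sub>R w) x < d" if "0 \<le> a" "a \<le> s" "0 \<le> b" "b \<le> s" for a b
  proof -
    have "dist (x + a *\<^sub>R v + b *\<^sub>R w) x = norm (a *\<^sub>R v + b *\<^sub>R w)" by (simp add: dist_norm algebra_simps)
    also have "\<dots> \<le> a * norm v + b * norm w"
      using norm_triangle_ineq[of "a *\<^sub>R v" "b *\<^sub>R w"] that by simp
    also have "\<dots> \<le> s * norm v + s * norm w"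
      using that by (intro add_mono mult_right_mono) auto
    also have "\<dots> < s * (norm v + norm w + 1)" using s by (simp add: algebra_simps)
    also have "\<dots> = d" using n by (simp add: s_def)
    finally show ?thesis .
  qed
  have sub: "x + a *\<^sub>R v + b *\<^sub>R w \<in> U" if "0 \<le> a" "a \<le> s" "0 \<le> b" "b \<le> s" for a b
    using near[OF that] d3 by (auto simp: d_def dist_commute)
  have sub': "x + a *\<^sub>R w + b *\<^sub>R v \<in> U" if "0 \<le> a" "a \<le> s" "0 \<le> b" "b \<le> s" for a b
    using sub[OF that(3,4,1,2)] by (simp add: algebra_simps)
  obtain a b where ab: "0 \<le> a" "a \<le> s" "0 \<le> b" "b \<le> s"
    "F (x + s *\<^sub>R v + s *\<^sub>R w) - F (x + s *\<^sub>R v) - F (x + s *\<^sub>R w) + F x =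
      s * s * pd (pd F v) w (x + a *\<^sub>R v + b *\<^sub>R w)"
    using mixed_mean_value[OF F s sub] by blast
  obtain a' b' where ab': "0 \<le> a'" "a' \<le> s" "0 \<le> b'" "b' \<le> s"
    "F (x + s *\<^sub>R w + s *\<^sub>R v) - F (x + s *\<^sub>R w) - F (x + s *\<^sub>R v) + F x =
      s * s * pd (pd F w) v (x + a' *\<^sub>R w + b' *\<^sub>R v)"
    using mixed_mean_value[OF F s sub'] by blast
  have "s * s * pd (pd F v) w (x + a *\<^sub>R v + b *\<^sub>R w) = s * s * pd (pd F w) v (x + b' *\<^sub>R v + a' *\<^sub>R w)"
    using ab(5) ab'(5) by (simp add: algebra_simps)
  then have eq: "pd (pd F v) w (x + a *\<^sub>R v + b *\<^sub>R w) = pd (pd F w) v (x + b' *\<^sub>R v + a' *\<^sub>R w)"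
    using s by simp
  have "dist (pd (pd F v) w (x + a *\<^sub>R v + b *\<^sub>R w)) (pd (pd F v) w x) < e"
    using d1(2)[OF sub[OF ab(1-4)]] near[OF ab(1-4)] by (simp add: d_def)
  then have n1: "dist (pd (pd F w) v (x + b' *\<^sub>R v + a' *\<^sub>R w)) (pd (pd F v) w x) < e"
    unfolding eq .
  have n2: "dist (pd (pd F w) v (x + b' *\<^sub>R v + a' *\<^sub>R w)) (pd (pd F w) v x) < e"
    using d2(2)[OF sub[OF ab'(3,4,1,2)]] near[OF ab'(3,4,1,2)] by (simp add: d_def)
  have "dist (pd (pd F v) w x) (pd (pd F w) v x) < 2 * e"
    using dist_triangle3[of "pd (pd F v) w x" "pd (pd F w) v x" "pd (pd F w) v (x + b' *\<^sub>R v + a' *\<^sub>R w)"]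
      n1 n2 by linarith
  then show False unfolding e_def dist_real_def by simp
qed

subsection \<open>Hadamard's lemma\<close>

lemma continuous_on_radial:
  fixes w :: "'e::euclidean_space \<Rightarrow> real"
  assumes "continuous_on C w" "\<And>x t. x \<in> C \<Longrightarrow> t \<in> {0..1} \<Longrightarrow> p + t *\<^sub>R (x - p) \<in> C"
  shows "continuous_on (C \<times> cbox 0 1) (\<lambda>z. snd z ^ n * w (p + snd z *\<^sub>R (fst z - p)))"
proof -
  have "continuous_on (C \<times> cbox (0::real) 1) (\<lambda>z. w (p + snd z *\<^sub>R (fst z - p)))"
    by (rule continuous_on_compose2[OF assms(1)]) (use assms(2) in \<open>auto intro!: continuous_intros\<close>)
  then show ?thesis by (intro continuous_on_mult continuous_on_power continuous_on_snd continuous_on_id)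
qed

text \<open>Differentiating under the integral sign in direction v replaces u by
  \<open>pd u v\<close> and, by the chain rule, produces one more factor t. This is why the weight
  \<open>t ^ m\<close> is present and m is arbitrary in the induction.\<close>

lemma ck_on_radial_integral:
  fixes u :: "'e::euclidean_space \<Rightarrow> real"
  assumes C: "open C" "convex C" "p \<in> C" and u: "ck_on k u C"
  shows "ck_on k (\<lambda>x. integral {0..1} (\<lambda>t. t ^ m * u (p + t *\<^sub>R (x - p)))) C"
  using u
proof (induction k arbitrary: u m)
  case 0
  have in_C: "p + t *\<^sub>R (x - p) \<in> C" if "x \<in> C" "t \<in> {0..1}" for x t
    using convexD_alt[OF C(2,3) that(1)] that by (simp add: algebra_simps)
  have "continuous_on (C \<times> cbox 0 1) (\<lambda>(x, t). t ^ m * u (p + t *\<^sub>R (x - p)))"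
    using continuous_on_radial[of C u p m] 0 in_C unfolding split_beta by simp
  from integral_continuous_on_param[OF this] show ?case by simp
next
  case (Suc k)
  have in_C: "p + t *\<^sub>R (x - p) \<in> C" if "x \<in> C" "t \<in> {0..1}" for x t
    using convexD_alt[OF C(2,3) that(1)] that by (simp add: algebra_simps)
  have cu: "continuous_on C u" using Suc.prems ck_on_SucD
    by (metis ck_on.simps(1) ck_on_has_derivative continuous_at_imp_continuous_on has_derivative_continuous)
  have cpd: "continuous_on C (pd u v)" for v
  proof -
    have "ck_on k (pd u v) C" using Suc.prems by simp
    then show ?thesis
      by (cases k) (auto intro!: continuous_at_imp_continuous_on differentiable_imp_continuous_within)
  qed
  have bl: "bounded_linear (\<lambda>v. t ^ Suc m * pd u v (p + t *\<^sub>R (x - p)))" if "x \<in> C" "t \<in> {0..1}" for x t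
    using has_derivative_bounded_linear[OF ck_on_has_derivative[OF Suc.prems in_C[OF that]]]
    by (rule bounded_linear_const_mult)
  \<comment> \<open>The derivative in x is packed into a bounded linear map because
    \<open>leibniz_rule\<close> takes a derivative of that type, continuous in both
    variables.\<close>
  define fx where "fx x t = Blinfun (\<lambda>v. t ^ Suc m * pd u v (p + t *\<^sub>R (x - p)))" for x t
  have fx: "blinfun_apply (fx x t) v = t ^ Suc m * pd u v (p + t *\<^sub>R (x - p))"
    if "x \<in> C" "t \<in> {0..1}" for x t v
    unfolding fx_def by (rule bounded_linear_Blinfun_apply[OF bl[OF that], THEN fun_cong])
  have cfx: "continuous_on (C \<times> cbox 0 1) (\<lambda>(x, t). fx x t)"
    unfolding split_beta
  proof (rule continuous_on_blinfun_componentwise)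
    fix i :: 'e assume "i \<in> Basis"
    have "continuous_on (C \<times> cbox 0 1) (\<lambda>z. snd z ^ Suc m * pd u i (p + snd z *\<^sub>R (fst z - p)))"
      by (rule continuous_on_radial[OF cpd in_C])
    then show "continuous_on (C \<times> cbox 0 1) (\<lambda>z. blinfun_apply (fx (fst z) (snd z)) i)"
      by (rule continuous_on_eq) (auto simp: fx)
  qed
  have deriv: "((\<lambda>x. integral (cbox 0 1) (\<lambda>t. t ^ m * u (p + t *\<^sub>R (x - p)))) has_derivative
      integral (cbox 0 1) (fx x)) (at x)" if x: "x \<in> C" for x
  proof -
    have "((\<lambda>x. integral (cbox 0 1) (\<lambda>t. t ^ m * u (p + t *\<^sub>R (x - p)))) has_derivative
      blinfun_apply (integral (cbox 0 1) (fx x))) (at x within C)"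
    proof (rule leibniz_rule[OF _ _ cfx x C(2)])
      fix y t assume y: "y \<in> C" and t: "t \<in> cbox (0::real) 1"
      have t': "t \<in> {0..1}" using t by simp
      have "((\<lambda>y. p + t *\<^sub>R (y - p)) has_derivative (\<lambda>v. t *\<^sub>R v)) (at y within C)"
        by (auto intro!: derivative_eq_intros)
      from has_derivative_compose[OF this ck_on_has_derivative[OF Suc.prems in_C[OF y t']]]
      have "((\<lambda>y. t ^ m * u (p + t *\<^sub>R (y - p))) has_derivative
          (\<lambda>v. t ^ m * pd u (t *\<^sub>R v) (p + t *\<^sub>R (y - p)))) (at y within C)"
        by (rule has_derivative_mult_right)
      moreover have "(\<lambda>v. t ^ m * pd u (t *\<^sub>R v) (p + t *\<^sub>R (y - p))) = blinfun_apply (fx y t)"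
        using linear_scale[OF has_derivative_linear[OF ck_on_has_derivative[OF Suc.prems in_C[OF y t']]]]
        by (auto simp: fx[OF y t'])
      ultimately show "((\<lambda>y. t ^ m * u (p + t *\<^sub>R (y - p))) has_derivative blinfun_apply (fx y t)) (at y within C)"
        by simp
    next
      fix y assume y: "y \<in> C"
      show "(\<lambda>t. t ^ m * u (p + t *\<^sub>R (y - p))) integrable_on cbox 0 1"
      proof (intro integrable_continuous continuous_on_mult continuous_on_power continuous_on_id)
        have "continuous_on (cbox 0 1) (\<lambda>t::real. p + t *\<^sub>R (y - p))"
          by (intro continuous_intros)
        then show "continuous_on (cbox 0 1) (\<lambda>t. u (p + t *\<^sub>R (y - p)))"
          by (rule continuous_on_compose2[OF cu]) (use in_C[OF y] in auto)
      qed
    qed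
    then show ?thesis unfolding at_within_open[OF x C(1)] .
  qed
  have app: "blinfun_apply (integral (cbox 0 1) (fx x)) v =
      integral {0..1} (\<lambda>t. t ^ Suc m * pd u v (p + t *\<^sub>R (x - p)))" if x: "x \<in> C" for x v
  proof -
    have "continuous_on (cbox (0::real) 1) (\<lambda>t. (x, t))" by (intro continuous_intros)
    from continuous_on_compose2[OF cfx this] x have "continuous_on (cbox 0 1) (fx x)"
      by (simp add: image_subset_iff)
    then have "fx x integrable_on cbox 0 1" by (rule integrable_continuous)
    then have "blinfun_apply (integral (cbox 0 1) (fx x)) v = integral (cbox 0 1) (\<lambda>t. blinfun_apply (fx x t) v)"
      using integral_linear[of "fx x" "cbox 0 1" "\<lambda>b. blinfun_apply b v"]
      by (simp add: o_def blinfun.bounded_linear_left)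
    also have "\<dots> = integral {0..1} (\<lambda>t. t ^ Suc m * pd u v (p + t *\<^sub>R (x - p)))"
      using fx[OF x] by (auto intro!: integral_cong)
    finally show ?thesis .
  qed
  show ?case
  proof (rule ck_on_SucI[OF C(1)])
    show "((\<lambda>x. integral {0..1} (\<lambda>t. t ^ m * u (p + t *\<^sub>R (x - p)))) has_derivative
      integral (cbox 0 1) (fx x)) (at x)" if "x \<in> C" for x
      using deriv[OF that] by simp
    show "ck_on k (\<lambda>x. blinfun_apply (integral (cbox 0 1) (fx x)) v) C" for v
      by (rule ck_on_cong[OF Suc.IH[OF ck_on_pd[OF Suc.prems], of "Suc m" v] C(1) app[symmetric]])
  qed
qed

text \<open>The fundamental theorem of calculus on the segment from p to x, with the derivative in
  direction x - p expanded over the basis. Smoothness of the coefficients \<open>H b\<close> is the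
  point: a derivation at p can then be applied to each product.\<close>

lemma hadamard:
  fixes h :: "'e::euclidean_space \<Rightarrow> real"
  assumes C: "open C" "convex C" "p \<in> C" and h: "smooth_on h C"
  obtains H where "\<And>b. b \<in> Basis \<Longrightarrow> smooth_on (H b) C"
    "\<And>b. H b p = pd h b p"
    "\<And>x. x \<in> C \<Longrightarrow> h x = h p + (\<Sum>b\<in>Basis. ((x - p) \<bullet> b) * H b x)"
proof
  define H where "H b x = integral {0..1} (\<lambda>t. pd h b (p + t *\<^sub>R (x - p)))" for b x
  show "smooth_on (H b) C" for b
    unfolding smooth_on_def H_def
    using ck_on_radial_integral[OF C, of _ "pd h b" 0] smooth_on_pd[OF h, of b]
    by (simp add: smooth_on_def)
  show "H b p = pd h b p" for b by (simp add: H_def)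
  fix x assume x: "x \<in> C"
  have in_C: "p + t *\<^sub>R (x - p) \<in> C" if "t \<in> {0..1}" for t
    using convexD_alt[OF C(2,3) x] that by (simp add: algebra_simps)
  have line: "continuous_on {0..1} (\<lambda>t::real. p + t *\<^sub>R (x - p))" by (intro continuous_intros)
  have cp: "continuous_on C (pd h b)" for b by (rule smooth_on_continuous[OF smooth_on_pd[OF h]])
  have int: "(\<lambda>t. pd h b (p + t *\<^sub>R (x - p))) integrable_on {0..1}" for b
    by (rule integrable_continuous_interval,
        rule continuous_on_compose2[OF cp line image_subsetI[OF in_C]])
  have "((\<lambda>t. pd h (x - p) (p + t *\<^sub>R (x - p))) has_integral (h (p + 1 *\<^sub>R (x - p)) - h (p + 0 *\<^sub>R (x - p)))) {0..1}"
  proof (rule fundamental_theorem_of_calculus)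
    fix t :: real assume "t \<in> {0..1}"
    from smooth_on_line_deriv[OF h in_C[OF this]]
    show "((\<lambda>t. h (p + t *\<^sub>R (x - p))) has_vector_derivative pd h (x - p) (p + t *\<^sub>R (x - p))) (at t within {0..1})"
      by (rule has_vector_derivative_at_within)
  qed simp
  then have "h x - h p = integral {0..1} (\<lambda>t. pd h (x - p) (p + t *\<^sub>R (x - p)))"
    by (simp add: integral_unique)
  also have "\<dots> = integral {0..1} (\<lambda>t. \<Sum>b\<in>Basis. ((x - p) \<bullet> b) * pd h b (p + t *\<^sub>R (x - p)))"
    using linear_expand[OF smooth_on_linear_pd[OF h in_C], of _ "x - p"]
    by (intro integral_cong) (simp only: real_scaleR_def)
  also have "\<dots> = (\<Sum>b\<in>Basis. ((x - p) \<bullet> b) * H b x)"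
    unfolding H_def by (subst integral_sum) (simp_all add: integrable_on_mult_right int)
  finally show "h x = h p + (\<Sum>b\<in>Basis. ((x - p) \<bullet> b) * H b x)" by simp
qed

subsection \<open>Bump functions\<close>

text \<open>The powers of 1/x make the family closed under differentiation up to linear
  combinations, so all members are shown to be smooth by one simultaneous induction.\<close>

definition flat_exp :: "nat \<Rightarrow> real \<Rightarrow> real" where
  "flat_exp n x = (if x > 0 then exp (- inverse x) * inverse x ^ n else 0)"

text \<open>A single term of the exponential series is kept: exp y is at least y^(n+2)/(n+2)! for y
  = 1/x. The exponent n + 2 leaves a factor x squared, which makes the difference quotient at 0
  vanish in the limit.\<close>

lemma flat_exp_bound: "\<bar>flat_exp n x\<bar> \<le> fact (n + 2) * x\<^sup>2"
proof (cases "x > 0")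
  case True
  define y where "y = inverse x"
  have y: "y > 0" using True by (simp add: y_def)
  have "(\<lambda>k. y ^ k /\<^sub>R fact k) sums exp y" by (rule exp_converges)
  then have "(\<Sum>k\<in>{n+2}. y ^ k /\<^sub>R fact k) \<le> exp y"
    using y by (intro sum_le_suminf[of "\<lambda>k. y ^ k /\<^sub>R fact k", THEN order_trans])
      (auto simp: sums_iff)
  then have "y ^ (n + 2) \<le> fact (n + 2) * exp y"
    by (simp add: field_simps del: fact_Suc)
  then have le: "y ^ (n + 2) * exp (- y) * x\<^sup>2 \<le> fact (n + 2) * exp y * exp (- y) * x\<^sup>2"
    by (intro mult_right_mono) auto
  have eq1: "y ^ (n + 2) * exp (- y) * x\<^sup>2 = exp (- y) * y ^ n"
    using True by (simp add: y_def power_add power2_eq_square field_simps)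
  have eq2: "fact (n + 2) * exp y * exp (- y) * x\<^sup>2 = fact (n + 2) * x\<^sup>2"
    by (simp add: exp_minus)
  show ?thesis using le[unfolded eq1 eq2] True y
    by (simp add: flat_exp_def y_def[symmetric] abs_mult del: fact_Suc)
qed (simp add: flat_exp_def)

text \<open>Away from 0 this is the usual calculus on either side. At 0 the right-hand side is 0 by
  the default value, and the quadratic bound sends the difference quotient there.\<close>

lemma flat_exp_deriv:
  "(flat_exp n has_real_derivative (flat_exp (n + 2) x - real n * flat_exp (n + 1) x)) (at x)"
proof (cases "x = 0")
  case False
  show ?thesis
  proof (cases "x > 0")
    case True
    have "((\<lambda>x. exp (- inverse x) * inverse x ^ n) has_real_derivative
       exp (- inverse x) * inverse x ^ (n + 2) - real n * (exp (- inverse x) * inverse x ^ (n + 1))) (at x)"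
      using True
      by (auto intro!: derivative_eq_intros simp: power2_eq_square algebra_simps)
        (cases n; simp add: algebra_simps)
    then have "((\<lambda>x. exp (- inverse x) * inverse x ^ n) has_real_derivative
        (flat_exp (n + 2) x - real n * flat_exp (n + 1) x)) (at x)"
      using True by (simp add: flat_exp_def)
    then show ?thesis
      by (rule has_field_derivative_transform_within_open[of _ _ _ "{0<..}"])
         (use True in \<open>auto simp: flat_exp_def\<close>)
  next
    case neg: False
    have "((\<lambda>x. 0) has_real_derivative (flat_exp (n + 2) x - real n * flat_exp (n + 1) x)) (at x)"
      using neg by (simp add: flat_exp_def)
    then show ?thesis
      by (rule has_field_derivative_transform_within_open[of _ _ _ "{..<0}"])
         (use neg False in \<open>auto simp: flat_exp_def\<close>)
  qed
next
  case True
  have lim: "((\<lambda>h. fact (n + 2) * \<bar>h\<bar>) \<longlongrightarrow> (0::real)) (at 0)"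
    by (auto intro!: tendsto_eq_intros simp del: fact_Suc)
  have "((\<lambda>h. flat_exp n h / h) \<longlongrightarrow> 0) (at 0)"
  proof (rule Lim_null_comparison[OF _ lim])
    show "\<forall>\<^sub>F h in at 0. norm (flat_exp n h / h) \<le> fact (n + 2) * \<bar>h\<bar>"
    proof (rule eventually_at_filter[THEN iffD2, OF always_eventually], intro allI impI)
      fix h :: real assume h: "h \<noteq> 0"
      have "\<bar>flat_exp n h\<bar> \<le> fact (n + 2) * \<bar>h\<bar> * \<bar>h\<bar>"
        using flat_exp_bound[of n h] by (simp add: power2_eq_square mult.assoc del: fact_Suc)
      then show "norm (flat_exp n h / h) \<le> fact (n + 2) * \<bar>h\<bar>"
        using h by (simp add: divide_le_eq del: fact_Suc)
    qed
  qed
  then show ?thesis unfolding True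
    by (simp add: has_field_derivative_iff flat_exp_def[of _ 0])
qed

lemma smooth_on_flat_exp: "smooth_on (flat_exp n) UNIV"
  unfolding smooth_on_def
proof
  fix k show "ck_on k (flat_exp n) UNIV"
  proof (induction k arbitrary: n)
    case 0
    show ?case
      using DERIV_isCont[OF flat_exp_deriv] by (auto intro!: continuous_at_imp_continuous_on)
  next
    case (Suc k)
    show ?case
    proof (rule ck_on_SucI[OF open_UNIV])
      show "(flat_exp n has_derivative (\<lambda>v. (flat_exp (n + 2) x + (- real n) * flat_exp (n + 1) x) * v)) (at x)" for x
        using flat_exp_deriv[of n x] by (simp add: has_field_derivative_def)
      show "ck_on k (\<lambda>x. (flat_exp (n + 2) x + (- real n) * flat_exp (n + 1) x) * v) UNIV" for v
        by (intro ck_on_mult ck_on_add ck_on_const Suc.IH open_UNIV)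
    qed
  qed
qed

text \<open>The standard quotient of flat functions; the denominator never vanishes because one of t
  and 1 - t is always positive.\<close>

lemma smooth_bump:
  fixes p :: "'e::euclidean_space"
  assumes "r > 0"
  obtains \<beta> :: "'e \<Rightarrow> real" where "smooth_on \<beta> UNIV"
    "\<And>y. y \<in> ball p (r / 2) \<Longrightarrow> \<beta> y = 1" "\<And>y. y \<notin> ball p r \<Longrightarrow> \<beta> y = 0"
proof
  \<comment> \<open>The constants make s greater than 1 inside radius r/2, where the second flat
    function vanishes, and at most -2 outside radius r, where the first one does.\<close>
  define s where "s y = 2 + (- (4 / r\<^sup>2)) * ((y + - p) \<bullet> (y + - p))" for y :: 'e
  define \<beta> where "\<beta> y = flat_exp 0 (s y) * inverse (flat_exp 0 (s y) + flat_exp 0 (1 + (-1) * s y))" for y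
  have s: "smooth_on s UNIV"
    unfolding s_def by (intro smooth_on_intros) auto
  have pos: "flat_exp 0 t + flat_exp 0 (1 + (-1) * t) > 0" for t :: real
    by (auto simp: flat_exp_def intro: add_pos_pos)
  have "smooth_on (\<lambda>y. flat_exp 0 (s y)) UNIV"
    by (rule smooth_on_compose[OF _ _ _ s smooth_on_flat_exp]) auto
  moreover have "smooth_on (\<lambda>y. 1 + (-1) * s y) UNIV"
    by (intro smooth_on_intros s) auto
  then have "smooth_on (\<lambda>y. flat_exp 0 (1 + (-1) * s y)) UNIV"
    by (intro smooth_on_compose[OF _ _ _ _ smooth_on_flat_exp]) auto
  ultimately show "smooth_on \<beta> UNIV"
    unfolding \<beta>_def using pos
    by (intro smooth_on_intros smooth_on_inverse) (auto simp: less_imp_neq[symmetric])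
  have n: "(y + - p) \<bullet> (y + - p) = (dist p y)\<^sup>2" for y
    by (simp add: dist_norm power2_norm_eq_inner[symmetric] norm_minus_commute)
  show "\<beta> y = 1" if "y \<in> ball p (r / 2)" for y
  proof -
    have "(dist p y)\<^sup>2 < (r / 2)\<^sup>2" using that by (intro power_strict_mono) auto
    then have "4 / r\<^sup>2 * (dist p y)\<^sup>2 < 1" using assms by (simp add: field_simps power2_eq_square)
    then have "s y > 1" unfolding s_def n by simp
    then show ?thesis by (simp add: \<beta>_def flat_exp_def)
  qed
  show "\<beta> y = 0" if "y \<notin> ball p r" for y
  proof -
    have "r\<^sup>2 \<le> (dist p y)\<^sup>2" using that assms by (intro power_mono) auto
    then have "4 / r\<^sup>2 * (dist p y)\<^sup>2 \<ge> 4" using assms by (simp add: field_simps)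
    then have "s y < 0" unfolding s_def n by simp
    then show ?thesis by (simp add: \<beta>_def flat_exp_def)
  qed
qed

subsection \<open>The smooth inverse function theorem\<close>

text \<open>Split h c into h c(x) + h (c - c(x)): the second summand is a first-order term times one
  tending to 0. Asking only continuity of \<open>c\<close> is what starts the bootstrap for inverse
  matrices, whose differentiability is not known in advance.\<close>

lemma has_derivative_mult_vanishing:
  fixes h :: "'e::real_normed_vector \<Rightarrow> real" and c :: "'e \<Rightarrow> 'f::real_normed_vector"
  assumes h: "(h has_derivative h') (at x)" and h0: "h x = 0" and c: "isCont c x"
  shows "((\<lambda>y. h y *\<^sub>R c y) has_derivative (\<lambda>v. h' v *\<^sub>R c x)) (at x)"
proof -
  have 1: "((\<lambda>y. h y *\<^sub>R c x) has_derivative (\<lambda>v. h' v *\<^sub>R c x)) (at x)"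
    by (rule has_derivative_scaleR_left[OF h])
  have bl: "bounded_linear h'" using h by (rule has_derivative_bounded_linear)
  obtain K where K: "K > 0" "\<And>v. norm (h' v) \<le> norm v * K" using bounded_linear.pos_bounded[OF bl] by blast
  have "((\<lambda>y. h y *\<^sub>R (c y - c x)) has_derivative (\<lambda>v. 0)) (at x)"
    unfolding has_derivative_at
  proof (intro conjI bounded_linear_zero)
    have lin: "((\<lambda>v. norm (h (x + v) - h x - h' v) / norm v) \<longlongrightarrow> 0) (at 0)"
      using h unfolding has_derivative_at by simp
    have cc: "((\<lambda>v. norm (c (x + v) - c x)) \<longlongrightarrow> 0) (at 0)"
    proof -
      have "((\<lambda>v. c (x + v)) \<longlongrightarrow> c x) (at 0)"
        using c by (simp add: isCont_def LIM_offset_zero_iff)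
      then show ?thesis by (metis LIM_zero tendsto_norm_zero)
    qed
    have lim: "((\<lambda>v. (norm (h (x + v) - h x - h' v) / norm v + K) * norm (c (x + v) - c x)) \<longlongrightarrow> 0) (at 0)"
      by (rule tendsto_eq_intros lin cc refl | simp)+
    have "((\<lambda>v. norm (h (x + v) *\<^sub>R (c (x + v) - c x)) / norm v) \<longlongrightarrow> 0) (at 0)"
    proof (rule Lim_null_comparison[OF _ lim], rule eventually_at_filter[THEN iffD2, OF always_eventually], intro allI impI)
      fix v :: 'e assume v: "v \<noteq> 0"
      have "\<bar>h (x + v)\<bar> \<le> norm (h (x + v) - h x - h' v) + norm (h' v)" using h0 by simp
      also have "\<dots> \<le> norm (h (x + v) - h x - h' v) + norm v * K" using K by simp
      finally have "\<bar>h (x + v)\<bar> / norm v \<le> norm (h (x + v) - h x - h' v) / norm v + K"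
        using v by (simp add: field_simps)
      then have "\<bar>h (x + v)\<bar> / norm v * norm (c (x + v) - c x) \<le>
          (norm (h (x + v) - h x - h' v) / norm v + K) * norm (c (x + v) - c x)"
        by (rule mult_right_mono) simp
      then show "norm (norm (h (x + v) *\<^sub>R (c (x + v) - c x)) / norm v)
          \<le> (norm (h (x + v) - h x - h' v) / norm v + K) * norm (c (x + v) - c x)"
        by simp
    qed
    then show "((\<lambda>v. norm (h (x + v) *\<^sub>R (c (x + v) - c x) - h x *\<^sub>R (c x - c x) - 0) / norm v) \<longlongrightarrow> 0) (at 0)"
      by simp
  qed
  from has_derivative_add[OF 1 this] show ?thesis
    by (simp add: scaleR_right_diff_distrib)
qed

text \<open>The resolvent identity B_z - B_y = B_z (A_y - A_z) B_y gives continuity of B through the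
  uniform bound \<open>c\<close>, and then differentiability with derivative -B A' B. This formula
  contains B undifferentiated, so the order of smoothness climbs by induction.\<close>

lemma ck_on_inverse_matrix:
  fixes A B :: "'g::euclidean_space \<Rightarrow> 'e::euclidean_space \<Rightarrow> 'e"
  assumes V: "open V" and A: "\<And>w. ck_on k (\<lambda>y. A y w) V"
    and lA: "\<And>y. y \<in> V \<Longrightarrow> linear (A y)" and lB: "\<And>y. y \<in> V \<Longrightarrow> linear (B y)"
    and AB: "\<And>y w. y \<in> V \<Longrightarrow> A y (B y w) = w" and BA: "\<And>y w. y \<in> V \<Longrightarrow> B y (A y w) = w"
    and bd: "\<And>y w. y \<in> V \<Longrightarrow> norm (B y w) \<le> c * norm w"
    and A0: "\<And>w. continuous_on V (\<lambda>y. A y w)"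
  shows "ck_on k (\<lambda>y. B y w) V"
  using A
proof (induction k arbitrary: w)
  have diff: "B z w - B y w = B z (A y (B y w) - A z (B y w))" if "y \<in> V" "z \<in> V" for y z w
    using AB[OF that(1), of w] BA[OF that(2), of "B y w"] lB[OF that(2)] by (simp add: linear_diff)
  have cont: "continuous_on V (\<lambda>y. B y w)" for w
  proof (intro continuous_at_imp_continuous_on ballI)
    fix y assume y: "y \<in> V"
    have "isCont (\<lambda>z. A z (B y w)) y"
      using A0[of "B y w"] V y by (simp add: continuous_on_eq_continuous_at)
    then have "((\<lambda>z. A y (B y w) - A z (B y w)) \<longlongrightarrow> A y (B y w) - A y (B y w)) (at y)"
      unfolding isCont_def by (intro tendsto_diff tendsto_const)
    then have "((\<lambda>z. c * norm (A y (B y w) - A z (B y w))) \<longlongrightarrow> c * norm (0::'e)) (at y)"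
      by (intro tendsto_mult tendsto_const tendsto_norm) simp
    then have lim: "((\<lambda>z. c * norm (A y (B y w) - A z (B y w))) \<longlongrightarrow> 0) (at y)" by simp
    have "((\<lambda>z. B z w - B y w) \<longlongrightarrow> 0) (at y)"
    proof (rule Lim_null_comparison[OF _ lim])
      have "\<forall>\<^sub>F z in at y. z \<in> V" using V y by (simp add: eventually_at_in_open')
      then show "\<forall>\<^sub>F z in at y. norm (B z w - B y w) \<le> c * norm (A y (B y w) - A z (B y w))"
        by (rule eventually_mono) (simp add: diff[OF y] bd)
    qed
    then show "isCont (\<lambda>y. B y w) y" unfolding isCont_def by (rule LIM_zero_cancel)
  qed
  {
    case 0
    show ?case using cont by simp
  next
    case (Suc k)
    have Ad: "((\<lambda>z. A z u) has_derivative (\<lambda>v. pd (\<lambda>z. A z u) v y)) (at y)" if "y \<in> V" for y u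
      using ck_on_has_derivative[OF Suc.prems that] by simp
    have deriv: "((\<lambda>z. B z w) has_derivative (\<lambda>v. \<Sum>j\<in>Basis. (- (pd (\<lambda>z. A z (B y w)) v y \<bullet> j)) *\<^sub>R B y j)) (at y)"
      if y: "y \<in> V" for y
    proof -
      \<comment> \<open>The right factor of the resolvent identity is frozen at y, so the
        coordinates of \<open>A y (B y w) - A z (B y w)\<close> vanish at z = y and continuity of
        \<open>B z j\<close> is enough to differentiate the products.\<close>
      have D: "((\<lambda>z. B y w + (\<Sum>j\<in>Basis. ((A y (B y w) - A z (B y w)) \<bullet> j) *\<^sub>R B z j)) has_derivative
          (\<lambda>v. 0 + (\<Sum>j\<in>Basis. (- (pd (\<lambda>z. A z (B y w)) v y \<bullet> j)) *\<^sub>R B y j))) (at y)"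
      proof (intro has_derivative_add has_derivative_sum has_derivative_const has_derivative_mult_vanishing)
        fix j :: 'e
        have "((\<lambda>z. (A y (B y w) - A z (B y w)) \<bullet> j) has_derivative
           (\<lambda>v. (0 - pd (\<lambda>z. A z (B y w)) v y) \<bullet> j)) (at y)"
          by (intro has_derivative_inner_left has_derivative_diff has_derivative_const Ad y)
        then show "((\<lambda>z. (A y (B y w) - A z (B y w)) \<bullet> j) has_derivative
           (\<lambda>v. - (pd (\<lambda>z. A z (B y w)) v y \<bullet> j))) (at y)"
          by simp
        show "isCont (\<lambda>z. B z j) y" using cont V y by (simp add: continuous_on_eq_continuous_at)
      qed simp
      have E: "B y w + (\<Sum>j\<in>Basis. ((A y (B y w) - A z (B y w)) \<bullet> j) *\<^sub>R B z j) = B z w" if "z \<in> V" for z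
        unfolding linear_expand[OF lB[OF that], of "A y (B y w) - A z (B y w)", symmetric] diff[OF y that, symmetric]
        by simp
      from has_derivative_transform_within_open[OF D V y E] show ?thesis by simp
    qed
    \<comment> \<open>The vector \<open>B y w\<close> inserted into A moves with y as well;
      expanding it separates that dependence from the derivatives of A at fixed vectors.\<close>
    have pdA: "pd (\<lambda>z. A z (B y w)) v y = (\<Sum>i\<in>Basis. (B y w \<bullet> i) *\<^sub>R pd (\<lambda>z. A z i) v y)" if y: "y \<in> V" for y v
    proof -
      have "((\<lambda>z. \<Sum>i\<in>Basis. (B y w \<bullet> i) *\<^sub>R A z i) has_derivative (\<lambda>v. \<Sum>i\<in>Basis. (B y w \<bullet> i) *\<^sub>R pd (\<lambda>z. A z i) v y)) (at y)"
        by (intro has_derivative_sum has_derivative_scaleR_right Ad y)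
      then have "((\<lambda>z. A z (B y w)) has_derivative (\<lambda>v. \<Sum>i\<in>Basis. (B y w \<bullet> i) *\<^sub>R pd (\<lambda>z. A z i) v y)) (at y)"
        by (rule has_derivative_transform_within_open[OF _ V y]) (simp add: linear_expand[OF lA, symmetric])
      then show ?thesis by (simp add: frechet_derivative_at[symmetric])
    qed
    have A': "ck_on k (\<lambda>y. A y u) V" for u using Suc.prems ck_on_SucD by blast
    show ?case
    proof (rule ck_on_SucI[OF V deriv])
      fix v
      have "ck_on k (\<lambda>y. \<Sum>j\<in>Basis. (- 1 * ((\<Sum>i\<in>Basis. (B y w \<bullet> i) *\<^sub>R pd (\<lambda>z. A z i) v y) \<bullet> j)) *\<^sub>R B y j) V"
        by (intro ck_on_sum ck_on_scaleR ck_on_mult ck_on_inner ck_on_const V Suc.IH[OF A'] ck_on_pd Suc.prems)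
      then show "ck_on k (\<lambda>y. \<Sum>j\<in>Basis. (- (pd (\<lambda>z. A z (B y w)) v y \<bullet> j)) *\<^sub>R B y j) V"
        by (rule ck_on_cong[OF _ V]) (simp add: pdA)
    qed
  }
qed

text \<open>The C^1 theorem yields an inverse h whose derivative at y is the inverse of the
  derivative of f at h(y). If h is C^k, so is that inverse matrix, and then h is C^(k+1). The
  identity derivative at x0 provides a uniform bound on the inverse matrices nearby.\<close>

lemma smooth_inverse_function_id:
  fixes f :: "'e::euclidean_space \<Rightarrow> 'e"
  assumes U: "open U" and f: "smooth_on f U" and x0: "x0 \<in> U" and id: "\<And>v. pd f v x0 = v"
  obtains U' V h where "open U'" "U' \<subseteq> U" "x0 \<in> U'" "open V" "homeomorphism U' V f h" "smooth_on h V"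
proof -
  define f' where "f' x = Blinfun (\<lambda>v. pd f v x)" for x
  have f': "blinfun_apply (f' x) = (\<lambda>v. pd f v x)" if "x \<in> U" for x
    unfolding f'_def
    by (rule bounded_linear_Blinfun_apply) (use has_derivative_bounded_linear[OF smooth_on_has_derivative[OF f that]] in simp)
  have df: "(f has_derivative blinfun_apply (f' x)) (at x)" if "x \<in> U" for x
    using smooth_on_has_derivative[OF f that] f'[OF that] by simp
  have cf': "continuous_on U f'"
  proof (rule continuous_on_blinfun_componentwise)
    fix i :: 'e
    show "continuous_on U (\<lambda>x. blinfun_apply (f' x) i)"
      by (rule continuous_on_eq[OF smooth_on_continuous[OF smooth_on_pd[OF f, of i]]]) (simp add: f')
  qed
  have f'x0: "f' x0 = id_blinfun" by (rule blinfun_eqI) (simp add: f'[OF x0] id)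
  obtain d where d: "d > 0" "\<And>x. x \<in> U \<Longrightarrow> dist x x0 < d \<Longrightarrow> dist (f' x) (f' x0) < 1/2"
    using cf' x0 unfolding continuous_on_iff by (metis half_gt_zero zero_less_one)
  \<comment> \<open>On \<open>U1\<close> the derivative of f is within 1/2 of the identity, so v is
    at most twice as long as its image. This is the uniform bound 2 on the inverse matrices.\<close>
  define U1 where "U1 = U \<inter> ball x0 d"
  have U1: "open U1" "x0 \<in> U1" "U1 \<subseteq> U" using U x0 d by (auto simp: U1_def)
  have low: "norm v \<le> 2 * norm (pd f v x)" if "x \<in> U1" for x v
  proof -
    have xU: "x \<in> U" "dist x x0 < d" using that by (auto simp: U1_def dist_commute)
    have "norm (f' x - id_blinfun) \<le> 1/2" using d(2)[OF xU] by (simp add: f'x0 dist_norm)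
    then have "norm (f' x - id_blinfun) * norm v \<le> 1/2 * norm v" by (rule mult_right_mono) simp
    then have "norm (blinfun_apply (f' x - id_blinfun) v) \<le> 1/2 * norm v"
      using norm_blinfun[of "f' x - id_blinfun" v] by linarith
    then have "norm (pd f v x - v) \<le> norm v / 2" by (simp add: blinfun.diff_left f'[OF xU(1)])
    then show ?thesis using norm_triangle_ineq2[of v "v - pd f v x"] by (simp add: norm_minus_commute)
  qed
  \<comment> \<open>\<open>inverse_function_theorem_scaled\<close> concerns a map that fixes 0 and
    has identity derivative there, hence the translations in source and target.\<close>
  have sc: "open ((\<lambda>x. x - x0) ` U1)" using U1(1) open_translation_subtract by blast
  obtain U2 V2 g g' where IF: "open U2" "U2 \<subseteq> (\<lambda>x. x - x0) ` U1" "0 \<in> U2" "open V2"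
    "homeomorphism U2 V2 (\<lambda>x. f (x + x0) - f x0) g"
    "\<And>y. y \<in> V2 \<Longrightarrow> (g has_derivative (g' y)) (at y)"
    "\<And>y. y \<in> V2 \<Longrightarrow> g' y = inv (blinfun_apply (f' (g y + x0)))"
    "\<And>y. y \<in> V2 \<Longrightarrow> bij (blinfun_apply (f' (g y + x0)))"
  proof (rule inverse_function_theorem_scaled[OF sc, of "\<lambda>x. f (x + x0) - f x0" "\<lambda>x. f' (x + x0)"])
    fix x assume "x \<in> (\<lambda>x. x - x0) ` U1"
    then have "x + x0 \<in> U" using U1 by auto
    moreover have "((\<lambda>x. x + x0) has_derivative (\<lambda>v. v)) (at x)" by (auto intro!: derivative_eq_intros)
    ultimately have "((\<lambda>x. f (x + x0)) has_derivative blinfun_apply (f' (x + x0))) (at x)"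
      using has_derivative_compose[of "\<lambda>x. x + x0" "\<lambda>v. v" x UNIV f] df by auto
    then
    show "((\<lambda>x. f (x + x0) - f x0) has_derivative blinfun_apply (f' (x + x0))) (at x)"
      by (auto intro!: derivative_eq_intros)
  next
    show "continuous_on ((\<lambda>x. x - x0) ` U1) (\<lambda>x. f' (x + x0))"
      by (rule continuous_on_compose2[OF cf' continuous_on_add[OF continuous_on_id continuous_on_const]]) (use U1 in auto)
  qed (use f'x0 U1 in auto)
  define U' where "U' = (\<lambda>x. x + x0) ` U2"
  define V where "V = (\<lambda>y. y + f x0) ` V2"
  define h where "h y = g (y - f x0) + x0" for y
  have U'U: "U' \<subseteq> U1" using IF(2) by (auto simp: U'_def)
  have gV: "g y \<in> U2" if "y \<in> V2" for y using IF(5) that by (auto simp: homeomorphism_def)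
  have hV: "h y \<in> U'" if "y \<in> V" for y using gV that by (auto simp: U'_def V_def h_def)
  have hom: "homeomorphism U' V f h"
  proof
    show "continuous_on U' f" using smooth_on_continuous[OF f] U'U U1 by (meson continuous_on_subset)
    have "continuous_on V2 g" using IF(5) by (auto simp: homeomorphism_def)
    moreover have "continuous_on V (\<lambda>y. y - f x0)" by (intro continuous_intros)
    ultimately have "continuous_on V (\<lambda>y. g (y - f x0))"
      by (rule continuous_on_compose2) (auto simp: V_def)
    then show "continuous_on V h" unfolding h_def by (intro continuous_on_add continuous_on_const)
    show "f ` U' \<subseteq> V"
    proof
      fix y assume "y \<in> f ` U'"
      then obtain x where x: "x \<in> U2" "y = f (x + x0)" by (auto simp: U'_def)
      then have "f (x + x0) - f x0 \<in> V2" using IF(5) by (auto simp: homeomorphism_def)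
      then show "y \<in> V" unfolding V_def x(2) by force
    qed
    show "h ` V \<subseteq> U'" using hV by blast
    show "h (f x) = x" if "x \<in> U'" for x
      using that IF(5) by (auto simp: U'_def h_def homeomorphism_def)
    show "f (h y) = y" if "y \<in> V" for y
      using that IF(5) by (auto simp: V_def h_def homeomorphism_def algebra_simps)
  qed
  have V: "open V" unfolding V_def using open_translation[OF IF(4), of "f x0"] by (simp add: add.commute)
  define A where "A y v = pd f v (h y)" for y v
  define B where "B y = inv (A y)" for y
  have hU: "h y \<in> U" "h y \<in> U1" if "y \<in> V" for y using hV[OF that] U'U U1 by auto
  have Ab: "A y = blinfun_apply (f' (h y))" if "y \<in> V" for y using f'[OF hU(1)[OF that]] by (simp add: A_def fun_eq_iff)
  have bij: "bij (A y)" if "y \<in> V" for y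
    using IF(8)[of "y - f x0"] that Ab[OF that] by (auto simp: V_def h_def)
  have lA: "linear (A y)" if "y \<in> V" for y
    using Ab[OF that] blinfun.bounded_linear_right bounded_linear.linear by metis
  have AB: "A y (B y w) = w" if "y \<in> V" for y w 
    unfolding B_def by (rule surj_f_inv_f[OF bij_is_surj[OF bij[OF that]]])
  have BA: "B y (A y w) = w" if "y \<in> V" for y w 
    unfolding B_def by (rule inv_f_f[OF bij_is_inj[OF bij[OF that]]])
  have lB: "linear (B y)" if "y \<in> V" for y
  proof (rule linearI)
    fix u w c
    have "B y (u + w) = B y (A y (B y u) + A y (B y w))" by (simp add: AB[OF that])
    also have "\<dots> = B y u + B y w"
      by (simp add: linear_add[OF lA[OF that], symmetric] BA[OF that])
    finally show "B y (u + w) = B y u + B y w" .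
    have "B y (c *\<^sub>R u) = B y (c *\<^sub>R A y (B y u))" by (simp add: AB[OF that])
    also have "\<dots> = c *\<^sub>R B y u"
      by (simp add: linear_scale[OF lA[OF that], symmetric] BA[OF that])
    finally show "B y (c *\<^sub>R u) = c *\<^sub>R B y u" .
  qed
  have bd: "norm (B y w) \<le> 2 * norm w" if "y \<in> V" for y w
    using low[OF hU(2)[OF that], of "B y w"] AB[OF that, of w] by (simp add: A_def)
  have dh: "(h has_derivative B y) (at y)" if "y \<in> V" for y
  proof -
    have y: "y - f x0 \<in> V2" using that by (auto simp: V_def)
    have "((\<lambda>y. y - f x0) has_derivative (\<lambda>v. v)) (at y)" by (auto intro!: derivative_eq_intros)
    from has_derivative_compose[OF this IF(6)[OF y]]
    have "(h has_derivative g' (y - f x0)) (at y)"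
      unfolding h_def by (auto intro!: derivative_eq_intros)
    moreover have "g' (y - f x0) = B y" using IF(7)[OF y] Ab[OF that] by (simp add: B_def h_def)
    ultimately show ?thesis by simp
  qed
  have ch: "continuous_on V h" using dh by (meson continuous_at_imp_continuous_on has_derivative_continuous)
  have "ck_on k h V" for k
  proof (induction k)
    case 0
    then show ?case using ch by simp
  next
    case (Suc k)
    have cA: "ck_on k (\<lambda>y. A y w) V" for w
      unfolding A_def
      by (rule ck_on_compose[OF V U _ Suc]) (use hU smooth_on_pd[OF f] in \<open>auto simp: smooth_on_def\<close>)
    have cA0: "continuous_on V (\<lambda>y. A y w)" for w
      unfolding A_def
      by (rule continuous_on_compose2[OF smooth_on_continuous[OF smooth_on_pd[OF f, of w]] ch]) (use hU in auto)
    show ?case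
      by (rule ck_on_SucI[OF V dh ck_on_inverse_matrix[OF V cA lA lB AB BA bd cA0]])
  qed
  then have "smooth_on h V" by (simp add: smooth_on_def)
  moreover have "open U'" unfolding U'_def using open_translation[OF IF(1), of x0] by (simp add: add.commute)
  moreover have "x0 \<in> U'" using IF(3) by (force simp: U'_def)
  ultimately show ?thesis using U'U U1(3) by (intro that[OF _ _ _ V hom]) auto
qed

text \<open>Compose with a left inverse of the derivative at x0, which exists because equal
  dimensions make a surjective linear map injective. It also brings the values back into the type of
  the source, where the normalised version applies.\<close>

lemma smooth_inverse_function:
  fixes f :: "'d::euclidean_space \<Rightarrow> 'f::euclidean_space"
  assumes U: "open U" and f: "smooth_on f U" and x0: "x0 \<in> U"
    and surj: "surj (\<lambda>v. pd f v x0)" and dim: "DIM('d) = DIM('f)"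
  obtains U' V h where "open U'" "U' \<subseteq> U" "x0 \<in> U'" "open V" "homeomorphism U' V f h" "smooth_on h V"
proof -
  define A where "A v = pd f v x0" for v
  have lA: "linear A" using smooth_on_linear_pd[OF f x0] by (simp add: A_def[abs_def])
  have sA: "surj A" using surj by (simp add: A_def[abs_def])
  have iA: "inj A"
    using linear_surjective_imp_injective[OF lA sA] dim by simp
  obtain L where L: "linear L" "L \<circ> A = id" using linear_injective_left_inverse[OF lA iA] by blast
  have LA: "L (A v) = v" for v using L(2) by (metis comp_apply id_apply)
  have AL: "A (L w) = w" for w using sA LA by (metis surjD)
  have bL: "bounded_linear L" and bA: "bounded_linear A" using L lA by (auto simp: linear_conv_bounded_linear)
  have sLf: "smooth_on (\<lambda>x. L (f x)) U" by (rule smooth_on_bounded_linear[OF U bL f])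
  have "pd (\<lambda>x. L (f x)) v x0 = v" for v
    using bounded_linear.has_derivative[OF bL smooth_on_has_derivative[OF f x0], THEN frechet_derivative_at]
    by (metis A_def LA)
  from smooth_inverse_function_id[OF U sLf x0 this]
  obtain U' V h where 1: "open U'" "U' \<subseteq> U" "x0 \<in> U'" "open V" "homeomorphism U' V (\<lambda>x. L (f x)) h" "smooth_on h V"
    by blast
  have opV: "open (L -` V)" using 1(4) linear_continuous_on[OF bL, of UNIV] by (auto intro: open_vimage)
  show ?thesis
  proof (rule that[OF 1(1-3), of "L -` V" "\<lambda>y. h (L y)"])
    show "open (L -` V)" by (rule opV)
    show "smooth_on (\<lambda>y. h (L y)) (L -` V)"
      by (rule smooth_on_compose[OF opV 1(4) _ smooth_on_linear[OF opV bL] 1(6)]) auto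
    show "homeomorphism U' (L -` V) f (\<lambda>y. h (L y))"
    proof
      show "continuous_on U' f" using smooth_on_continuous[OF f] 1(2) continuous_on_subset by blast
      show "continuous_on (L -` V) (\<lambda>y. h (L y))"
        by (rule smooth_on_continuous) fact
      show "f ` U' \<subseteq> L -` V" "(\<lambda>y. h (L y)) ` (L -` V) \<subseteq> U'"
        using 1(5) by (auto simp: homeomorphism_def)
      show "h (L (f x)) = x" if "x \<in> U'" for x using 1(5) that by (auto simp: homeomorphism_def)
      show "f (h (L y)) = y" if "y \<in> L -` V" for y
      proof -
        have "L (f (h (L y))) = L y" using 1(5) that by (auto simp: homeomorphism_def)
        then show ?thesis using AL by metis
      qed
    qed
  qed
qed

section \<open>Smooth functions and tangent vectors on manifolds\<close>

lemma chart_props: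
  assumes "smooth_manifold M" "(V, \<phi>) \<in> atlas M"
  shows "openin (mtop M) V" "V \<subseteq> points M" "inj_on \<phi> V" "open (\<phi> ` V)"
    "homeomorphic_map (subtopology (mtop M) V) (top_of_set (\<phi> ` V)) \<phi>"
proof -
  show 1: "openin (mtop M) V" "open (\<phi> ` V)"
    "homeomorphic_map (subtopology (mtop M) V) (top_of_set (\<phi> ` V)) \<phi>"
    using assms unfolding smooth_manifold_def by blast+
  show 2: "V \<subseteq> points M" using 1(1) by (rule openin_subset)
  show "inj_on \<phi> V"
    using homeomorphic_imp_injective_map[OF 1(3)] 2 by (simp add: Int_absorb1)
qed

lemma inv_chart:
  assumes "smooth_manifold M" "(V, \<phi>) \<in> atlas M" "p \<in> V"
  shows "inv_into V \<phi> (\<phi> p) = p"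
  using chart_props(3)[OF assms(1,2)] assms(3) by (rule inv_into_f_f)

lemma chart_image_open:
  assumes M: "smooth_manifold M" "(V, \<phi>) \<in> atlas M" and W: "openin (mtop M) W"
  shows "open (\<phi> ` (V \<inter> W))"
proof -
  have "openin (subtopology (mtop M) V) (V \<inter> W)"
    using W by (simp add: openin_subtopology_Int2)
  then have "openin (top_of_set (\<phi> ` V)) (\<phi> ` (V \<inter> W))"
    using homeomorphic_imp_open_map[OF chart_props(5)[OF M]] unfolding open_map_def by blast
  then show ?thesis using chart_props(4)[OF M] openin_open_trans by blast
qed

lemma chart_preimage_open:
  assumes M: "smooth_manifold M" "(V, \<phi>) \<in> atlas M" and C: "open C"
  shows "openin (mtop M) {p \<in> V. \<phi> p \<in> C}"
proof -
  have "continuous_map (subtopology (mtop M) V) (top_of_set (\<phi> ` V)) \<phi>"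
    using chart_props(5)[OF M] by (rule homeomorphic_imp_continuous_map)
  then have "continuous_map (subtopology (mtop M) V) euclidean \<phi>"
    by (rule continuous_map_into_fulltopology)
  from openin_continuous_map_preimage[OF this, of C] C
  have "openin (subtopology (mtop M) V) {p \<in> points M \<inter> V. \<phi> p \<in> C}" by simp
  moreover have "points M \<inter> V = V" using chart_props(2)[OF M] by blast
  ultimately show ?thesis
    using openin_trans_full[OF _ chart_props(1)[OF M]] by simp
qed

lemma chart_at:
  assumes "smooth_manifold M" "p \<in> points M"
  obtains V \<phi> where "(V, \<phi>) \<in> atlas M" "p \<in> V"
proof -
  have "p \<in> (\<Union>(V, \<phi>)\<in>atlas M. V)" using assms unfolding smooth_manifold_def by blast
  then show ?thesis using that by blast
qed

section \<open>Real functions smooth on an open set of a manifold\<close>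

lemma smooth_funI:
  assumes "openin (mtop M) W"
    "\<And>V \<phi>. (V, \<phi>) \<in> atlas M \<Longrightarrow> smooth_on (\<lambda>y. h (inv_into V \<phi> y)) (\<phi> ` (V \<inter> W))"
  shows "smooth_fun M W h"
  using assms unfolding smooth_fun_def by (auto simp: o_def)

lemma smooth_funD:
  assumes "smooth_fun M W h"
  shows "openin (mtop M) W"
    "(V, \<phi>) \<in> atlas M \<Longrightarrow> smooth_on (\<lambda>y. h (inv_into V \<phi> y)) (\<phi> ` (V \<inter> W))"
  using assms unfolding smooth_fun_def by (auto simp: o_def)

lemma smooth_fun_points: "smooth_fun M W h \<Longrightarrow> W \<subseteq> points M"
  using smooth_funD(1) openin_subset by blast

lemma smooth_fun_subset:
  assumes "smooth_fun M W h" "openin (mtop M) W'" "W' \<subseteq> W"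
  shows "smooth_fun M W' h"
  by (rule smooth_funI[OF assms(2)], rule smooth_on_subset[OF smooth_funD(2)[OF assms(1)]])
     (use assms(3) in auto)

lemma smooth_fun_cong:
  assumes M: "smooth_manifold M" and h: "smooth_fun M W h" and eq: "\<And>p. p \<in> W \<Longrightarrow> h p = k p"
  shows "smooth_fun M W k"
proof (rule smooth_funI[OF smooth_funD(1)[OF h]])
  fix V \<phi> assume c: "(V, \<phi>) \<in> atlas M"
  show "smooth_on (\<lambda>y. k (inv_into V \<phi> y)) (\<phi> ` (V \<inter> W))"
    by (rule smooth_on_cong[OF smooth_funD(2)[OF h c] chart_image_open[OF M c smooth_funD(1)[OF h]]])
       (auto simp: inv_chart[OF M c] eq)
qed

lemma smooth_fun_const:
  "smooth_manifold M \<Longrightarrow> openin (mtop M) W \<Longrightarrow> smooth_fun M W (\<lambda>q. c)"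
  by (intro smooth_funI smooth_on_const chart_image_open)

lemma smooth_fun_add:
  "smooth_manifold M \<Longrightarrow> smooth_fun M W h \<Longrightarrow> smooth_fun M W k \<Longrightarrow> smooth_fun M W (\<lambda>q. h q + k q)"
  by (intro smooth_funI smooth_on_add chart_image_open) (auto dest: smooth_funD)

lemma smooth_fun_mult:
  "smooth_manifold M \<Longrightarrow> smooth_fun M W h \<Longrightarrow> smooth_fun M W k \<Longrightarrow> smooth_fun M W (\<lambda>q. h q * k q)"
  by (intro smooth_funI smooth_on_mult chart_image_open) (auto dest: smooth_funD)

lemma smooth_fun_sum:
  assumes "smooth_manifold M" "openin (mtop M) W" "\<And>i. i \<in> I \<Longrightarrow> smooth_fun M W (h i)"
  shows "smooth_fun M W (\<lambda>q. \<Sum>i\<in>I. h i q)"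
  using assms by (intro smooth_funI smooth_on_sum chart_image_open) (auto dest: smooth_funD)

lemma smooth_fun_local:
  assumes M: "smooth_manifold M" and W: "openin (mtop M) W"
    and loc: "\<And>p. p \<in> W \<Longrightarrow> \<exists>W'. p \<in> W' \<and> smooth_fun M W' h"
  shows "smooth_fun M W h"
proof (rule smooth_funI[OF W])
  fix V \<phi> assume c: "(V, \<phi>) \<in> atlas M"
  show "smooth_on (\<lambda>y. h (inv_into V \<phi> y)) (\<phi> ` (V \<inter> W))"
  proof (rule smooth_on_local)
    fix y assume "y \<in> \<phi> ` (V \<inter> W)"
    then obtain p where p: "p \<in> V" "p \<in> W" "y = \<phi> p" by blast
    obtain W' where W': "p \<in> W'" "smooth_fun M W' h" using loc p by blast
    show "\<exists>N. open N \<and> y \<in> N \<and> smooth_on (\<lambda>y. h (inv_into V \<phi> y)) N"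
      using chart_image_open[OF M c smooth_funD(1)[OF W'(2)]] smooth_funD(2)[OF W'(2) c] p W'
      by (intro exI[of _ "\<phi> ` (V \<inter> W')"]) auto
  qed
qed

lemma smooth_fun_compose:
  fixes F :: "'a \<Rightarrow> 'f::euclidean_space"
  assumes M: "smooth_manifold M" and W: "openin (mtop M) W"
    and F: "\<And>b. b \<in> Basis \<Longrightarrow> smooth_fun M W (\<lambda>q. F q \<bullet> b)"
    and G: "smooth_on G C" "open C" and sub: "\<And>q. q \<in> W \<Longrightarrow> F q \<in> C"
  shows "smooth_fun M W (\<lambda>q. G (F q))"
proof (rule smooth_funI[OF W])
  fix V \<phi> assume c: "(V, \<phi>) \<in> atlas M"
  show "smooth_on (\<lambda>y. G (F (inv_into V \<phi> y))) (\<phi> ` (V \<inter> W))"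
  proof (rule smooth_on_compose[OF chart_image_open[OF M c W] G(2) _ _ G(1)])
    show "(\<lambda>y. F (inv_into V \<phi> y)) ` \<phi> ` (V \<inter> W) \<subseteq> C"
      using sub by (auto simp: inv_chart[OF M c])
    show "smooth_on (\<lambda>y. F (inv_into V \<phi> y)) (\<phi> ` (V \<inter> W))"
      by (rule smooth_on_componentwise[OF chart_image_open[OF M c W] smooth_funD(2)[OF F c]])
  qed
qed

text \<open>This is the compatibility of charts: seen in another chart, a coordinate is a component
  of a transition map.\<close>

lemma smooth_fun_chart:
  assumes M: "smooth_manifold M" "(V, \<phi>) \<in> atlas M"
  shows "smooth_fun M V (\<lambda>q. \<phi> q \<bullet> b)"
proof (rule smooth_funI[OF chart_props(1)[OF M]])
  fix V' \<psi> assume c: "(V', \<psi>) \<in> atlas M"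
  have "smooth_on (\<phi> \<circ> inv_into V' \<psi>) (\<psi> ` (V' \<inter> V))"
    using M c unfolding smooth_manifold_def by blast
  then show "smooth_on (\<lambda>y. \<phi> (inv_into V' \<psi> y) \<bullet> b) (\<psi> ` (V' \<inter> V))"
    using chart_image_open[OF M(1) c chart_props(1)[OF M]]
    by (intro smooth_on_inner smooth_on_const) (simp_all add: o_def)
qed

section \<open>Functions smooth near a point\<close>

lemma smooth_fun_atI: "smooth_fun M W h \<Longrightarrow> p \<in> W \<Longrightarrow> smooth_fun_at M p h"
  unfolding smooth_fun_at_def by blast

lemma smooth_fun_at_common:
  assumes "smooth_fun_at M p h" "smooth_fun_at M p k"
  obtains W where "p \<in> W" "openin (mtop M) W" "smooth_fun M W h" "smooth_fun M W k"
proof -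
  obtain W1 W2 where W: "p \<in> W1" "smooth_fun M W1 h" "p \<in> W2" "smooth_fun M W2 k"
    using assms unfolding smooth_fun_at_def by blast
  have o: "openin (mtop M) (W1 \<inter> W2)" using smooth_funD(1)[OF W(2)] smooth_funD(1)[OF W(4)] by blast
  show ?thesis
    by (rule that[OF _ o smooth_fun_subset[OF W(2) o] smooth_fun_subset[OF W(4) o]]) (use W in auto)
qed

lemma smooth_fun_at_const:
  "smooth_manifold M \<Longrightarrow> p \<in> points M \<Longrightarrow> smooth_fun_at M p (\<lambda>q. c)"
  by (rule smooth_fun_atI[OF smooth_fun_const]) auto

lemma smooth_fun_at_add:
  assumes "smooth_manifold M" "smooth_fun_at M p h" "smooth_fun_at M p k"
  shows "smooth_fun_at M p (\<lambda>q. h q + k q)"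
  using smooth_fun_at_common[OF assms(2,3)] smooth_fun_add[OF assms(1)] smooth_fun_atI by metis

lemma smooth_fun_at_mult:
  assumes "smooth_manifold M" "smooth_fun_at M p h" "smooth_fun_at M p k"
  shows "smooth_fun_at M p (\<lambda>q. h q * k q)"
  using smooth_fun_at_common[OF assms(2,3)] smooth_fun_mult[OF assms(1)] smooth_fun_atI by metis

lemma smooth_fun_at_cong:
  assumes M: "smooth_manifold M" and h: "smooth_fun_at M p h"
    and W: "openin (mtop M) W" "p \<in> W" "\<And>q. q \<in> W \<Longrightarrow> h q = k q"
  shows "smooth_fun_at M p k"
proof -
  obtain W1 where W1: "p \<in> W1" "smooth_fun M W1 h" using h unfolding smooth_fun_at_def by blast
  have o: "openin (mtop M) (W1 \<inter> W)" using W(1) smooth_funD(1)[OF W1(2)] by blast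
  have "smooth_fun M (W1 \<inter> W) k"
    by (rule smooth_fun_cong[OF M smooth_fun_subset[OF W1(2) o]]) (use W in auto)
  then show ?thesis by (rule smooth_fun_atI) (use W1 W in auto)
qed

lemma smooth_fun_at_points: "smooth_fun_at M p h \<Longrightarrow> p \<in> points M"
  using smooth_fun_points unfolding smooth_fun_at_def by blast

lemma smooth_fun_at_sum:
  assumes "smooth_manifold M" "p \<in> points M" "\<And>i. i \<in> I \<Longrightarrow> smooth_fun_at M p (h i)"
  shows "smooth_fun_at M p (\<lambda>q. \<Sum>i\<in>I. h i q)"
  using assms(3)
  by (induction I rule: infinite_finite_induct)
     (auto intro: smooth_fun_at_const smooth_fun_at_add assms(1,2))

section \<open>Calculus of derivations at a point\<close>

lemma tangentI:
  assumes "\<And>h. \<not> smooth_fun_at M p h \<Longrightarrow> v h = 0"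
    "\<And>a b h k. smooth_fun_at M p h \<Longrightarrow> smooth_fun_at M p k \<Longrightarrow>
        v (\<lambda>q. a * h q + b * k q) = a * v h + b * v k"
    "\<And>h k. smooth_fun_at M p h \<Longrightarrow> smooth_fun_at M p k \<Longrightarrow>
        v (\<lambda>q. h q * k q) = v h * k p + h p * v k"
  shows "v \<in> tangent_space M p"
  using assms unfolding tangent_space_def by simp

lemma tangentD:
  assumes "v \<in> tangent_space M p"
  shows "\<not> smooth_fun_at M p h \<Longrightarrow> v h = 0"
    "smooth_fun_at M p h \<Longrightarrow> smooth_fun_at M p k \<Longrightarrow>
        v (\<lambda>q. a * h q + b * k q) = a * v h + b * v k"
    "smooth_fun_at M p h \<Longrightarrow> smooth_fun_at M p k \<Longrightarrow>
        v (\<lambda>q. h q * k q) = v h * k p + h p * v k"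
  using assms unfolding tangent_space_def by simp_all

lemma tangent_add:
  "v \<in> tangent_space M p \<Longrightarrow> smooth_fun_at M p h \<Longrightarrow> smooth_fun_at M p k \<Longrightarrow>
    v (\<lambda>q. h q + k q) = v h + v k"
  using tangentD(2)[of v M p h k 1 1] by simp

text \<open>From 1 = 1 * 1 the Leibniz rule gives v(1) = 2 v(1); linearity does the rest.\<close>

lemma tangent_const:
  assumes M: "smooth_manifold M" and p: "p \<in> points M" and v: "v \<in> tangent_space M p"
  shows "v (\<lambda>q. c) = 0"
proof -
  have "v (\<lambda>q. 1) = 0"
    using tangentD(3)[OF v smooth_fun_at_const[OF M p, of 1] smooth_fun_at_const[OF M p, of 1]] by simp
  then show ?thesis
    using tangentD(2)[OF v smooth_fun_at_const[OF M p, of 1] smooth_fun_at_const[OF M p, of 1], of c 0] by simp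
qed

lemma tangent_sum:
  assumes M: "smooth_manifold M" and p: "p \<in> points M" and v: "v \<in> tangent_space M p"
    and h: "\<And>i. i \<in> I \<Longrightarrow> smooth_fun_at M p (h i)"
  shows "v (\<lambda>q. \<Sum>i\<in>I. h i q) = (\<Sum>i\<in>I. v (h i))"
  using h
proof (induction I rule: infinite_finite_induct)
  case (insert i I)
  have "v (\<lambda>q. h i q + (\<Sum>i\<in>I. h i q)) = v (h i) + v (\<lambda>q. \<Sum>i\<in>I. h i q)"
    using insert by (intro tangent_add[OF v] smooth_fun_at_sum M p) auto
  then show ?case using insert by simp
qed (simp_all add: tangent_const[OF M p v])

lemma tangent_local:
  assumes M: "smooth_manifold M" and v: "v \<in> tangent_space M p"
    and W: "openin (mtop M) W" "p \<in> W" "\<And>q. q \<in> W \<Longrightarrow> h q = k q"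
  shows "v h = v k"
proof (cases "smooth_fun_at M p h")
  case False
  then have "\<not> smooth_fun_at M p k"
    using smooth_fun_at_cong[OF M _ W(1,2), of k h] W(3) by auto
  then show ?thesis using False tangentD(1)[OF v] by simp
next
  case True
  then have k: "smooth_fun_at M p k" by (rule smooth_fun_at_cong[OF M _ W])
  have p: "p \<in> points M" using True smooth_fun_at_points by metis
  \<comment> \<open>\<open>cut\<close> may jump at the boundary of W, but it vanishes on W, and
    smoothness near p is all that the Leibniz rule asks of it.\<close>
  define cut where "cut q = (if q \<in> W then 0 else 1::real)" for q
  have cut: "smooth_fun_at M p cut"
    by (rule smooth_fun_at_cong[OF M smooth_fun_at_const[OF M p, of 0] W(1,2)]) (simp add: cut_def)
  define d where "d q = 1 * h q + (-1) * k q" for q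
  have d: "smooth_fun_at M p d"
    unfolding d_def by (intro smooth_fun_at_add smooth_fun_at_mult smooth_fun_at_const M p True k)
  have "d = (\<lambda>q. d q * cut q)" using W(3) by (auto simp: d_def cut_def)
  then have "v d = v d * cut p + d p * v cut" using tangentD(3)[OF v d cut] by simp
  then have "v d = 0" using W by (simp add: cut_def d_def)
  then show ?thesis using tangentD(2)[OF v True k, of 1 "-1"] by (simp add: d_def[abs_def])
qed

lemma tangent_comb:
  assumes "v \<in> tangent_space M p" "w \<in> tangent_space M p"
  shows "tvec_comb a v b w \<in> tangent_space M p"
  by (rule tangentI) (auto simp: tangentD[OF assms(1)] tangentD[OF assms(2)] algebra_simps)

lemma deriv_along_inner: "b \<in> Basis \<Longrightarrow> deriv_along v F \<bullet> b = v (\<lambda>q. F q \<bullet> b)"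
  unfolding deriv_along_def by (simp add: inner_sum_left inner_Basis if_distrib cong: if_cong)

lemma deriv_along_comb: "deriv_along (tvec_comb a v b w) F = a *\<^sub>R deriv_along v F + b *\<^sub>R deriv_along w F"
  unfolding deriv_along_def by (simp add: scaleR_sum_right sum.distrib scaleR_left_distrib)

lemma deriv_along_local:
  assumes M: "smooth_manifold M" and v: "v \<in> tangent_space M p"
    and W: "openin (mtop M) W" "p \<in> W" "\<And>q. q \<in> W \<Longrightarrow> F q = G q"
  shows "deriv_along v F = deriv_along v G"
  unfolding deriv_along_def
  by (intro sum.cong refl arg_cong2[of _ _ _ _ scaleR] tangent_local[OF M v W(1,2)]) (simp add: W(3))

text \<open>In the Leibniz rule the term with the derivative of k carries the factor h p - h p = 0.
  Products of this shape are the summands in Hadamard's lemma.\<close>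

lemma tangent_mult_vanishing:
  assumes M: "smooth_manifold M" and v: "v \<in> tangent_space M p"
    and h: "smooth_fun_at M p h" "smooth_fun_at M p k"
  shows "v (\<lambda>q. (h q - h p) * k q) = v h * k p"
proof -
  have p: "p \<in> points M" using h smooth_fun_at_points by metis
  have c: "smooth_fun_at M p (\<lambda>q. - h p)" by (rule smooth_fun_at_const[OF M p])
  have s: "smooth_fun_at M p (\<lambda>q. h q + - h p)" by (rule smooth_fun_at_add[OF M h(1) c])
  have "v (\<lambda>q. (h q + - h p) * k q) = v h * k p"
    using tangentD(3)[OF v s h(2)] tangent_add[OF v h(1) c] tangent_const[OF M p v, of "- h p"] by simp
  then show ?thesis by simp
qed

text \<open>Hadamard's lemma in the chart writes h as its value at p plus a sum of coordinate
  differences times smooth functions. A derivation kills the constant and, as the differences vanish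
  at p, sees only the values of those functions at p, which are the partial derivatives.\<close>

lemma tangent_chart:
  fixes M :: "('a, 'e::euclidean_space) manifold"
  assumes M: "smooth_manifold M" and c: "(V, \<phi>) \<in> atlas M" and p: "p \<in> V"
    and v: "v \<in> tangent_space M p" and h: "smooth_fun_at M p h"
  shows "v h = pd (\<lambda>y. h (inv_into V \<phi> y)) (deriv_along v \<phi>) (\<phi> p)"
proof -
  obtain W where W: "p \<in> W" "smooth_fun M W h" using h unfolding smooth_fun_at_def by blast
  have pM: "p \<in> points M" using h smooth_fun_at_points by metis
  define A where "A = \<phi> ` (V \<inter> W)"
  have A: "open A" "\<phi> p \<in> A" "smooth_on (\<lambda>y. h (inv_into V \<phi> y)) A"
    using chart_image_open[OF M c smooth_funD(1)[OF W(2)]] smooth_funD(2)[OF W(2) c] p W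
    by (auto simp: A_def)
  obtain r where r: "r > 0" "ball (\<phi> p) r \<subseteq> A" using A openE by blast
  obtain H where H: "\<And>b. b \<in> Basis \<Longrightarrow> smooth_on (H b) (ball (\<phi> p) r)"
    "\<And>b. H b (\<phi> p) = pd (\<lambda>y. h (inv_into V \<phi> y)) b (\<phi> p)"
    "\<And>y. y \<in> ball (\<phi> p) r \<Longrightarrow> h (inv_into V \<phi> y) =
       h (inv_into V \<phi> (\<phi> p)) + (\<Sum>b\<in>Basis. ((y - \<phi> p) \<bullet> b) * H b y)"
    using hadamard[OF open_ball convex_ball _ smooth_on_subset[OF A(3) r(2)], of "\<phi> p"] r by auto
  define W' where "W' = {q \<in> V. \<phi> q \<in> ball (\<phi> p) r}"
  have W': "openin (mtop M) W'" "p \<in> W'" "W' \<subseteq> V"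
    using chart_preimage_open[OF M c open_ball] p r by (auto simp: W'_def)
  have co: "smooth_fun_at M p (\<lambda>q. \<phi> q \<bullet> b)" for b
    by (rule smooth_fun_atI[OF smooth_fun_chart[OF M c] p])
  have Hs: "smooth_fun_at M p (\<lambda>q. H b (\<phi> q))" if "b \<in> Basis" for b
    by (rule smooth_fun_atI[OF smooth_fun_compose[OF M W'(1) _ H(1)[OF that] open_ball] W'(2)])
       (rule smooth_fun_subset[OF smooth_fun_chart[OF M c] W'(1,3)], simp add: W'_def)
  have sm: "smooth_fun_at M p (\<lambda>q. (\<phi> q \<bullet> b - \<phi> p \<bullet> b) * H b (\<phi> q))" if "b \<in> Basis" for b
  proof -
    have "smooth_fun_at M p (\<lambda>q. (\<phi> q \<bullet> b + - (\<phi> p \<bullet> b)) * H b (\<phi> q))"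
      by (intro smooth_fun_at_mult smooth_fun_at_add smooth_fun_at_const M pM co Hs that)
    then show ?thesis by simp
  qed
  have "v h = v (\<lambda>q. h p + (\<Sum>b\<in>Basis. (\<phi> q \<bullet> b - \<phi> p \<bullet> b) * H b (\<phi> q)))"
  proof (rule tangent_local[OF M v W'(1,2)])
    fix q assume "q \<in> W'"
    then have "\<phi> q \<in> ball (\<phi> p) r" "q \<in> V" by (auto simp: W'_def)
    with H(3)[of "\<phi> q"] show "h q = h p + (\<Sum>b\<in>Basis. (\<phi> q \<bullet> b - \<phi> p \<bullet> b) * H b (\<phi> q))"
      by (simp add: inv_chart[OF M c] p inner_diff_left)
  qed
  also have "\<dots> = v (\<lambda>q. h p) + v (\<lambda>q. \<Sum>b\<in>Basis. (\<phi> q \<bullet> b - \<phi> p \<bullet> b) * H b (\<phi> q))"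
    by (rule tangent_add[OF v smooth_fun_at_const[OF M pM] smooth_fun_at_sum[OF M pM sm]])
  also have "\<dots> = (\<Sum>b\<in>Basis. v (\<lambda>q. (\<phi> q \<bullet> b - \<phi> p \<bullet> b) * H b (\<phi> q)))"
    using tangent_const[OF M pM v] tangent_sum[OF M pM v sm] by simp
  also have "\<dots> = (\<Sum>b\<in>Basis. v (\<lambda>q. \<phi> q \<bullet> b) * H b (\<phi> p))"
    by (intro sum.cong refl tangent_mult_vanishing[OF M v co Hs])
  also have "\<dots> = (\<Sum>b\<in>Basis. (deriv_along v \<phi> \<bullet> b) *\<^sub>R pd (\<lambda>y. h (inv_into V \<phi> y)) b (\<phi> p))"
    by (simp add: deriv_along_inner H(2))
  also have "\<dots> = pd (\<lambda>y. h (inv_into V \<phi> y)) (deriv_along v \<phi>) (\<phi> p)"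
    by (rule linear_expand[OF smooth_on_linear_pd[OF A(3,2)], symmetric])
  finally show ?thesis .
qed

section \<open>Vector fields with constant coordinates in a chart\<close>

definition chart_vector ::
    "('a, 'e::euclidean_space) manifold \<Rightarrow> 'a set \<Rightarrow> ('a \<Rightarrow> 'e) \<Rightarrow> 'e \<Rightarrow> 'a \<Rightarrow> 'a tvec" where
  "chart_vector M V \<phi> c p =
     (\<lambda>h. if smooth_fun_at M p h then pd (\<lambda>y. h (inv_into V \<phi> y)) c (\<phi> p) else 0)"

lemma smooth_fun_at_chart_derivative:
  assumes M: "smooth_manifold M" and c: "(V, \<phi>) \<in> atlas M" and p: "p \<in> V" and h: "smooth_fun_at M p h"
  shows "((\<lambda>y. h (inv_into V \<phi> y)) has_derivative (\<lambda>u. pd (\<lambda>y. h (inv_into V \<phi> y)) u (\<phi> p))) (at (\<phi> p))"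
proof -
  obtain W where W: "p \<in> W" "smooth_fun M W h" using h unfolding smooth_fun_at_def by blast
  show ?thesis
    by (rule smooth_on_has_derivative[OF smooth_funD(2)[OF W(2) c]]) (use p W in auto)
qed

lemma chart_vector_tangent:
  assumes M: "smooth_manifold M" and c: "(V, \<phi>) \<in> atlas M" and p: "p \<in> V"
  shows "chart_vector M V \<phi> u p \<in> tangent_space M p"
proof (rule tangentI)
  have pM: "p \<in> points M" using chart_props(2)[OF M c] p by blast
  fix h k a b assume h: "smooth_fun_at M p h" and k: "smooth_fun_at M p k"
  note d = smooth_fun_at_chart_derivative[OF M c p]
  have "((\<lambda>y. a * h (inv_into V \<phi> y) + b * k (inv_into V \<phi> y)) has_derivative
      (\<lambda>u. a * pd (\<lambda>y. h (inv_into V \<phi> y)) u (\<phi> p) + b * pd (\<lambda>y. k (inv_into V \<phi> y)) u (\<phi> p))) (at (\<phi> p))"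
    by (intro has_derivative_add has_derivative_mult_right d h k)
  moreover have "smooth_fun_at M p (\<lambda>q. a * h q + b * k q)"
    by (intro smooth_fun_at_add smooth_fun_at_mult smooth_fun_at_const M pM h k)
  ultimately show "chart_vector M V \<phi> u p (\<lambda>q. a * h q + b * k q) =
      a * chart_vector M V \<phi> u p h + b * chart_vector M V \<phi> u p k"
    by (simp add: chart_vector_def h k frechet_derivative_at[symmetric])
  have "((\<lambda>y. h (inv_into V \<phi> y) * k (inv_into V \<phi> y)) has_derivative
      (\<lambda>u. h (inv_into V \<phi> (\<phi> p)) * pd (\<lambda>y. k (inv_into V \<phi> y)) u (\<phi> p) +
        pd (\<lambda>y. h (inv_into V \<phi> y)) u (\<phi> p) * k (inv_into V \<phi> (\<phi> p)))) (at (\<phi> p))"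
    by (intro has_derivative_mult d h k)
  moreover have "smooth_fun_at M p (\<lambda>q. h q * k q)" by (intro smooth_fun_at_mult M h k)
  ultimately show "chart_vector M V \<phi> u p (\<lambda>q. h q * k q) =
      chart_vector M V \<phi> u p h * k p + h p * chart_vector M V \<phi> u p k"
    by (simp add: chart_vector_def h k frechet_derivative_at[symmetric] inv_chart[OF M c p])
qed (simp add: chart_vector_def)

lemma smooth_vfD:
  assumes "smooth_vf M W X"
  shows "openin (mtop M) W" "p \<in> W \<Longrightarrow> X p \<in> tangent_space M p"
    "smooth_fun M V h \<Longrightarrow> smooth_fun M (W \<inter> V) (\<lambda>p. X p h)"
  using assms unfolding smooth_vf_def smooth_section_def by (auto simp: Int_def)

lemma smooth_vfI:
  assumes "openin (mtop M) W" "\<And>p. p \<in> W \<Longrightarrow> X p \<in> tangent_space M p"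
    "\<And>V h. smooth_fun M V h \<Longrightarrow> smooth_fun M (W \<inter> V) (\<lambda>p. X p h)"
  shows "smooth_vf M W X"
  using assms unfolding smooth_vf_def smooth_section_def by (auto simp: Int_def)

lemma chart_vector_field:
  assumes M: "smooth_manifold M" and c: "(V, \<phi>) \<in> atlas M"
  shows "smooth_vf M V (chart_vector M V \<phi> u)"
proof (rule smooth_vfI[OF chart_props(1)[OF M c] chart_vector_tangent[OF M c]])
  fix W h assume h: "smooth_fun M W h"
  have o: "openin (mtop M) (V \<inter> W)" using chart_props(1)[OF M c] smooth_funD(1)[OF h] by blast
  have "smooth_fun M (V \<inter> W) (\<lambda>p. pd (\<lambda>y. h (inv_into V \<phi> y)) u (\<phi> p))"
    by (rule smooth_fun_compose[OF M o _ smooth_on_pd[OF smooth_funD(2)[OF h c]]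
          chart_image_open[OF M c smooth_funD(1)[OF h]]])
       (auto intro: smooth_fun_subset[OF smooth_fun_chart[OF M c] o])
  then show "smooth_fun M (V \<inter> W) (\<lambda>p. chart_vector M V \<phi> u p h)"
    by (rule smooth_fun_cong[OF M]) (auto simp: chart_vector_def dest: smooth_fun_atI[OF h])
qed

lemma chart_vector_unique:
  assumes M: "smooth_manifold M" and c: "(V, \<phi>) \<in> atlas M" and p: "p \<in> V"
    and v: "v \<in> tangent_space M p"
  shows "v = chart_vector M V \<phi> (deriv_along v \<phi>) p"
proof
  fix h show "v h = chart_vector M V \<phi> (deriv_along v \<phi>) p h"
    using tangent_chart[OF M c p v] tangentD(1)[OF v] by (simp add: chart_vector_def)
qed

text \<open>In a chart around p the vector is continued with constant coordinates.\<close>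

lemma tangent_extends_locally:
  assumes M: "smooth_manifold M" and p: "p \<in> points M" and v: "v \<in> tangent_space M p"
  obtains N X where "p \<in> N" "smooth_vf M N X" "X p = v"
proof -
  obtain V \<phi> where c: "(V, \<phi>) \<in> atlas M" "p \<in> V" using chart_at[OF M p] .
  show ?thesis
    by (rule that[OF c(2) chart_vector_field[OF M c(1)] chart_vector_unique[OF M c v, symmetric]])
qed

subsection \<open>Open submanifolds\<close>

lemma openin_restrict:
  assumes "openin (mtop M) U"
  shows "openin (mtop (restrict_manifold M U)) W \<longleftrightarrow> W \<subseteq> U \<and> openin (mtop M) W"
  using openin_open_subtopology[OF assms] by (auto simp: restrict_manifold_def)

lemma points_restrict: "U \<subseteq> points M \<Longrightarrow> points (restrict_manifold M U) = U"
  by (auto simp: restrict_manifold_def)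

lemma atlas_restrict: "(W, \<phi>) \<in> atlas (restrict_manifold M U) \<longleftrightarrow> (\<exists>V. (V, \<phi>) \<in> atlas M \<and> W = V \<inter> U)"
  by (auto simp: restrict_manifold_def)

lemma inv_into_restrict: "inj_on \<phi> V \<Longrightarrow> y \<in> \<phi> ` (V \<inter> U) \<Longrightarrow> inv_into (V \<inter> U) \<phi> y = inv_into V \<phi> y"
  by (auto simp: inv_into_f_f inj_on_subset)

text \<open>An equality of records: the affine embedding is given on U and the statistical one on a
  smaller set, and this lets the conclusion speak of a restriction of M itself.\<close>

lemma restrict_restrict:
  assumes "U' \<subseteq> U"
  shows "restrict_manifold (restrict_manifold M U) U' = restrict_manifold M U'"
proof -
  have e: "U \<inter> U' = U'" using assms by blast
  have "x \<in> atlas (restrict_manifold (restrict_manifold M U) U') \<longleftrightarrow> x \<in> atlas (restrict_manifold M U')" for x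
  proof (cases x)
    case (Pair W \<phi>)
    have "(\<exists>V. (\<exists>V'. (V', \<phi>) \<in> atlas M \<and> V = V' \<inter> U) \<and> W = V \<inter> U') \<longleftrightarrow>
        (\<exists>V'. (V', \<phi>) \<in> atlas M \<and> W = V' \<inter> (U \<inter> U'))"
      unfolding Int_assoc[symmetric] by blast
    then show ?thesis unfolding Pair atlas_restrict e .
  qed
  then have "atlas (restrict_manifold (restrict_manifold M U) U') = atlas (restrict_manifold M U')" by blast
  moreover have "mtop (restrict_manifold (restrict_manifold M U) U') = mtop (restrict_manifold M U')"
    by (simp add: restrict_manifold_def subtopology_subtopology e)
  ultimately show ?thesis by simp
qed

text \<open>Restricting a chart changes the set in \<open>inv_into\<close>, but both inverses agree
  on the image of V \<inter> U. As the images are open, this agreement transfers smoothness in both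
  directions.\<close>

lemma smooth_fun_restrict:
  assumes M: "smooth_manifold M" and U: "openin (mtop M) U"
  shows "smooth_fun (restrict_manifold M U) W h \<longleftrightarrow> W \<subseteq> U \<and> smooth_fun M W h"
proof (cases "W \<subseteq> U \<and> openin (mtop M) W")
  case False
  then show ?thesis using openin_restrict[OF U] smooth_funD(1) by metis
next
  case True
  have "smooth_on (\<lambda>y. h (inv_into (V \<inter> U) \<phi> y)) (\<phi> ` (V \<inter> U \<inter> W)) \<longleftrightarrow>
      smooth_on (\<lambda>y. h (inv_into V \<phi> y)) (\<phi> ` (V \<inter> W))" if c: "(V, \<phi>) \<in> atlas M" for V \<phi>
  proof -
    have e: "V \<inter> U \<inter> W = V \<inter> W" using True by blast
    show ?thesis unfolding e
      by (rule smooth_on_cong_iff[OF chart_image_open[OF M c]])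
         (use True inv_into_restrict[OF chart_props(3)[OF M c], of _ U] in auto)
  qed
  note eq = this
  have o: "openin (mtop (restrict_manifold M U)) W" using True openin_restrict[OF U] by blast
  show ?thesis
  proof
    assume h: "smooth_fun (restrict_manifold M U) W h"
    have "smooth_fun M W h"
    proof (rule smooth_funI)
      fix V \<phi> assume c: "(V, \<phi>) \<in> atlas M"
      then have "(V \<inter> U, \<phi>) \<in> atlas (restrict_manifold M U)" by (auto simp: atlas_restrict)
      from smooth_funD(2)[OF h this] show "smooth_on (\<lambda>y. h (inv_into V \<phi> y)) (\<phi> ` (V \<inter> W))"
        using eq[OF c] by simp
    qed (use True in blast)
    then show "W \<subseteq> U \<and> smooth_fun M W h" using True by blast
  next
    assume h: "W \<subseteq> U \<and> smooth_fun M W h"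
    show "smooth_fun (restrict_manifold M U) W h"
    proof (rule smooth_funI[OF o])
      fix V' \<phi> assume "(V', \<phi>) \<in> atlas (restrict_manifold M U)"
      then obtain V where c: "(V, \<phi>) \<in> atlas M" "V' = V \<inter> U" by (auto simp: atlas_restrict)
      show "smooth_on (\<lambda>y. h (inv_into V' \<phi> y)) (\<phi> ` (V' \<inter> W))"
        unfolding c(2) eq[OF c(1)] using h c(1) by (auto dest: smooth_funD(2))
    qed
  qed
qed

lemma smooth_fun_at_restrict:
  assumes M: "smooth_manifold M" and U: "openin (mtop M) U" and p: "p \<in> U"
  shows "smooth_fun_at (restrict_manifold M U) p h \<longleftrightarrow> smooth_fun_at M p h"
proof
  assume "smooth_fun_at M p h"
  then obtain W where W: "p \<in> W" "smooth_fun M W h" unfolding smooth_fun_at_def by blast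
  have o: "openin (mtop M) (W \<inter> U)" using U smooth_funD(1)[OF W(2)] by blast
  have "smooth_fun (restrict_manifold M U) (W \<inter> U) h"
    using smooth_fun_subset[OF W(2) o] by (simp add: smooth_fun_restrict[OF M U])
  then show "smooth_fun_at (restrict_manifold M U) p h" by (rule smooth_fun_atI) (use W p in auto)
qed (auto simp: smooth_fun_at_def smooth_fun_restrict[OF M U])

lemma tangent_space_restrict:
  assumes "smooth_manifold M" "openin (mtop M) U" "p \<in> U"
  shows "tangent_space (restrict_manifold M U) p = tangent_space M p"
  unfolding tangent_space_def smooth_fun_at_restrict[OF assms] ..

lemma smooth_vf_restrict:
  assumes M: "smooth_manifold M" and U: "openin (mtop M) U"
  shows "smooth_vf (restrict_manifold M U) W X \<longleftrightarrow> W \<subseteq> U \<and> smooth_vf M W X"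
proof
  assume X: "smooth_vf (restrict_manifold M U) W X"
  have W: "W \<subseteq> U" "openin (mtop M) W" using smooth_vfD(1)[OF X] openin_restrict[OF U] by auto
  have "smooth_vf M W X"
  proof (rule smooth_vfI[OF W(2)])
    show "X p \<in> tangent_space M p" if "p \<in> W" for p
      using smooth_vfD(2)[OF X that] tangent_space_restrict[OF M U] W that by blast
    fix V h assume h: "smooth_fun M V h"
    have o: "openin (mtop M) (V \<inter> U)" using U smooth_funD(1)[OF h] by blast
    have "smooth_fun (restrict_manifold M U) (V \<inter> U) h"
      using smooth_fun_subset[OF h o] by (simp add: smooth_fun_restrict[OF M U])
    from smooth_vfD(3)[OF X this] have "smooth_fun M (W \<inter> (V \<inter> U)) (\<lambda>p. X p h)"
      by (simp add: smooth_fun_restrict[OF M U])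
    moreover have "W \<inter> (V \<inter> U) = W \<inter> V" using W by blast
    ultimately show "smooth_fun M (W \<inter> V) (\<lambda>p. X p h)" by simp
  qed
  then show "W \<subseteq> U \<and> smooth_vf M W X" using W by blast
next
  assume "W \<subseteq> U \<and> smooth_vf M W X"
  then have W: "W \<subseteq> U" and X: "smooth_vf M W X" by auto
  show "smooth_vf (restrict_manifold M U) W X"
  proof (rule smooth_vfI)
    show "openin (mtop (restrict_manifold M U)) W" using W smooth_vfD(1)[OF X] openin_restrict[OF U] by auto
    show "X p \<in> tangent_space (restrict_manifold M U) p" if "p \<in> W" for p
      using smooth_vfD(2)[OF X that] tangent_space_restrict[OF M U] W that by blast
    show "smooth_fun (restrict_manifold M U) (W \<inter> V) (\<lambda>p. X p h)"
      if "smooth_fun (restrict_manifold M U) V h" for V h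
      using that smooth_vfD(3)[OF X] W by (auto simp: smooth_fun_restrict[OF M U])
  qed
qed

lemma vector_fields_restrict:
  assumes "smooth_manifold M" "openin (mtop M) U"
  shows "X \<in> vector_fields (restrict_manifold M U) \<longleftrightarrow> smooth_vf M U X"
  using points_restrict[OF openin_subset[OF assms(2)]]
  by (simp add: vector_fields_def smooth_vf_restrict[OF assms])

lemma smooth_manifold_restrict:
  assumes M: "smooth_manifold M" and U: "openin (mtop M) U"
  shows "smooth_manifold (restrict_manifold M U)"
  unfolding smooth_manifold_def
proof (intro conjI)
  have UM: "U \<subseteq> points M" using U by (rule openin_subset)
  show "Hausdorff_space (mtop (restrict_manifold M U))" "second_countable (mtop (restrict_manifold M U))"
    using M by (auto simp: smooth_manifold_def restrict_manifold_def
        intro: Hausdorff_space_subtopology second_countable_subtopology)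
  show "(\<Union>(V, \<phi>)\<in>atlas (restrict_manifold M U). V) = points (restrict_manifold M U)"
  proof -
    have e: "(\<Union>(V, \<phi>)\<in>A. V) = {p. \<exists>V \<phi>. (V, \<phi>) \<in> A \<and> p \<in> V}"
      for A :: "('a set \<times> ('a \<Rightarrow> 'b)) set"
      by auto
    have "points M = {p. \<exists>V \<phi>. (V, \<phi>) \<in> atlas M \<and> p \<in> V}"
      using M unfolding smooth_manifold_def e by blast
    moreover have "(\<exists>W \<phi>. (W, \<phi>) \<in> atlas (restrict_manifold M U) \<and> p \<in> W) \<longleftrightarrow>
        (\<exists>V \<phi>. (V, \<phi>) \<in> atlas M \<and> p \<in> V) \<and> p \<in> U" for p
      unfolding atlas_restrict by blast
    ultimately show ?thesis using UM unfolding points_restrict[OF UM] e by blast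
  qed
  show "\<forall>(W, \<phi>)\<in>atlas (restrict_manifold M U). openin (mtop (restrict_manifold M U)) W \<and> open (\<phi> ` W) \<and>
        homeomorphic_map (subtopology (mtop (restrict_manifold M U)) W) (top_of_set (\<phi> ` W)) \<phi>"
  proof (clarify, unfold atlas_restrict, clarify)
    fix V \<phi> assume c: "(V, \<phi>) \<in> atlas M"
    have t: "subtopology (mtop (restrict_manifold M U)) (V \<inter> U) = subtopology (mtop M) (V \<inter> U)"
      by (simp add: restrict_manifold_def subtopology_subtopology Int_ac)
    have "homeomorphic_map (subtopology (subtopology (mtop M) V) (V \<inter> U))
        (subtopology (top_of_set (\<phi> ` V)) (\<phi> ` (V \<inter> U))) \<phi>"
      by (rule homeomorphic_map_subtopologies_alt[OF chart_props(5)[OF M c], THEN iffD1[OF refl]])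
         (use chart_props(3)[OF M c] UM in \<open>auto simp: inj_on_def\<close>)
    then have "homeomorphic_map (subtopology (mtop M) (V \<inter> U)) (top_of_set (\<phi> ` (V \<inter> U))) \<phi>"
      by (simp add: subtopology_subtopology Int_absorb1 image_mono)
    then show "openin (mtop (restrict_manifold M U)) (V \<inter> U) \<and> open (\<phi> ` (V \<inter> U)) \<and>
        homeomorphic_map (subtopology (mtop (restrict_manifold M U)) (V \<inter> U)) (top_of_set (\<phi> ` (V \<inter> U))) \<phi>"
      unfolding t using chart_image_open[OF M c U] chart_props(1)[OF M c] U openin_restrict[OF U] by auto
  qed
  show "\<forall>(W, \<phi>)\<in>atlas (restrict_manifold M U). \<forall>(W', \<psi>)\<in>atlas (restrict_manifold M U).
        smooth_on (\<psi> \<circ> inv_into W \<phi>) (\<phi> ` (W \<inter> W'))"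
  proof (clarify, unfold atlas_restrict, clarify)
    fix V \<phi> V' \<psi> assume c: "(V, \<phi>) \<in> atlas M" and c': "(V', \<psi>) \<in> atlas M"
    have o: "open (\<phi> ` (V \<inter> (V' \<inter> U)))"
      using chart_props(1)[OF M c'] U by (intro chart_image_open[OF M c]) blast
    have "smooth_on (\<psi> \<circ> inv_into V \<phi>) (\<phi> ` (V \<inter> V'))"
      using M c c' unfolding smooth_manifold_def by blast
    then have "smooth_on (\<psi> \<circ> inv_into V \<phi>) (\<phi> ` (V \<inter> (V' \<inter> U)))"
      by (rule smooth_on_subset) auto
    then have "smooth_on (\<psi> \<circ> inv_into (V \<inter> U) \<phi>) (\<phi> ` (V \<inter> (V' \<inter> U)))"
      by (rule smooth_on_cong[OF _ o])
         (use inv_into_restrict[OF chart_props(3)[OF M c], of _ U] in auto)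
    moreover have "V \<inter> U \<inter> (V' \<inter> U) = V \<inter> (V' \<inter> U)" by blast
    ultimately show "smooth_on (\<psi> \<circ> inv_into (V \<inter> U) \<phi>) (\<phi> ` (V \<inter> U \<inter> (V' \<inter> U)))" by simp
  qed
qed

section \<open>Euclidean space as a manifold and maps into it\<close>

lemma smooth_manifold_euclid: "smooth_manifold (euclid :: ('f::euclidean_space, 'f) manifold)"
proof -
  have "second_countable (euclidean :: 'f topology)"
  proof -
    obtain \<B> :: "'f set set" where B: "countable \<B>" "topological_basis \<B>"
      using ex_countable_basis by (elim exE conjE)
    have "\<exists>V\<in>\<B>. x \<in> V \<and> V \<subseteq> U" if "open U" "x \<in> U" for U x
      using topological_basisE[OF B(2) that] by metis
    then show ?thesis
      unfolding second_countable_def using B(1) topological_basis_open[OF B(2)]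
      by (intro exI[of _ \<B>]) simp
  qed
  moreover have "inv_into UNIV (\<lambda>y::'f. y) = (\<lambda>y. y)" by (metis inv_id eq_id_iff)
  moreover have "homeomorphic_map (euclidean :: 'f topology) euclidean (\<lambda>y. y)"
    using homeomorphic_map_id[of euclidean euclidean] by (simp add: id_def)
  ultimately show ?thesis
    by (simp add: smooth_manifold_def euclid_def o_def smooth_on_ident Hausdorff_space_euclidean)
qed

lemma smooth_fun_euclid: "smooth_fun euclid W h \<longleftrightarrow> open W \<and> smooth_on h W"
proof -
  have "inv_into UNIV (\<lambda>y::'a. y) = (\<lambda>y. y)" by (metis inv_id eq_id_iff)
  then show ?thesis by (simp add: smooth_fun_def euclid_def o_def)
qed

lemma openin_euclid [simp]: "openin (mtop euclid) W \<longleftrightarrow> open W"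
  and points_euclid [simp]: "points euclid = UNIV"
  by (simp_all add: euclid_def)

lemma restrict_euclid_UNIV: "restrict_manifold euclid UNIV = euclid"
  by (simp add: restrict_manifold_def euclid_def)

lemma points_open_euclid [simp]: "points (restrict_manifold euclid W) = W"
  by (simp add: points_restrict)

lemma smooth_map_components:
  assumes M: "smooth_manifold M" and F: "smooth_map M (restrict_manifold euclid W) F" and "open W"
  shows "smooth_fun M (points M) (\<lambda>q. F q \<bullet> b)" "q \<in> points M \<Longrightarrow> F q \<in> W"
proof -
  have cm: "continuous_map (mtop M) (mtop (restrict_manifold euclid W)) F" using F by (simp add: smooth_map_def)
  have sub: "F q \<in> W" if "q \<in> points M" for q
    using continuous_map_image_subset_topspace[OF cm] that by auto
  then show "q \<in> points M \<Longrightarrow> F q \<in> W" .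
  show "smooth_fun M (points M) (\<lambda>q. F q \<bullet> b)"
  proof (rule smooth_funI[OF openin_topspace])
    fix V \<phi> assume c: "(V, \<phi>) \<in> atlas M"
    have "(W, \<lambda>y. y) \<in> atlas (restrict_manifold euclid W)"
      by (auto simp: restrict_manifold_def euclid_def)
    then have "smooth_on ((\<lambda>y. y) \<circ> F \<circ> inv_into V \<phi>) (\<phi> ` (V \<inter> F -` W))"
      using F c unfolding smooth_map_def by blast
    moreover have "V \<inter> F -` W = V \<inter> points M" using sub chart_props(2)[OF M c] by auto
    ultimately show "smooth_on (\<lambda>y. F (inv_into V \<phi> y) \<bullet> b) (\<phi> ` (V \<inter> points M))"
      using chart_image_open[OF M c openin_topspace] by (intro smooth_on_inner smooth_on_const) (simp_all add: o_def)
  qed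
qed

lemma smooth_map_euclid_components:
  "smooth_manifold M \<Longrightarrow> smooth_map M euclid F \<Longrightarrow> smooth_fun M (points M) (\<lambda>q. F q \<bullet> b)"
  using smooth_map_components(1)[of M UNIV F b] by (simp add: restrict_euclid_UNIV)

text \<open>The topological part is composition with an inclusion. Injectivity of the differential
  carries over because an open subset has the same tangent spaces and the same functions smooth near
  each of its points.\<close>

lemma embedding_restrict:
  fixes f :: "'a \<Rightarrow> 'f::euclidean_space"
  assumes M: "smooth_manifold M" and f: "embedding M euclid f" and U: "openin (mtop M) U"
    and W: "open W" and sub: "f ` U \<subseteq> W"
  shows "embedding (restrict_manifold M U) (restrict_manifold euclid W) f"
  unfolding embedding_def
proof (intro conjI ballI)
  have UM: "U \<subseteq> points M" using U by (rule openin_subset)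
  have W': "openin (mtop euclid) W" using W by simp
  have emb: "embedding_map (mtop M) euclidean f" and sm: "smooth_map M euclid f"
    using f by (auto simp: embedding_def euclid_def)
  have emb': "embedding_map (subtopology (mtop M) U) (top_of_set W) f"
  proof -
    have "embedding_map (subtopology (mtop M) U) (mtop M) id"
      unfolding embedding_map_def
      using UM by (simp add: Int_absorb1)
    from embedding_map_compose[OF this emb] show ?thesis
      using sub UM by (auto simp: embedding_map_in_subtopology)
  qed
  then show "embedding_map (mtop (restrict_manifold M U)) (mtop (restrict_manifold euclid W)) f"
    by (simp add: restrict_manifold_def euclid_def)
  show "smooth_map (restrict_manifold M U) (restrict_manifold euclid W) f"
    unfolding smooth_map_def
  proof (intro conjI ballI)
    show "continuous_map (mtop (restrict_manifold M U)) (mtop (restrict_manifold euclid W)) f"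
    proof -
      have "continuous_map (subtopology (mtop M) U) (top_of_set W) f"
        using emb' unfolding embedding_map_def
        by (blast intro: homeomorphic_imp_continuous_map continuous_map_into_fulltopology)
      then show ?thesis by (simp add: restrict_manifold_def euclid_def)
    qed
    show "case x of (V, \<phi>) \<Rightarrow> \<forall>(V', \<psi>)\<in>atlas (restrict_manifold euclid W).
        smooth_on (\<psi> \<circ> f \<circ> inv_into V \<phi>) (\<phi> ` (V \<inter> f -` V'))" if "x \<in> atlas (restrict_manifold M U)" for x
    proof -
      obtain W' \<phi> where x: "x = (W', \<phi>)" by (cases x)
      then have "(W', \<phi>) \<in> atlas (restrict_manifold M U)" using that by simp
      then obtain V where "(V, \<phi>) \<in> atlas M" "W' = V \<inter> U"
        unfolding atlas_restrict by (elim exE conjE)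
      with x have c: "x = (V \<inter> U, \<phi>)" "(V, \<phi>) \<in> atlas M" by simp_all
      have "smooth_on ((\<lambda>y. y) \<circ> f \<circ> inv_into V \<phi>) (\<phi> ` (V \<inter> f -` UNIV))"
        using sm c unfolding smooth_map_def by (auto simp: euclid_def)
      then have "smooth_on (\<lambda>y. f (inv_into V \<phi> y)) (\<phi> ` (V \<inter> U))"
        by (auto simp: o_def elim: smooth_on_subset)
      then have "smooth_on (\<lambda>y. f (inv_into (V \<inter> U) \<phi> y)) (\<phi> ` (V \<inter> U))"
        by (rule smooth_on_cong[OF _ chart_image_open[OF M c(2) U]])
           (simp add: inv_into_restrict[OF chart_props(3)[OF M c(2)]])
      moreover have "V \<inter> U \<inter> f -` W = V \<inter> U" using sub by auto
      ultimately show ?thesis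
        unfolding c(1) by (auto simp: restrict_manifold_def euclid_def o_def)
    qed
  qed
  fix p assume "p \<in> points (restrict_manifold M U)"
  then have p: "p \<in> U" using points_restrict[OF UM] by simp
  then have fp: "f p \<in> W" using sub by blast
  have "pushforward (restrict_manifold euclid W) f p = pushforward euclid f p"
    by (simp add: pushforward_def fun_eq_iff smooth_fun_at_restrict[OF smooth_manifold_euclid W' fp])
  then show "inj_on (pushforward (restrict_manifold euclid W) f p) (tangent_space (restrict_manifold M U) p)"
    using f p UM unfolding embedding_def tangent_space_restrict[OF M U p] by auto
qed

section \<open>Hessian structures on open subsets of Euclidean space\<close>

lemma smooth_manifold_open: "open W \<Longrightarrow> smooth_manifold (restrict_manifold euclid W)"
  by (simp add: smooth_manifold_restrict smooth_manifold_euclid)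

lemma smooth_fun_open:
  "open W \<Longrightarrow> smooth_fun (restrict_manifold euclid W) V h \<longleftrightarrow> V \<subseteq> W \<and> open V \<and> smooth_on h V"
  by (simp add: smooth_fun_restrict smooth_manifold_euclid smooth_fun_euclid)

lemma smooth_fun_at_open:
  "open W \<Longrightarrow> p \<in> W \<Longrightarrow> smooth_fun_at (restrict_manifold euclid W) p h \<longleftrightarrow> smooth_fun_at euclid p h"
  by (simp add: smooth_fun_at_restrict smooth_manifold_euclid)

lemma tangent_space_open:
  "open W \<Longrightarrow> p \<in> W \<Longrightarrow> tangent_space (restrict_manifold euclid W) p = tangent_space euclid p"
  by (simp add: tangent_space_restrict smooth_manifold_euclid)

lemma smooth_fun_at_euclidI: "open V \<Longrightarrow> smooth_on h V \<Longrightarrow> p \<in> V \<Longrightarrow> smooth_fun_at euclid p h"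
  by (rule smooth_fun_atI[of _ V]) (simp_all add: smooth_fun_euclid)

lemma smooth_fun_at_euclidE:
  assumes "smooth_fun_at euclid p h"
  obtains V where "open V" "smooth_on h V" "p \<in> V"
  using assms unfolding smooth_fun_at_def smooth_fun_euclid by auto

lemma smooth_fun_at_coord: "smooth_fun_at euclid p (\<lambda>y. y \<bullet> b)"
  by (rule smooth_fun_at_euclidI[OF open_UNIV])
     (auto intro!: smooth_on_inner smooth_on_ident smooth_on_const)

section \<open>Tangent vectors of Euclidean space as vectors\<close>

abbreviation vec_of :: "'f::euclidean_space tvec \<Rightarrow> 'f" where
  "vec_of v \<equiv> deriv_along v (\<lambda>y. y)"

text \<open>Inverse to \<open>vec_of\<close> on derivations at p. It refers to all of
  \<open>euclid\<close>; an open subset containing p has the same tangent space there, so these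
  vectors serve every target \<open>restrict_manifold euclid W\<close>.\<close>

definition flat_vec :: "'f::euclidean_space \<Rightarrow> 'f \<Rightarrow> 'f tvec" where
  "flat_vec p w = (\<lambda>h. if smooth_fun_at euclid p h then pd h w p else 0)"

lemma euclid_chart: "(UNIV, \<lambda>y. y) \<in> atlas euclid" "inv_into UNIV (\<lambda>y::'f::euclidean_space. y) = (\<lambda>y. y)"
proof -
  show "(UNIV, \<lambda>y. y) \<in> atlas euclid" by (simp add: euclid_def)
  show "inv_into UNIV (\<lambda>y::'f. y) = (\<lambda>y. y)" by (metis inv_id eq_id_iff)
qed

lemma flat_vec_chart: "flat_vec p w = chart_vector euclid UNIV (\<lambda>y. y) w p"
  unfolding flat_vec_def chart_vector_def euclid_chart(2) ..

lemma flat_vec_tangent: "flat_vec p w \<in> tangent_space euclid p"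
  unfolding flat_vec_chart by (rule chart_vector_tangent[OF smooth_manifold_euclid euclid_chart(1) UNIV_I])

lemma flat_vec_vec_of: "v \<in> tangent_space euclid p \<Longrightarrow> flat_vec p (vec_of v) = v"
  unfolding flat_vec_chart
  using chart_vector_unique[OF smooth_manifold_euclid euclid_chart(1) UNIV_I, of v p] by simp

lemma tangent_euclid:
  "v \<in> tangent_space euclid p \<Longrightarrow> smooth_fun_at euclid p h \<Longrightarrow> v h = pd h (vec_of v) p"
  using flat_vec_vec_of[of v p] by (metis flat_vec_def)

lemma vec_of_flat_vec: "vec_of (flat_vec p w) = w"
proof (rule euclidean_eqI)
  fix b :: 'a assume b: "b \<in> Basis"
  have "((\<lambda>y. y \<bullet> b) has_derivative (\<lambda>u. u \<bullet> b)) (at p)" by (auto intro!: derivative_eq_intros)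
  then show "vec_of (flat_vec p w) \<bullet> b = w \<bullet> b"
    using b by (simp add: deriv_along_inner flat_vec_def smooth_fun_at_coord frechet_derivative_at[symmetric])
qed

lemma flat_vec_comb: "flat_vec p (a *\<^sub>R u + b *\<^sub>R w) = tvec_comb a (flat_vec p u) b (flat_vec p w)"
proof
  fix h
  show "flat_vec p (a *\<^sub>R u + b *\<^sub>R w) h = tvec_comb a (flat_vec p u) b (flat_vec p w) h"
  proof (cases "smooth_fun_at euclid p h")
    case True
    then obtain V where V: "open V" "smooth_on h V" "p \<in> V" by (rule smooth_fun_at_euclidE)
    show ?thesis
      using True linear_add[OF smooth_on_linear_pd[OF V(2,3)]] linear_scale[OF smooth_on_linear_pd[OF V(2,3)]]
      by (simp add: flat_vec_def)
  qed (simp add: flat_vec_def)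
qed

section \<open>Chain rules along a map into Euclidean space\<close>

lemma smooth_compose_at:
  assumes M: "smooth_manifold M" and f: "smooth_map M euclid f" and q: "q \<in> points M"
    and h: "smooth_on h V" "open V" "f q \<in> V"
  shows "openin (mtop M) {x \<in> points M. f x \<in> V}" "smooth_fun M {x \<in> points M. f x \<in> V} (\<lambda>x. h (f x))"
    "smooth_fun_at M q (\<lambda>x. h (f x))"
proof -
  have "continuous_map (mtop M) euclidean f" using f by (simp add: smooth_map_def euclid_def)
  from openin_continuous_map_preimage[OF this, of V] h
  show o: "openin (mtop M) {x \<in> points M. f x \<in> V}" by simp
  show s: "smooth_fun M {x \<in> points M. f x \<in> V} (\<lambda>x. h (f x))"
    by (rule smooth_fun_compose[OF M o smooth_fun_subset[OF smooth_map_euclid_components[OF M f] o] h(1,2)]) auto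
  show "smooth_fun_at M q (\<lambda>x. h (f x))" by (rule smooth_fun_atI[OF s]) (use q h in auto)
qed

lemma pushforward_tangent:
  assumes M: "smooth_manifold M" and f: "smooth_map M euclid f" and q: "q \<in> points M"
    and v: "v \<in> tangent_space M q"
  shows "pushforward euclid f q v \<in> tangent_space euclid (f q)"
proof (rule tangentI)
  note E = smooth_manifold_euclid
  have s: "smooth_fun_at M q (\<lambda>x. h (f x))" if "smooth_fun_at euclid (f q) h" for h
    using that smooth_compose_at(3)[OF M f q] by (elim smooth_fun_at_euclidE) blast
  fix h k a b assume h: "smooth_fun_at euclid (f q) h" and k: "smooth_fun_at euclid (f q) k"
  have "smooth_fun_at euclid (f q) (\<lambda>x. a * h x + b * k x)"
    by (intro smooth_fun_at_add smooth_fun_at_mult smooth_fun_at_const E h k) auto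
  then show "pushforward euclid f q v (\<lambda>x. a * h x + b * k x) =
      a * pushforward euclid f q v h + b * pushforward euclid f q v k"
    using h k tangentD(2)[OF v s[OF h] s[OF k]] by (simp add: pushforward_def o_def)
  have "smooth_fun_at euclid (f q) (\<lambda>x. h x * k x)" by (intro smooth_fun_at_mult E h k)
  then show "pushforward euclid f q v (\<lambda>x. h x * k x) =
      pushforward euclid f q v h * k (f q) + h (f q) * pushforward euclid f q v k"
    using h k tangentD(3)[OF v s[OF h] s[OF k]] by (simp add: pushforward_def o_def)
qed (simp add: pushforward_def)

lemma vec_of_pushforward: "vec_of (pushforward euclid f q v) = deriv_along v f"
  by (rule euclidean_eqI) (simp add: deriv_along_inner pushforward_def smooth_fun_at_coord o_def)

lemma tangent_chain:
  assumes M: "smooth_manifold M" and f: "smooth_map M euclid f" and q: "q \<in> points M"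
    and v: "v \<in> tangent_space M q" and h: "smooth_on h V" "open V" "f q \<in> V"
  shows "v (\<lambda>x. h (f x)) = pd h (deriv_along v f) (f q)"
proof -
  have "smooth_fun_at euclid (f q) h" by (rule smooth_fun_at_euclidI[OF h(2,1,3)])
  then have "v (\<lambda>x. h (f x)) = pushforward euclid f q v h" by (simp add: pushforward_def o_def)
  also have "\<dots> = pd h (deriv_along v f) (f q)"
    using tangent_euclid[OF pushforward_tangent[OF M f q v], of h] smooth_fun_at_euclidI[OF h(2,1,3)]
    by (simp add: vec_of_pushforward)
  finally show ?thesis .
qed

lemma pd_expand: "smooth_on h V \<Longrightarrow> p \<in> V \<Longrightarrow> pd h w p = (\<Sum>b\<in>Basis. (w \<bullet> b) *\<^sub>R pd h b p)"
  by (rule linear_expand[OF smooth_on_linear_pd])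

text \<open>The expansion of \<open>pd h w\<close> over the basis holds throughout V, so it may be
  differentiated once more.\<close>

lemma hess_expand:
  fixes h :: "'f::euclidean_space \<Rightarrow> real"
  assumes h: "smooth_on h V" "open V" "p \<in> V"
  shows "pd (pd h w) u p = (\<Sum>b\<in>Basis. (w \<bullet> b) * pd (pd h b) u p)"
proof -
  have "((\<lambda>y. \<Sum>b\<in>Basis. (w \<bullet> b) * pd h b y) has_derivative (\<lambda>u. \<Sum>b\<in>Basis. (w \<bullet> b) * pd (pd h b) u p)) (at p)"
    by (intro has_derivative_sum has_derivative_mult_right smooth_on_has_derivative[OF smooth_on_pd[OF h(1)] h(3)])
  then have "(pd h w has_derivative (\<lambda>u. \<Sum>b\<in>Basis. (w \<bullet> b) * pd (pd h b) u p)) (at p)"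
    by (rule has_derivative_transform_within_open[OF _ h(2,3)]) (simp add: pd_expand[OF h(1)])
  then show ?thesis by (simp add: frechet_derivative_at[symmetric])
qed

text \<open>Both the direction s and the base point f move with x, and each contributes one term.
  The tangential and the mixed entries of the Hessian of the potential come from this formula, with
  s a tangent field or a frame field on which d\<phi> is constant.\<close>

lemma tangent_pd:
  fixes \<phi> :: "'f::euclidean_space \<Rightarrow> real"
  assumes M: "smooth_manifold M" and f: "smooth_map M euclid f" and q: "q \<in> points M"
    and v: "v \<in> tangent_space M q" and h: "smooth_on \<phi> V" "open V" "f q \<in> V"
    and s: "\<And>b. b \<in> Basis \<Longrightarrow> smooth_fun_at M q (\<lambda>x. s x \<bullet> b)"
  shows "v (\<lambda>x. pd \<phi> (s x) (f x)) = pd \<phi> (deriv_along v s) (f q) + pd (pd \<phi> (s q)) (deriv_along v f) (f q)"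
proof -
  note pdb = smooth_compose_at(3)[OF M f q smooth_on_pd[OF h(1)] h(2,3)]
  have "v (\<lambda>x. pd \<phi> (s x) (f x)) = v (\<lambda>x. \<Sum>b\<in>Basis. (s x \<bullet> b) * pd \<phi> b (f x))"
    by (rule tangent_local[OF M v smooth_compose_at(1)[OF M f q h]])
       (use q h in \<open>auto simp: pd_expand[OF h(1)]\<close>)
  also have "\<dots> = (\<Sum>b\<in>Basis. v (\<lambda>x. (s x \<bullet> b) * pd \<phi> b (f x)))"
    by (intro tangent_sum[OF M q v] smooth_fun_at_mult M s pdb)
  also have "\<dots> = (\<Sum>b\<in>Basis. (deriv_along v s \<bullet> b) * pd \<phi> b (f q) + (s q \<bullet> b) * pd (pd \<phi> b) (deriv_along v f) (f q))"
  proof (rule sum.cong[OF refl])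
    fix b :: 'f assume b: "b \<in> Basis"
    show "v (\<lambda>x. (s x \<bullet> b) * pd \<phi> b (f x)) =
        (deriv_along v s \<bullet> b) * pd \<phi> b (f q) + (s q \<bullet> b) * pd (pd \<phi> b) (deriv_along v f) (f q)"
      using tangentD(3)[OF v s[OF b] pdb[of b]] tangent_chain[OF M f q v smooth_on_pd[OF h(1), of b] h(2,3)]
      by (simp add: deriv_along_inner[OF b])
  qed
  also have "\<dots> = pd \<phi> (deriv_along v s) (f q) + pd (pd \<phi> (s q)) (deriv_along v f) (f q)"
    by (simp add: sum.distrib pd_expand[OF h(1,3), of "deriv_along v s"] hess_expand[OF h, of "s q"])
  finally show ?thesis .
qed

lemma smooth_map_inclusion: "open W \<Longrightarrow> smooth_map (restrict_manifold euclid W) euclid (\<lambda>y. y)"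
proof -
  assume W: "open W"
  have "inv_into W (\<lambda>y. y) y = y" if "y \<in> W" for y :: 'a using inv_into_f_f[of "\<lambda>y. y" W y] that by simp
  then have "smooth_on (inv_into W (\<lambda>y::'a. y)) W"
    by (intro smooth_on_cong[OF smooth_on_ident W]) (use W in simp_all)
  then show ?thesis
    by (simp add: smooth_map_def restrict_manifold_def euclid_def o_def continuous_map_from_subtopology
        continuous_map_id[unfolded id_def])
qed

subsection \<open>The flat connection\<close>

text \<open>One formula serves two purposes: with f the identity it is the flat connection of an
  open subset of the ambient space, and for an embedding it is the pulled-back connection.\<close>

definition flat_conn :: "('a \<Rightarrow> 'f::euclidean_space) \<Rightarrow> ('a, 'f) conn" where
  "flat_conn f p v \<sigma> = flat_vec (f p) (deriv_along v (\<lambda>q. vec_of (\<sigma> q)))"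

text \<open>Components are recovered by applying a section to the coordinate functions, which are
  smooth on W. Together with \<open>flat_section\<close> this identifies smooth sections with smooth
  vector-valued functions.\<close>

lemma section_components:
  fixes f :: "'a \<Rightarrow> 'f::euclidean_space"
  assumes W: "open W" and \<sigma>: "smooth_section M (restrict_manifold euclid W) f \<Omega> \<sigma>"
    and f: "f ` points M \<subseteq> W"
  shows "b \<in> Basis \<Longrightarrow> smooth_fun M \<Omega> (\<lambda>q. vec_of (\<sigma> q) \<bullet> b)"
    "q \<in> \<Omega> \<Longrightarrow> \<sigma> q \<in> tangent_space euclid (f q)"
    "q \<in> \<Omega> \<Longrightarrow> \<sigma> q = flat_vec (f q) (vec_of (\<sigma> q))"
proof -
  have \<Omega>: "openin (mtop M) \<Omega>" using \<sigma> by (simp add: smooth_section_def)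
  then have fW: "f q \<in> W" if "q \<in> \<Omega>" for q using f openin_subset that by blast
  show t: "\<sigma> q \<in> tangent_space euclid (f q)" if "q \<in> \<Omega>" for q
    using \<sigma> that fW[OF that] W by (auto simp: smooth_section_def tangent_space_open)
  show "\<sigma> q = flat_vec (f q) (vec_of (\<sigma> q))" if "q \<in> \<Omega>"
    using flat_vec_vec_of[OF t[OF that]] by simp
  show "smooth_fun M \<Omega> (\<lambda>q. vec_of (\<sigma> q) \<bullet> b)" if b: "b \<in> Basis"
  proof -
    have "smooth_fun (restrict_manifold euclid W) W (\<lambda>y. y \<bullet> b)"
      using W by (simp add: smooth_fun_open smooth_on_inner smooth_on_ident smooth_on_const)
    then have "smooth_fun M {q \<in> \<Omega>. f q \<in> W} (\<lambda>q. \<sigma> q (\<lambda>y. y \<bullet> b))"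
      using \<sigma> unfolding smooth_section_def by blast
    moreover have "{q \<in> \<Omega>. f q \<in> W} = \<Omega>" using fW by blast
    ultimately show ?thesis by (simp add: deriv_along_inner[OF b])
  qed
qed

text \<open>The action on a function h is its derivative in direction s, which is expanded so that
  only partial derivatives of h in fixed directions, composed with f, occur.\<close>

lemma flat_section:
  fixes f :: "'a \<Rightarrow> 'f::euclidean_space"
  assumes M: "smooth_manifold M" and W: "open W" and f: "smooth_map M euclid f" "f ` points M \<subseteq> W"
    and \<Omega>: "openin (mtop M) \<Omega>" and s: "\<And>b. b \<in> Basis \<Longrightarrow> smooth_fun M \<Omega> (\<lambda>q. s q \<bullet> b)"
  shows "smooth_section M (restrict_manifold euclid W) f \<Omega> (\<lambda>q. flat_vec (f q) (s q))"
  unfolding smooth_section_def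
proof (intro conjI ballI allI impI \<Omega>)
  fix q assume "q \<in> \<Omega>"
  then have "f q \<in> W" using f(2) openin_subset[OF \<Omega>] by blast
  then show "flat_vec (f q) (s q) \<in> tangent_space (restrict_manifold euclid W) (f q)"
    using W flat_vec_tangent by (simp add: tangent_space_open)
next
  fix V h assume "smooth_fun (restrict_manifold euclid W) V h"
  then have V: "V \<subseteq> W" "open V" "smooth_on h V" using W by (simp_all add: smooth_fun_open)
  define N where "N = {q \<in> \<Omega>. f q \<in> V}"
  have "continuous_map (mtop M) euclidean f" using f by (simp add: smooth_map_def euclid_def)
  from openin_continuous_map_preimage[OF this, of V] V have "openin (mtop M) {q \<in> points M. f q \<in> V}" by simp
  then have "openin (mtop M) (\<Omega> \<inter> {q \<in> points M. f q \<in> V})" using \<Omega> by blast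
  moreover have "\<Omega> \<inter> {q \<in> points M. f q \<in> V} = N" using openin_subset[OF \<Omega>] by (auto simp: N_def)
  ultimately have N: "openin (mtop M) N" by simp
  have "smooth_fun M N (\<lambda>q. \<Sum>b\<in>Basis. (s q \<bullet> b) * pd h b (f q))"
  proof (intro smooth_fun_sum[OF M N] smooth_fun_mult[OF M])
    fix b :: 'f assume b: "b \<in> Basis"
    show "smooth_fun M N (\<lambda>q. s q \<bullet> b)" by (rule smooth_fun_subset[OF s[OF b] N]) (simp add: N_def)
    show "smooth_fun M N (\<lambda>q. pd h b (f q))"
      by (rule smooth_fun_compose[OF M N smooth_fun_subset[OF smooth_map_euclid_components[OF M f(1)] N]
            smooth_on_pd[OF V(3)] V(2)])
         (use openin_subset[OF N] in \<open>auto simp: N_def\<close>)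
  qed
  then have "smooth_fun M N (\<lambda>q. flat_vec (f q) (s q) h)"
  proof (rule smooth_fun_cong[OF M])
    fix q assume "q \<in> N"
    then have q: "f q \<in> V" by (simp add: N_def)
    show "(\<Sum>b\<in>Basis. (s q \<bullet> b) * pd h b (f q)) = flat_vec (f q) (s q) h"
      using smooth_fun_at_euclidI[OF V(2,3) q] by (simp add: flat_vec_def pd_expand[OF V(3) q, of "s q"])
  qed
  then show "smooth_fun M {q \<in> \<Omega>. f q \<in> V} (\<lambda>q. flat_vec (f q) (s q) h)" by (simp add: N_def)
qed

lemma deriv_along_add:
  assumes "v \<in> tangent_space M p" "\<And>b. b \<in> Basis \<Longrightarrow> smooth_fun_at M p (\<lambda>q. F q \<bullet> b)"
    "\<And>b. b \<in> Basis \<Longrightarrow> smooth_fun_at M p (\<lambda>q. G q \<bullet> b)"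
  shows "deriv_along v (\<lambda>q. F q + G q) = deriv_along v F + deriv_along v G"
  by (rule euclidean_eqI) (simp add: deriv_along_inner inner_add_left tangent_add[OF assms(1) assms(2,3)])

lemma deriv_along_scaleR:
  assumes "v \<in> tangent_space M p" "\<And>b. b \<in> Basis \<Longrightarrow> smooth_fun_at M p (\<lambda>q. F q \<bullet> b)"
    "smooth_fun_at M p c"
  shows "deriv_along v (\<lambda>q. c q *\<^sub>R F q) = v c *\<^sub>R F p + c p *\<^sub>R deriv_along v F"
  by (rule euclidean_eqI) (simp add: deriv_along_inner inner_add_left tangentD(3)[OF assms(1,3,2)])

lemma deriv_along_vec_add: "deriv_along (\<lambda>h. v h + w h) F = deriv_along v F + deriv_along w F"
  using deriv_along_comb[of 1 v 1 w F] by simp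

lemma deriv_along_vec_scale: "deriv_along (\<lambda>h. a * v h) F = a *\<^sub>R deriv_along v F"
  using deriv_along_comb[of a v 0 v F] by simp

lemma connection_along_flat_conn:
  fixes f :: "'a \<Rightarrow> 'f::euclidean_space"
  assumes M: "smooth_manifold M" and W: "open W" and f: "smooth_map M euclid f" "f ` points M \<subseteq> W"
  shows "connection_along M (restrict_manifold euclid W) f (flat_conn f)"
  unfolding connection_along_def
proof (intro conjI ballI allI impI)
  fix p v \<sigma> assume p: "p \<in> points M" and v: "v \<in> tangent_space M p"
    and "smooth_section_at M (restrict_manifold euclid W) f p \<sigma>"
  then obtain \<Omega> where \<Omega>: "p \<in> \<Omega>" "smooth_section M (restrict_manifold euclid W) f \<Omega> \<sigma>"
    by (auto simp: smooth_section_at_def)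
  note sc = section_components[OF W _ f(2)]
  have s: "smooth_fun_at M p (\<lambda>q. vec_of (\<sigma> q) \<bullet> b)" if "b \<in> Basis" for b
    by (rule smooth_fun_atI[OF sc(1)[OF \<Omega>(2) that] \<Omega>(1)])
  have "f p \<in> W" using p f by blast
  then show "flat_conn f p v \<sigma> \<in> tangent_space (restrict_manifold euclid W) (f p)"
    using W flat_vec_tangent by (simp add: tangent_space_open flat_conn_def)
  show "flat_conn f p (tvec_comb a v b w) \<sigma> = tvec_comb a (flat_conn f p v \<sigma>) b (flat_conn f p w \<sigma>)" for w a b
    by (simp add: flat_conn_def deriv_along_comb flat_vec_comb)
  show "flat_conn f p v (\<lambda>q h. \<sigma> q h + \<rho> q h) = (\<lambda>h. flat_conn f p v \<sigma> h + flat_conn f p v \<rho> h)"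
    if \<rho>: "smooth_section_at M (restrict_manifold euclid W) f p \<rho>" for \<rho>
  proof -
    obtain \<Omega>' where \<Omega>': "p \<in> \<Omega>'" "smooth_section M (restrict_manifold euclid W) f \<Omega>' \<rho>"
      using \<rho> by (auto simp: smooth_section_at_def)
    have r: "smooth_fun_at M p (\<lambda>q. vec_of (\<rho> q) \<bullet> b)" if "b \<in> Basis" for b
      by (rule smooth_fun_atI[OF sc(1)[OF \<Omega>'(2) that] \<Omega>'(1)])
    have "deriv_along v (\<lambda>q. vec_of (\<sigma> q) + vec_of (\<rho> q)) =
        deriv_along v (\<lambda>q. vec_of (\<sigma> q)) + deriv_along v (\<lambda>q. vec_of (\<rho> q))"
      by (rule deriv_along_add[OF v]) (auto intro: s r)
    then show ?thesis
      unfolding flat_conn_def deriv_along_vec_add using flat_vec_comb[of "f p" 1 _ 1] by simp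
  qed
  show "flat_conn f p v (\<lambda>q h. c q * \<sigma> q h) = (\<lambda>h. v c * \<sigma> p h + c p * flat_conn f p v \<sigma> h)"
    if c: "smooth_fun_at M p c" for c
  proof -
    have "deriv_along v (\<lambda>q. c q *\<^sub>R vec_of (\<sigma> q)) =
        v c *\<^sub>R vec_of (\<sigma> p) + c p *\<^sub>R deriv_along v (\<lambda>q. vec_of (\<sigma> q))"
      by (rule deriv_along_scaleR[OF v _ c]) (rule s)
    then show ?thesis
      unfolding flat_conn_def deriv_along_vec_scale
      by (simp only: flat_vec_comb sc(3)[OF \<Omega>(2,1), symmetric])
  qed
  show "flat_conn f p v \<rho> = flat_conn f p v \<sigma>"
    if "p \<in> N \<and> openin (mtop M) N \<and> (\<forall>q\<in>N. \<rho> q = \<sigma> q)" for N \<rho>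
    unfolding flat_conn_def using that
    by (intro arg_cong[where f = "flat_vec (f p)"] deriv_along_local[OF M v, of N]) auto
next
  fix \<Omega> X \<sigma> assume "smooth_vf M \<Omega> X \<and> smooth_section M (restrict_manifold euclid W) f \<Omega> \<sigma>"
  then have X: "smooth_vf M \<Omega> X" and \<sigma>: "smooth_section M (restrict_manifold euclid W) f \<Omega> \<sigma>" by auto
  show "smooth_section M (restrict_manifold euclid W) f \<Omega> (\<lambda>p. flat_conn f p (X p) \<sigma>)"
    unfolding flat_conn_def
  proof (rule flat_section[OF M W f smooth_vfD(1)[OF X]])
    fix b :: 'f assume b: "b \<in> Basis"
    show "smooth_fun M \<Omega> (\<lambda>q. deriv_along (X q) (\<lambda>q. vec_of (\<sigma> q)) \<bullet> b)"
      using smooth_vfD(3)[OF X section_components(1)[OF W \<sigma> f(2) b]] by (simp add: deriv_along_inner[OF b])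
  qed
qed

lemma pushforward_open:
  assumes "open W" "f q \<in> W"
  shows "pushforward (restrict_manifold euclid W) f q v = pushforward euclid f q v"
  unfolding pushforward_def smooth_fun_at_open[OF assms] ..

text \<open>Applying the pushforward of v to a component of Z is by definition applying v to that
  component composed with f; the components are smooth near f p because Z is.\<close>

lemma pullback_flat_conn:
  fixes f :: "'a \<Rightarrow> 'f::euclidean_space"
  assumes M: "smooth_manifold M" and W: "open W" and f: "smooth_map M euclid f" "f ` points M \<subseteq> W"
  shows "pullback_connection M (restrict_manifold euclid W) f (flat_conn (\<lambda>y. y)) (flat_conn f)"
  unfolding pullback_connection_def
proof (intro conjI connection_along_flat_conn[OF assms] ballI allI impI)
  fix p v V Z assume p: "p \<in> points M" and v: "v \<in> tangent_space M p"
    and VZ: "f p \<in> V \<and> smooth_vf (restrict_manifold euclid W) V Z"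
  have fp: "f p \<in> W" using p f by blast
  have "deriv_along v (\<lambda>q. vec_of (Z (f q))) = deriv_along (pushforward euclid f p v) (\<lambda>q. vec_of (Z q))"
  proof (rule euclidean_eqI)
    fix b :: 'f assume b: "b \<in> Basis"
    have "smooth_fun (restrict_manifold euclid W) V (\<lambda>q. vec_of (Z q) \<bullet> b)"
      using VZ b by (intro section_components(1)[OF W]) (auto simp: smooth_vf_def)
    then have "smooth_fun_at euclid (f p) (\<lambda>q. vec_of (Z q) \<bullet> b)"
      using VZ W by (intro smooth_fun_at_euclidI[of V]) (auto simp: smooth_fun_open)
    then show "deriv_along v (\<lambda>q. vec_of (Z (f q))) \<bullet> b =
        deriv_along (pushforward euclid f p v) (\<lambda>q. vec_of (Z q)) \<bullet> b"
      using b by (simp add: deriv_along_inner pushforward_def o_def)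
  qed
  then show "flat_conn f p v (\<lambda>q. Z (f q)) =
      flat_conn (\<lambda>y. y) (f p) (pushforward (restrict_manifold euclid W) f p v) Z"
    by (simp add: flat_conn_def pushforward_open[of W f p, OF W fp])
qed

lemma vector_field_open:
  assumes W: "open W" and X: "X \<in> vector_fields (restrict_manifold euclid W)" and p: "p \<in> W"
  shows "X p \<in> tangent_space euclid p" "X p \<in> tangent_space (restrict_manifold euclid W) p"
    "X p = flat_vec p (vec_of (X p))"
    "b \<in> Basis \<Longrightarrow> smooth_fun (restrict_manifold euclid W) W (\<lambda>q. vec_of (X q) \<bullet> b)"
    "b \<in> Basis \<Longrightarrow> smooth_fun_at (restrict_manifold euclid W) p (\<lambda>q. vec_of (X q) \<bullet> b)"
proof -
  have s: "smooth_section (restrict_manifold euclid W) (restrict_manifold euclid W) (\<lambda>p. p) W X"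
    using X by (simp add: vector_fields_def smooth_vf_def)
  note sc = section_components[OF W s]
  show "X p \<in> tangent_space euclid p" "X p = flat_vec p (vec_of (X p))" using sc(2,3)[OF _ p] by auto
  then show "X p \<in> tangent_space (restrict_manifold euclid W) p" using W p by (simp add: tangent_space_open)
  show "smooth_fun (restrict_manifold euclid W) W (\<lambda>q. vec_of (X q) \<bullet> b)" if "b \<in> Basis" for b
    using sc(1)[OF _ that] by simp
  then show "b \<in> Basis \<Longrightarrow> smooth_fun_at (restrict_manifold euclid W) p (\<lambda>q. vec_of (X q) \<bullet> b)"
    using p by (blast intro: smooth_fun_atI)
qed

text \<open>The Hessian term is symmetric in the two fields, so in their bracket only the
  derivatives of the components survive. These are the values of the flat connection, whence its
  torsion vanishes.\<close>

lemma vector_field_apply: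
  assumes W: "open W" and X: "X \<in> vector_fields (restrict_manifold euclid W)"
    and Y: "Y \<in> vector_fields (restrict_manifold euclid W)" and p: "p \<in> W" and h: "smooth_fun_at euclid p h"
  shows "X p (\<lambda>q. Y q h) =
    pd h (deriv_along (X p) (\<lambda>q. vec_of (Y q))) p + pd (pd h (vec_of (Y p))) (vec_of (X p)) p"
proof -
  let ?S = "restrict_manifold euclid W"
  obtain V where V: "open V" "smooth_on h V" "p \<in> V" using h by (rule smooth_fun_at_euclidE)
  note S = smooth_manifold_open[OF W]
  have "X p (\<lambda>q. Y q h) = X p (\<lambda>q. pd h (vec_of (Y q)) q)"
  proof (rule tangent_local[OF S vector_field_open(2)[OF W X p], of "W \<inter> V"])
    show "openin (mtop ?S) (W \<inter> V)" using W V openin_restrict[of euclid W] by auto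
    fix q assume q: "q \<in> W \<inter> V"
    then show "Y q h = pd h (vec_of (Y q)) q"
      using tangent_euclid[OF vector_field_open(1)[OF W Y]] smooth_fun_at_euclidI[OF V(1,2)] by blast
  qed (use p V in auto)
  also have "\<dots> = pd h (deriv_along (X p) (\<lambda>q. vec_of (Y q))) p + pd (pd h (vec_of (Y p))) (vec_of (X p)) p"
    by (rule tangent_pd[OF S smooth_map_inclusion[OF W] _ vector_field_open(2)[OF W X p] V(2,1,3)
        vector_field_open(5)[OF W Y p]]) (use p in simp)
  finally show ?thesis .
qed

lemma torsion_free_flat_conn:
  fixes W :: "'f::euclidean_space set"
  assumes W: "open W"
  shows "torsion_free (restrict_manifold euclid W) (flat_conn (\<lambda>y. y))"
  unfolding torsion_free_def
proof (intro ballI allI)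
  let ?S = "restrict_manifold euclid W"
  fix X Y p h assume X: "X \<in> vector_fields ?S" and Y: "Y \<in> vector_fields ?S" and "p \<in> points ?S"
  then have p: "p \<in> W" by simp
  show "flat_conn (\<lambda>y. y) p (X p) Y h - flat_conn (\<lambda>y. y) p (Y p) X h - lie_bracket ?S X Y p h = 0"
  proof (cases "smooth_fun_at euclid p h")
    case False
    then show ?thesis using W p by (simp add: flat_conn_def flat_vec_def lie_bracket_def smooth_fun_at_open)
  next
    case True
    then obtain V where V: "open V" "smooth_on h V" "p \<in> V" by (rule smooth_fun_at_euclidE)
    have "lie_bracket ?S X Y p h = X p (\<lambda>q. Y q h) - Y p (\<lambda>q. X q h)"
      using True W p by (simp add: lie_bracket_def smooth_fun_at_open)
    then show ?thesis
      using True vector_field_apply[OF W X Y p True] vector_field_apply[OF W Y X p True]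
        pd_commute[OF V, of "vec_of (Y p)" "vec_of (X p)"]
      by (simp add: flat_conn_def flat_vec_def)
  qed
qed

text \<open>On components the connection merely applies fields as derivations, so the curvature
  identity is the definition of the bracket applied to each component function of Z.\<close>

lemma curvature_free_flat_conn:
  fixes W :: "'f::euclidean_space set"
  assumes W: "open W"
  shows "curvature_free (restrict_manifold euclid W) (flat_conn (\<lambda>y. y))"
  unfolding curvature_free_def
proof (intro ballI allI)
  let ?S = "restrict_manifold euclid W" and ?D = "flat_conn (\<lambda>y::'f. y)"
  fix X Y Z p h assume X: "X \<in> vector_fields ?S" and Y: "Y \<in> vector_fields ?S" and Z: "Z \<in> vector_fields ?S"
    and "p \<in> points ?S"
  then have p: "p \<in> W" by simp
  let ?Z = "\<lambda>q. vec_of (Z q)"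
  have 1: "?D p (X p) (\<lambda>q. ?D q (Y q) Z) = flat_vec p (deriv_along (X p) (\<lambda>q. deriv_along (Y q) ?Z))" for X Y
    by (simp add: flat_conn_def vec_of_flat_vec)
  have "deriv_along (lie_bracket ?S X Y p) ?Z =
      deriv_along (X p) (\<lambda>q. deriv_along (Y q) ?Z) - deriv_along (Y p) (\<lambda>q. deriv_along (X q) ?Z)"
  proof (rule euclidean_eqI)
    fix b :: 'f assume b: "b \<in> Basis"
    show "deriv_along (lie_bracket ?S X Y p) ?Z \<bullet> b =
      (deriv_along (X p) (\<lambda>q. deriv_along (Y q) ?Z) - deriv_along (Y p) (\<lambda>q. deriv_along (X q) ?Z)) \<bullet> b"
      using vector_field_open(5)[OF W Z p b] by (simp add: deriv_along_inner b inner_diff_left lie_bracket_def)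
  qed
  then show "?D p (X p) (\<lambda>q. ?D q (Y q) Z) h - ?D p (Y p) (\<lambda>q. ?D q (X q) Z) h
      - ?D p (lie_bracket ?S X Y p) Z h = 0"
    unfolding 1
    using flat_vec_comb[of p 1 "deriv_along (X p) (\<lambda>q. deriv_along (Y q) ?Z)" "-1"
        "deriv_along (Y p) (\<lambda>q. deriv_along (X q) ?Z)"]
    by (simp add: flat_conn_def)
qed

section \<open>Hessian metrics\<close>

definition hess_metric :: "('f::euclidean_space \<Rightarrow> real) \<Rightarrow> 'f \<Rightarrow> 'f tvec \<Rightarrow> 'f tvec \<Rightarrow> real" where
  "hess_metric \<phi> p v w = pd (pd \<phi> (vec_of w)) (vec_of v) p"

lemma hess_linear_left:
  fixes \<phi> :: "'f::euclidean_space \<Rightarrow> real"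
  shows "smooth_on \<phi> W \<Longrightarrow> p \<in> W \<Longrightarrow> linear (\<lambda>v. pd (pd \<phi> w) v p)"
  by (intro smooth_on_linear_pd smooth_on_pd)

text \<open>Linearity in the inner direction is obtained from the outer one by exchanging the two
  derivatives.\<close>

lemma hess_linear_right:
  fixes \<phi> :: "'f::euclidean_space \<Rightarrow> real"
  assumes "smooth_on \<phi> W" "open W" "p \<in> W"
  shows "linear (\<lambda>w. pd (pd \<phi> w) v p)"
  using hess_linear_left[OF assms(1,3), of v] pd_commute[OF assms(2,1,3), of _ v] by simp

lemma riemannian_hess_metric:
  assumes W: "open W" and \<phi>: "smooth_on \<phi> W"
    and pos: "\<And>p w. p \<in> W \<Longrightarrow> w \<noteq> 0 \<Longrightarrow> pd (pd \<phi> w) w p > 0"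
  shows "riemannian_metric (restrict_manifold euclid W) (hess_metric \<phi>)"
  unfolding riemannian_metric_def two_tensor_def
proof (intro conjI ballI allI impI)
  let ?S = "restrict_manifold euclid W"
  note S = smooth_manifold_open[OF W]
  {
    fix p v w assume "p \<in> points ?S"
    then have p: "p \<in> W" by simp
    show "hess_metric \<phi> p v w = hess_metric \<phi> p w v"
      unfolding hess_metric_def by (rule pd_commute[OF W \<phi> p])
    show "hess_metric \<phi> p v v > 0" if "v \<in> tangent_space ?S p" "v \<noteq> (\<lambda>h. 0)"
    proof -
      have v: "flat_vec p (vec_of v) = v" using that(1) W p by (intro flat_vec_vec_of) (simp add: tangent_space_open)
      have "flat_vec p 0 = (\<lambda>h. 0)" using flat_vec_comb[of p 0 0 0 0] by simp
      then have "vec_of v \<noteq> 0" using that(2) v by metis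
      then show ?thesis using pos[OF p] by (simp add: hess_metric_def)
    qed
    fix u a b
    show "hess_metric \<phi> p (tvec_comb a v b w) u = a * hess_metric \<phi> p v u + b * hess_metric \<phi> p w u"
      unfolding hess_metric_def deriv_along_comb
      using linear_add[OF hess_linear_left[OF \<phi> p]] linear_scale[OF hess_linear_left[OF \<phi> p]] by simp
    show "hess_metric \<phi> p u (tvec_comb a v b w) = a * hess_metric \<phi> p u v + b * hess_metric \<phi> p u w"
      unfolding hess_metric_def deriv_along_comb
      using linear_add[OF hess_linear_right[OF \<phi> W p]] linear_scale[OF hess_linear_right[OF \<phi> W p]] by simp
  }
  fix N X Y assume XY: "smooth_vf ?S N X \<and> smooth_vf ?S N Y"
  have NW: "N \<subseteq> W" and N: "openin (mtop ?S) N" using smooth_vfD(1)[of ?S N X] XY openin_subset[of "mtop ?S" N] by auto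
  have c: "smooth_fun ?S N (\<lambda>q. vec_of (X q) \<bullet> b)" "smooth_fun ?S N (\<lambda>q. vec_of (Y q) \<bullet> b)" if "b \<in> Basis" for b
    using XY that unfolding smooth_vf_def by (auto intro!: section_components(1)[OF W])
  have h: "smooth_fun ?S N (\<lambda>q. pd (pd \<phi> b) c q)" for b c
    using N NW W smooth_on_subset[OF smooth_on_pd[OF smooth_on_pd[OF \<phi>]] NW] openin_restrict[of euclid W N]
    by (simp add: smooth_fun_open)
  \<comment> \<open>Second derivatives of \<phi> are known to be smooth in fixed directions, so the
    metric is expanded in the components of both fields.\<close>
  have "smooth_fun ?S N (\<lambda>q. \<Sum>b\<in>Basis. (vec_of (Y q) \<bullet> b) * (\<Sum>c\<in>Basis. (vec_of (X q) \<bullet> c) * pd (pd \<phi> b) c q))"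
    by (intro smooth_fun_sum[OF S N] smooth_fun_mult[OF S] c h)
  then show "smooth_fun ?S N (\<lambda>p. hess_metric \<phi> p (X p) (Y p))"
  proof (rule smooth_fun_cong[OF S])
    fix q assume "q \<in> N"
    then have q: "q \<in> W" using NW by blast
    show "(\<Sum>b\<in>Basis. (vec_of (Y q) \<bullet> b) * (\<Sum>c\<in>Basis. (vec_of (X q) \<bullet> c) * pd (pd \<phi> b) c q)) =
        hess_metric \<phi> q (X q) (Y q)"
      unfolding hess_metric_def hess_expand[OF \<phi> W q, of "vec_of (Y q)"]
        pd_expand[OF smooth_on_pd[OF \<phi>] q, of _ "vec_of (X q)"] by simp
  qed
qed

text \<open>By the product rule, differentiating the fields Y and Z contributes exactly the two
  connection terms of the covariant derivative; they cancel and the third derivative of \<phi>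
  remains.\<close>

lemma metric_derivative_hess:
  assumes W: "open W" and \<phi>: "smooth_on \<phi> W"
    and X: "X \<in> vector_fields (restrict_manifold euclid W)" and Y: "Y \<in> vector_fields (restrict_manifold euclid W)"
    and Z: "Z \<in> vector_fields (restrict_manifold euclid W)" and p: "p \<in> W"
  shows "metric_derivative (hess_metric \<phi>) (flat_conn (\<lambda>y. y)) X Y Z p =
    pd (pd (pd \<phi> (vec_of (Z p))) (vec_of (Y p))) (vec_of (X p)) p"
proof -
  let ?S = "restrict_manifold euclid W"
  let ?X = "\<lambda>q. vec_of (X q)" and ?Y = "\<lambda>q. vec_of (Y q)" and ?Z = "\<lambda>q. vec_of (Z q)"
  note S = smooth_manifold_open[OF W]
  have pS: "p \<in> points ?S" using p by simp
  note v = vector_field_open(2)[OF W X p]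
  note Zs = vector_field_open(5)[OF W Z p]
  have h: "smooth_fun ?S W (\<lambda>q. pd (pd \<phi> b) (?Y q) q)" for b
  proof -
    have "smooth_fun ?S W (\<lambda>q. \<Sum>c\<in>Basis. (?Y q \<bullet> c) * pd (pd \<phi> b) c q)"
      using smooth_on_pd[OF smooth_on_pd[OF \<phi>]] W openin_restrict[of euclid W W]
      by (intro smooth_fun_sum[OF S] smooth_fun_mult[OF S] vector_field_open(4)[OF W Y p]) (auto simp: smooth_fun_open)
    then show ?thesis
    proof (rule smooth_fun_cong[OF S])
      fix q assume "q \<in> W"
      from pd_expand[OF smooth_on_pd[OF \<phi>] this, of b "?Y q"]
      show "(\<Sum>c\<in>Basis. (?Y q \<bullet> c) * pd (pd \<phi> b) c q) = pd (pd \<phi> b) (?Y q) q" by simp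
    qed
  qed
  have h': "smooth_fun_at ?S p (\<lambda>q. pd (pd \<phi> b) (?Y q) q)" for b by (rule smooth_fun_atI[OF h p])
  have hX: "X p (\<lambda>q. pd (pd \<phi> b) (?Y q) q) =
      pd (pd \<phi> b) (deriv_along (X p) ?Y) p + pd (pd (pd \<phi> b) (?Y p)) (?X p) p" for b
    by (rule tangent_pd[OF S smooth_map_inclusion[OF W] pS v smooth_on_pd[OF \<phi>] W p vector_field_open(5)[OF W Y p]])
  have "X p (\<lambda>q. hess_metric \<phi> q (Y q) (Z q)) = X p (\<lambda>q. \<Sum>b\<in>Basis. (?Z q \<bullet> b) * pd (pd \<phi> b) (?Y q) q)"
  proof (rule tangent_local[OF S v _ p])
    show "openin (mtop ?S) W" using W openin_restrict[of euclid W W] by simp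
    fix q assume "q \<in> W"
    from hess_expand[OF \<phi> W this, of "?Z q"]
    show "hess_metric \<phi> q (Y q) (Z q) = (\<Sum>b\<in>Basis. (?Z q \<bullet> b) * pd (pd \<phi> b) (?Y q) q)"
      by (simp add: hess_metric_def)
  qed
  also have "\<dots> = (\<Sum>b\<in>Basis. X p (\<lambda>q. (?Z q \<bullet> b) * pd (pd \<phi> b) (?Y q) q))"
    by (intro tangent_sum[OF S pS v] smooth_fun_at_mult[OF S] Zs h')
  also have "\<dots> = (\<Sum>b\<in>Basis. (deriv_along (X p) ?Z \<bullet> b) * pd (pd \<phi> b) (?Y p) p +
      (?Z p \<bullet> b) * (pd (pd \<phi> b) (deriv_along (X p) ?Y) p + pd (pd (pd \<phi> b) (?Y p)) (?X p) p))"
  proof (rule sum.cong[OF refl])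
    fix b :: 'a assume b: "b \<in> Basis"
    show "X p (\<lambda>q. (?Z q \<bullet> b) * pd (pd \<phi> b) (?Y q) q) = (deriv_along (X p) ?Z \<bullet> b) * pd (pd \<phi> b) (?Y p) p +
      (?Z p \<bullet> b) * (pd (pd \<phi> b) (deriv_along (X p) ?Y) p + pd (pd (pd \<phi> b) (?Y p)) (?X p) p)"
      unfolding tangentD(3)[OF v Zs[OF b] h'] hX deriv_along_inner[OF b, of "X p"] ..
  qed
  also have "\<dots> = pd (pd \<phi> (deriv_along (X p) ?Z)) (?Y p) p + pd (pd \<phi> (?Z p)) (deriv_along (X p) ?Y) p
      + (\<Sum>b\<in>Basis. (?Z p \<bullet> b) * pd (pd (pd \<phi> b) (?Y p)) (?X p) p)"
    by (simp add: sum.distrib distrib_left hess_expand[OF \<phi> W p, of "deriv_along (X p) ?Z"]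
        hess_expand[OF \<phi> W p, of "?Z p"])
  also have "(\<Sum>b\<in>Basis. (?Z p \<bullet> b) * pd (pd (pd \<phi> b) (?Y p)) (?X p) p) = pd (pd (pd \<phi> (?Z p)) (?Y p)) (?X p) p"
  proof -
    have "((\<lambda>q. \<Sum>b\<in>Basis. (?Z p \<bullet> b) * pd (pd \<phi> b) (?Y p) q) has_derivative
        (\<lambda>u. \<Sum>b\<in>Basis. (?Z p \<bullet> b) * pd (pd (pd \<phi> b) (?Y p)) u p)) (at p)"
      by (intro has_derivative_sum has_derivative_mult_right smooth_on_has_derivative[OF smooth_on_pd[OF smooth_on_pd[OF \<phi>]] p])
    then have "(pd (pd \<phi> (?Z p)) (?Y p) has_derivative
        (\<lambda>u. \<Sum>b\<in>Basis. (?Z p \<bullet> b) * pd (pd (pd \<phi> b) (?Y p)) u p)) (at p)"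
      by (rule has_derivative_transform_within_open[OF _ W p]) (rule hess_expand[OF \<phi> W, symmetric])
    then show ?thesis by (simp add: frechet_derivative_at[symmetric])
  qed
  finally show ?thesis
    by (simp add: metric_derivative_def hess_metric_def flat_conn_def vec_of_flat_vec)
qed

theorem flat_statistical_hess:
  fixes W :: "'f::euclidean_space set"
  assumes W: "open W" and \<phi>: "smooth_on \<phi> W"
    and pos: "\<And>p w. p \<in> W \<Longrightarrow> w \<noteq> 0 \<Longrightarrow> pd (pd \<phi> w) w p > 0"
  shows "flat_statistical_manifold (restrict_manifold euclid W) (hess_metric \<phi>) (flat_conn (\<lambda>y. y))"
  unfolding flat_statistical_manifold_def statistical_manifold_def
proof (intro conjI ballI)
  let ?S = "restrict_manifold euclid W"
  show "smooth_manifold ?S" by (rule smooth_manifold_open[OF W])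
  show "riemannian_metric ?S (hess_metric \<phi>)" by (rule riemannian_hess_metric[OF assms])
  show "affine_connection ?S (flat_conn (\<lambda>y. y))"
    unfolding affine_connection_def
    by (rule connection_along_flat_conn[OF smooth_manifold_open[OF W] W smooth_map_inclusion[OF W]]) simp
  show "torsion_free ?S (flat_conn (\<lambda>y. y))" by (rule torsion_free_flat_conn[OF W])
  show "curvature_free ?S (flat_conn (\<lambda>y. y))" by (rule curvature_free_flat_conn[OF W])
  fix X Y Z p assume X: "X \<in> vector_fields ?S" and Y: "Y \<in> vector_fields ?S" and Z: "Z \<in> vector_fields ?S"
    and "p \<in> points ?S"
  then have p: "p \<in> W" by simp
  note m = metric_derivative_hess[OF W \<phi> _ _ _ p]
  show "metric_derivative (hess_metric \<phi>) (flat_conn (\<lambda>y. y)) X Y Z p =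
      metric_derivative (hess_metric \<phi>) (flat_conn (\<lambda>y. y)) Y X Z p"
    unfolding m[OF X Y Z] m[OF Y X Z] by (rule pd_commute[OF W smooth_on_pd[OF \<phi>] p])
  \<comment> \<open>The symmetry in the inner two directions is an identity on all of W, so it may
    be differentiated at p.\<close>
  have "pd (pd (pd \<phi> z) y) x p = pd (pd (pd \<phi> y) z) x p" for x y z
  proof -
    have "pd (pd \<phi> z) y differentiable (at p)"
      using smooth_on_has_derivative[OF smooth_on_pd[OF smooth_on_pd[OF \<phi>]] p] by (rule differentiableI)
    from frechet_derivative_transform_within_open[OF this W p pd_commute[OF W \<phi>]]
    show ?thesis by simp
  qed
  then show "metric_derivative (hess_metric \<phi>) (flat_conn (\<lambda>y. y)) X Y Z p =
      metric_derivative (hess_metric \<phi>) (flat_conn (\<lambda>y. y)) X Z Y p"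
    unfolding m[OF X Y Z] m[OF X Z Y] .
qed

section \<open>The potential of an affine embedding\<close>

text \<open>Bridges fields on small open sets and the structure equations, which concern fields on
  all of M. Since f is an embedding, N is the preimage of an ambient open set C, and a Euclidean
  bump function composed with f cuts the field off inside N.\<close>

lemma extend_vector_field:
  fixes f :: "'a \<Rightarrow> 'f::euclidean_space"
  assumes M: "smooth_manifold M" and f: "embedding M euclid f" and X: "smooth_vf M N X" and p: "p \<in> N"
  obtains Y N' where "Y \<in> vector_fields M" "openin (mtop M) N'" "p \<in> N'" "N' \<subseteq> N" "\<forall>q\<in>N'. Y q = X q"
proof -
  note N = smooth_vfD(1)[OF X]
  have NM: "N \<subseteq> points M" using N by (rule openin_subset)
  have emb: "embedding_map (mtop M) euclidean f" and sm: "smooth_map M euclid f"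
    using f by (auto simp: embedding_def euclid_def)
  have hom: "homeomorphic_map (mtop M) (top_of_set (f ` points M)) f"
    using emb by (simp add: embedding_map_def)
  then have "openin (top_of_set (f ` points M)) (f ` N)"
    using N homeomorphic_imp_open_map unfolding open_map_def by blast
  then obtain C where C: "open C" "f ` N = f ` points M \<inter> C" by (auto simp: openin_open)
  have inj: "inj_on f (points M)" using hom by (rule homeomorphic_imp_injective_map)
  have CN: "q \<in> N" if "q \<in> points M" "f q \<in> C" for q
  proof -
    have "f q \<in> f ` N" using C that by blast
    then show ?thesis using inj NM that(1) by (auto simp: inj_on_def)
  qed
  have "f p \<in> C" using C p by blast
  then obtain r where r: "r > 0" "ball (f p) r \<subseteq> C" using C openE by blast
  \<comment> \<open>Radius r/2 leaves room inside the ball of radius r. A point outside N is mapped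
    outside that ball, hence has a neighbourhood mapped outside the closed ball of radius r/2, where
    the cut-off field is zero.\<close>
  obtain \<beta> :: "'f \<Rightarrow> real" where \<beta>: "smooth_on \<beta> UNIV"
    "\<And>y. y \<in> ball (f p) (r / 2 / 2) \<Longrightarrow> \<beta> y = 1" "\<And>y. y \<notin> ball (f p) (r / 2) \<Longrightarrow> \<beta> y = 0"
    using smooth_bump[of "r / 2" "f p"] r by auto
  define Y where "Y q = (if q \<in> N then (\<lambda>h. \<beta> (f q) * X q h) else (\<lambda>h. 0))" for q
  have pre: "openin (mtop M) {x \<in> points M. f x \<in> B}" if "open B" for B
    using openin_continuous_map_preimage[of "mtop M" euclidean f B] sm that
    by (simp add: smooth_map_def euclid_def)
  have \<beta>f: "smooth_fun M (points M) (\<lambda>q. \<beta> (f q))"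
    by (rule smooth_fun_compose[OF M openin_topspace smooth_map_euclid_components[OF M sm] \<beta>(1) open_UNIV]) auto
  have "smooth_vf M (points M) Y"
  proof (rule smooth_vfI[OF openin_topspace])
    fix q assume "q \<in> points M"
    show "Y q \<in> tangent_space M q"
    proof (cases "q \<in> N")
      case True
      have "tvec_comb (\<beta> (f q)) (X q) 0 (X q) \<in> tangent_space M q"
        by (intro tangent_comb smooth_vfD(2)[OF X True])
      then show ?thesis using True by (simp add: Y_def)
    next
      case False
      have "(\<lambda>h. 0) \<in> tangent_space M q" by (rule tangentI) auto
      then show ?thesis using False by (simp add: Y_def)
    qed
  next
    fix V h assume h: "smooth_fun M V h"
    note V = smooth_funD(1)[OF h]
    show "smooth_fun M (points M \<inter> V) (\<lambda>q. Y q h)"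
    proof (rule smooth_fun_local[OF M])
      show "openin (mtop M) (points M \<inter> V)" using V by blast
      fix q assume q: "q \<in> points M \<inter> V"
      show "\<exists>W. q \<in> W \<and> smooth_fun M W (\<lambda>q. Y q h)"
      proof (cases "q \<in> N")
        case True
        have o: "openin (mtop M) (N \<inter> V)" using N V by blast
        have "smooth_fun M (N \<inter> V) (\<lambda>q. \<beta> (f q) * X q h)"
          by (intro smooth_fun_mult M smooth_fun_subset[OF \<beta>f o] smooth_vfD(3)[OF X h]) (use NM in blast)
        then have "smooth_fun M (N \<inter> V) (\<lambda>q. Y q h)"
          by (rule smooth_fun_cong[OF M]) (simp add: Y_def)
        then show ?thesis using True q by blast
      next
        case False
        let ?B = "{x \<in> points M. f x \<in> - cball (f p) (r / 2)}"
        have o: "openin (mtop M) ?B" by (rule pre) (simp add: open_Compl)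
        have "f q \<notin> ball (f p) r" using CN[of q] False q r by blast
        then have "q \<in> ?B" using q r by (auto simp: not_less)
        moreover have "smooth_fun M ?B (\<lambda>q. Y q h)"
        proof (rule smooth_fun_cong[OF M smooth_fun_const[OF M o, of 0]])
          fix x assume "x \<in> ?B"
          then have "\<beta> (f x) = 0" by (intro \<beta>(3)) simp
          then show "0 = Y x h" by (simp add: Y_def)
        qed
        ultimately show ?thesis by (intro exI[of _ ?B] conjI)
      qed
    qed
  qed
  then have 1: "Y \<in> vector_fields M" by (simp add: vector_fields_def)
  let ?N = "N \<inter> {x \<in> points M. f x \<in> ball (f p) (r / 2 / 2)}"
  show ?thesis
  proof (rule that[OF 1])
    show "openin (mtop M) ?N" using N pre[of "ball (f p) (r / 2 / 2)"] by blast
    show "p \<in> ?N" using p NM r by auto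
    show "\<forall>q\<in>?N. Y q = X q" using \<beta>(2) by (simp add: Y_def)
  qed blast
qed

lemma extend_tangent_vector:
  fixes f :: "'a \<Rightarrow> 'f::euclidean_space"
  assumes M: "smooth_manifold M" and f: "embedding M euclid f" and p: "p \<in> points M"
    and v: "v \<in> tangent_space M p"
  obtains X where "X \<in> vector_fields M" "X p = v"
proof -
  obtain N X where X: "p \<in> N" "smooth_vf M N X" "X p = v" using tangent_extends_locally[OF M p v] .
  obtain Y N' where "Y \<in> vector_fields M" "openin (mtop M) N'" "p \<in> N'" "N' \<subseteq> N"
    "\<forall>q\<in>N'. Y q = X q"
    using extend_vector_field[OF M f X(2,1)] .
  then show ?thesis using X(3) by (intro that[of Y]) auto
qed

text \<open>The first derivative is identified for all small s and not just at s = 0, so that it can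
  be differentiated a second time.\<close>

lemma second_order_along_line:
  fixes \<phi> :: "'f::euclidean_space \<Rightarrow> real"
  assumes \<phi>: "smooth_on \<phi> W" and d: "\<delta> > 0"
    and line: "\<And>s. \<bar>s\<bar> < \<delta> \<Longrightarrow> y + s *\<^sub>R w \<in> W"
      "\<And>s. \<bar>s\<bar> < \<delta> \<Longrightarrow> \<phi> (y + s *\<^sub>R w) = s * \<alpha> + s\<^sup>2 * \<beta> / 2"
  shows "pd \<phi> w y = \<alpha>" "pd (pd \<phi> w) w y = \<beta>"
proof -
  have e: "pd \<phi> w (y + s *\<^sub>R w) = \<alpha> + s * \<beta>" if s: "\<bar>s\<bar> < \<delta>" for s
  proof -
    have "((\<lambda>s. \<phi> (y + s *\<^sub>R w)) has_real_derivative pd \<phi> w (y + s *\<^sub>R w)) (at s)"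
      using smooth_on_line_deriv[OF \<phi> line(1)[OF s]] by (simp add: has_real_derivative_iff_has_vector_derivative)
    then have "((\<lambda>s. s * \<alpha> + s\<^sup>2 * \<beta> / 2) has_real_derivative pd \<phi> w (y + s *\<^sub>R w)) (at s)"
      by (rule has_field_derivative_transform_within_open[of _ _ _ "{-\<delta><..<\<delta>}"])
         (use s line(2) in \<open>auto simp: abs_less_iff\<close>)
    moreover have "((\<lambda>s. s * \<alpha> + s\<^sup>2 * \<beta> / 2) has_real_derivative (\<alpha> + s * \<beta>)) (at s)"
      by (auto intro!: derivative_eq_intros)
    ultimately show ?thesis by (rule DERIV_unique)
  qed
  show "pd \<phi> w y = \<alpha>" using e[of 0] d by simp
  have "((\<lambda>s. pd \<phi> w (y + s *\<^sub>R w)) has_real_derivative pd (pd \<phi> w) w (y + 0 *\<^sub>R w)) (at 0)"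
    using smooth_on_line_deriv[OF smooth_on_pd[OF \<phi>] line(1)[of 0]] d
    by (simp add: has_real_derivative_iff_has_vector_derivative)
  then have "((\<lambda>s. \<alpha> + s * \<beta>) has_real_derivative pd (pd \<phi> w) w (y + 0 *\<^sub>R w)) (at 0)"
    by (rule has_field_derivative_transform_within_open[of _ _ _ "{-\<delta><..<\<delta>}"])
       (use d e in \<open>auto simp: abs_less_iff\<close>)
  moreover have "((\<lambda>s. \<alpha> + s * \<beta>) has_real_derivative \<beta>) (at 0)"
    by (auto intro!: derivative_eq_intros)
  ultimately show "pd (pd \<phi> w) w y = \<beta>" using DERIV_unique by fastforce
qed

text \<open>The quadratic form at y has a positive minimum m on the unit sphere. At z the form
  differs from it on the sphere by at most \<open>D z\<close>, the sum of the changes of its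
  coefficients. Homogeneity extends positivity from the sphere to all nonzero vectors.\<close>

lemma positive_definite_open:
  fixes \<phi> :: "'f::euclidean_space \<Rightarrow> real"
  assumes W: "open W" and \<phi>: "smooth_on \<phi> W" and y: "y \<in> W"
    and pos: "\<And>w. w \<noteq> 0 \<Longrightarrow> pd (pd \<phi> w) w y > 0"
  obtains W' where "open W'" "y \<in> W'" "W' \<subseteq> W" "\<forall>z\<in>W'. \<forall>w. w \<noteq> 0 \<longrightarrow> pd (pd \<phi> w) w z > 0"
proof -
  let ?h = "\<lambda>b c z. pd (pd \<phi> b) c z"
  define Q where "Q z w = (\<Sum>b\<in>Basis. (w \<bullet> b) * (\<Sum>c\<in>Basis. (w \<bullet> c) * ?h b c z))" for z w
  have Q: "pd (pd \<phi> w) w z = Q z w" if "z \<in> W" for z w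
    unfolding Q_def hess_expand[OF \<phi> W that, of w] pd_expand[OF smooth_on_pd[OF \<phi>] that, of _ w] by simp
  have Qscale: "Q z (a *\<^sub>R w) = a\<^sup>2 * Q z w" for z a w
    by (simp add: Q_def sum_distrib_left power2_eq_square mult_ac)
  have "continuous_on (sphere 0 1) (Q y)"
    unfolding Q_def by (intro continuous_intros)
  moreover have "sphere (0::'f) 1 \<noteq> {}" by simp
  ultimately obtain u where u: "u \<in> sphere 0 1" "\<And>w. w \<in> sphere 0 1 \<Longrightarrow> Q y u \<le> Q y w"
    using continuous_attains_inf[OF compact_sphere] by metis
  define m where "m = Q y u"
  have "u \<noteq> 0" using u(1) by auto
  then have m: "m > 0" using pos[of u] Q[OF y] by (simp add: m_def)
  define D where "D z = (\<Sum>b\<in>Basis. \<Sum>c\<in>Basis. \<bar>?h b c z - ?h b c y\<bar>)" for z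
  have ch: "continuous_on W (?h b c)" for b c
    by (intro smooth_on_continuous smooth_on_pd \<phi>)
  have "continuous_on W D" unfolding D_def by (intro continuous_intros ch)
  then have o: "open (W \<inter> D -` {..<m})" by (rule continuous_open_preimage[OF _ W open_lessThan])
  have near: "\<bar>Q z w - Q y w\<bar> \<le> D z" if "norm w = 1" for z w
  proof -
    have a: "\<bar>w \<bullet> b\<bar> \<le> 1" if "b \<in> Basis" for b using Basis_le_norm[OF that, of w] \<open>norm w = 1\<close> by simp
    have "Q z w - Q y w = (\<Sum>b\<in>Basis. \<Sum>c\<in>Basis. (w \<bullet> b) * (w \<bullet> c) * (?h b c z - ?h b c y))"
      by (simp add: Q_def sum_distrib_left sum_subtractf[symmetric] algebra_simps)
    also have "\<bar>\<dots>\<bar> \<le> D z"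
      unfolding D_def
    proof (intro order_trans[OF sum_abs] sum_mono)
      fix b c :: 'f assume b: "b \<in> Basis" and c: "c \<in> Basis"
      have "\<bar>w \<bullet> b\<bar> * \<bar>w \<bullet> c\<bar> \<le> 1 * 1" by (intro mult_mono a b c) auto
      then have "\<bar>w \<bullet> b\<bar> * \<bar>w \<bullet> c\<bar> * \<bar>?h b c z - ?h b c y\<bar> \<le> 1 * \<bar>?h b c z - ?h b c y\<bar>"
        by (intro mult_right_mono) auto
      then show "\<bar>(w \<bullet> b) * (w \<bullet> c) * (?h b c z - ?h b c y)\<bar> \<le> \<bar>?h b c z - ?h b c y\<bar>"
        by (simp add: abs_mult)
    qed
    finally show ?thesis .
  qed
  show ?thesis
  proof (rule that[OF o])
    show "y \<in> W \<inter> D -` {..<m}" using y m by (simp add: D_def)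
    show "\<forall>z\<in>W \<inter> D -` {..<m}. \<forall>w. w \<noteq> 0 \<longrightarrow> pd (pd \<phi> w) w z > 0"
    proof (intro ballI allI impI)
      fix z w :: 'f assume z: "z \<in> W \<inter> D -` {..<m}" and w: "w \<noteq> 0"
      define v where "v = w /\<^sub>R norm w"
      have v: "norm v = 1" using w by (simp add: v_def)
      have "m \<le> Q y v" using u(2)[of v] v by (simp add: m_def)
      then have "Q z v > 0" using near[OF v, of z] z by auto
      moreover have "w = norm w *\<^sub>R v" using w by (simp add: v_def)
      ultimately have "Q z w > 0" using Qscale[of z "norm w" v] w by (metis mult_pos_pos zero_less_norm_iff zero_less_power)
      then show "pd (pd \<phi> w) w z > 0" using Q z by simp
    qed
  qed auto
qed

text \<open>The coefficient space has one basis vector for each transverse field: it is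
  \<open>real\<close> in codimension 1 and \<open>real \<times> real\<close> in codimension 2, so
  that both cases share the construction of the potential.\<close>

definition normal :: "('n::euclidean_space \<Rightarrow> 'a \<Rightarrow> 'f::euclidean_space) \<Rightarrow> 'a \<Rightarrow> 'n \<Rightarrow> 'f" where
  "normal \<nu> q a = (\<Sum>b\<in>Basis. (a \<bullet> b) *\<^sub>R \<nu> b q)"

lemma normal_linear: "linear (normal \<nu> q)"
  by (rule linearI) (simp_all add: normal_def inner_add_left scaleR_left_distrib sum.distrib scaleR_sum_right)

lemma normal_Basis: "b \<in> Basis \<Longrightarrow> normal \<nu> q b = \<nu> b q"
  by (simp add: normal_def inner_Basis if_distrib[of "\<lambda>r. r *\<^sub>R _"] cong: if_cong)

text \<open>In the coordinates (y, t) the potential is t \<bullet> e + (t \<bullet> t) / 2. The line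
  through f q with direction \<open>normal \<nu> q a\<close> has coordinates (c q, s a), so there
  the potential is an explicit quadratic polynomial in s, and the inverse map is never
  computed.\<close>

lemma potential_exists:
  fixes M :: "('a, 'e::euclidean_space) manifold" and f :: "'a \<Rightarrow> 'f::euclidean_space"
    and \<nu> :: "'n::euclidean_space \<Rightarrow> 'a \<Rightarrow> 'f"
  assumes M: "smooth_manifold M" and f: "smooth_map M euclid f"
    and \<nu>: "\<And>b. b \<in> Basis \<Longrightarrow> smooth_map M euclid (\<nu> b)"
    and dim: "DIM('f) = DIM('e) + DIM('n)" and x: "x \<in> points M"
    and span: "\<And>w. \<exists>v\<in>tangent_space M x. \<exists>a. w = deriv_along v f + normal \<nu> x a"
  obtains W \<phi> U where "open W" "smooth_on \<phi> W" "openin (mtop M) U" "x \<in> U" "f ` U \<subseteq> W"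
    "\<forall>q\<in>U. \<phi> (f q) = 0"
    "\<forall>q\<in>U. \<forall>a. pd \<phi> (normal \<nu> q a) (f q) = a \<bullet> e"
    "\<forall>q\<in>U. \<forall>a. pd (pd \<phi> (normal \<nu> q a)) (normal \<nu> q a) (f q) = a \<bullet> a"
proof -
  obtain V c where c: "(V, c) \<in> atlas M" "x \<in> V" using chart_at[OF M x] .
  define A where "A = c ` V"
  define i where "i = inv_into V c"
  have A: "open A" using chart_props(4)[OF M c(1)] by (simp add: A_def)
  have VM: "V \<inter> points M = V" using chart_props(2)[OF M c(1)] by blast
  have ic: "i (c q) = q" if "q \<in> V" for q using inv_chart[OF M c(1) that] by (simp add: i_def)
  have smi: "smooth_on (\<lambda>y. F (i y)) A" if "smooth_map M euclid F" for F :: "'a \<Rightarrow> 'f"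
  proof (rule smooth_on_componentwise[OF A])
    fix b :: 'f
    show "smooth_on (\<lambda>y. F (i y) \<bullet> b) A"
      using smooth_funD(2)[OF smooth_map_euclid_components[OF M that, of b] c(1)]
      unfolding VM A_def i_def .
  qed
  define \<Phi> where "\<Phi> z = f (i (fst z)) + (\<Sum>b\<in>Basis. (snd z \<bullet> b) *\<^sub>R \<nu> b (i (fst z)))" for z
  have oA: "open (A \<times> (UNIV :: 'n set))" using A by (simp add: open_Times)
  have fs: "smooth_on (fst :: 'e \<times> 'n \<Rightarrow> 'e) (A \<times> UNIV)" and sn: "smooth_on (snd :: 'e \<times> 'n \<Rightarrow> 'n) (A \<times> UNIV)"
    by (intro smooth_on_linear oA bounded_linear_fst bounded_linear_snd)+
  have lift: "smooth_on (\<lambda>z. G (fst z)) (A \<times> (UNIV :: 'n set))" if "smooth_on G A" for G :: "'e \<Rightarrow> 'f"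
    by (rule smooth_on_compose[OF oA A _ fs that]) auto
  have \<Phi>: "smooth_on \<Phi> (A \<times> UNIV)"
    unfolding \<Phi>_def
  proof (intro smooth_on_add oA smooth_on_sum smooth_on_scaleR)
    show "smooth_on (\<lambda>z. f (i (fst z))) (A \<times> (UNIV :: 'n set))" by (rule lift[OF smi[OF f]])
    fix b :: 'n assume b: "b \<in> Basis"
    show "smooth_on (\<lambda>z. snd z \<bullet> b) (A \<times> (UNIV :: 'n set))"
      by (rule smooth_on_inner[OF oA sn smooth_on_const[OF oA]])
    show "smooth_on (\<lambda>z. \<nu> b (i (fst z))) (A \<times> (UNIV :: 'n set))" by (rule lift[OF smi[OF \<nu>[OF b]]])
  qed
  have x0: "(c x, 0) \<in> A \<times> UNIV" using c by (simp add: A_def)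
  have cx: "c x \<in> A" using c by (simp add: A_def)
  have deriv: "(\<Phi> has_derivative (\<lambda>u. pd (\<lambda>y. f (i y)) (fst u) (c x) + normal \<nu> x (snd u))) (at (c x, 0))"
  proof -
    have fst': "((\<lambda>z. G (fst z)) has_derivative (\<lambda>u. pd G (fst u) (c x))) (at (c x, 0 :: 'n))"
      if "smooth_on G A" for G :: "'e \<Rightarrow> 'f"
      using has_derivative_compose[OF has_derivative_fst[OF has_derivative_ident], of G _ "(c x, 0 :: 'n)" UNIV]
        smooth_on_has_derivative[OF that cx] by simp
    \<comment> \<open>At second coordinate 0 the derivatives of the frame fields are multiplied by
      0. What is left is the derivative of f plus the normal part, and this is onto by
      \<open>span\<close>.\<close>
    have "(\<Phi> has_derivative (\<lambda>u. pd (\<lambda>y. f (i y)) (fst u) (c x) +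
        (\<Sum>b\<in>Basis. (snd (c x, 0 :: 'n) \<bullet> b) *\<^sub>R pd (\<lambda>y. \<nu> b (i y)) (fst u) (c x) +
          (snd u \<bullet> b) *\<^sub>R \<nu> b (i (fst (c x, 0 :: 'n)))))) (at (c x, 0))"
      unfolding \<Phi>_def
      by (intro has_derivative_add has_derivative_sum has_derivative_scaleR fst' smi f \<nu>
          has_derivative_inner_left has_derivative_snd has_derivative_ident)
    then show ?thesis by (simp add: normal_def ic[OF c(2)])
  qed
  have surj: "surj (\<lambda>u. pd \<Phi> u (c x, 0))"
    unfolding surj_def
  proof
    fix w
    obtain v a where va: "v \<in> tangent_space M x" "w = deriv_along v f + normal \<nu> x a" using span[of w] by blast
    have "deriv_along v f = pd (\<lambda>y. f (i y)) (deriv_along v c) (c x)"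
    proof (rule euclidean_eqI)
      fix b :: 'f assume b: "b \<in> Basis"
      have "smooth_fun_at M x (\<lambda>q. f q \<bullet> b)"
        by (rule smooth_fun_atI[OF smooth_map_euclid_components[OF M f] x])
      from tangent_chart[OF M c va(1) this]
      have "v (\<lambda>q. f q \<bullet> b) = pd (\<lambda>y. f (i y) \<bullet> b) (deriv_along v c) (c x)" by (simp add: i_def)
      also have "\<dots> = pd (\<lambda>y. f (i y)) (deriv_along v c) (c x) \<bullet> b"
        using frechet_derivative_at[OF has_derivative_inner_left[OF smooth_on_has_derivative[OF smi[OF f] cx], of b]]
        by metis
      finally show "deriv_along v f \<bullet> b = pd (\<lambda>y. f (i y)) (deriv_along v c) (c x) \<bullet> b"
        by (simp add: deriv_along_inner[OF b])
    qed
    then have "pd \<Phi> (deriv_along v c, a) (c x, 0) = w"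
      using frechet_derivative_at[OF deriv, symmetric] va(2) by simp
    then show "\<exists>u. w = pd \<Phi> u (c x, 0)" by (intro exI) (rule sym)
  qed
  obtain \<Omega> W \<Psi> where \<Omega>: "open \<Omega>" "\<Omega> \<subseteq> A \<times> UNIV" "(c x, 0) \<in> \<Omega>" "open W" "homeomorphism \<Omega> W \<Phi> \<Psi>"
    and \<Psi>: "smooth_on \<Psi> W"
    using smooth_inverse_function[OF oA \<Phi> x0 surj] dim by auto
  define \<phi> where "\<phi> z = snd (\<Psi> z) \<bullet> e + (1/2) * (snd (\<Psi> z) \<bullet> snd (\<Psi> z))" for z
  have \<phi>: "smooth_on \<phi> W"
    unfolding \<phi>_def
    by (intro smooth_on_add smooth_on_mult smooth_on_inner smooth_on_const \<Omega>(4)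
        smooth_on_bounded_linear[OF \<Omega>(4) bounded_linear_snd \<Psi>])
  \<comment> \<open>The points of the chart domain whose zero-section point (c q, 0) lies in
    \<Omega>; since \<Omega> is open, it then contains a short segment in each fibre direction as
    well.\<close>
  define U where "U = {q \<in> V. c q \<in> (\<lambda>y. (y, 0)) -` \<Omega>}"
  have "open ((\<lambda>y. (y, 0 :: 'n)) -` \<Omega>)"
    using \<Omega>(1) by (intro open_vimage) (auto intro: continuous_on_Pair continuous_on_id continuous_on_const)
  then have U: "openin (mtop M) U" unfolding U_def by (rule chart_preimage_open[OF M c(1)])
  have \<Phi>c: "\<Phi> (c q, t) = f q + normal \<nu> q t" if "q \<in> V" for q t
    by (simp add: \<Phi>_def normal_def ic[OF that])
  have val: "f q + normal \<nu> q t \<in> W" "\<phi> (f q + normal \<nu> q t) = t \<bullet> e + (t \<bullet> t) / 2"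
    if "q \<in> V" "(c q, t) \<in> \<Omega>" for q t
    using \<Omega>(5) that(2) unfolding homeomorphism_def \<phi>_def \<Phi>c[OF that(1), symmetric] by auto
  have line: "\<exists>\<delta>>0. \<forall>s. \<bar>s\<bar> < \<delta> \<longrightarrow> f q + s *\<^sub>R normal \<nu> q a \<in> W \<and>
      \<phi> (f q + s *\<^sub>R normal \<nu> q a) = s * (a \<bullet> e) + s\<^sup>2 * (a \<bullet> a) / 2" if "q \<in> U" for q a
  proof -
    have q: "q \<in> V" "(c q, 0) \<in> \<Omega>" using that by (auto simp: U_def)
    have "open ((\<lambda>s::real. (c q, s *\<^sub>R a)) -` \<Omega>)"
      using \<Omega>(1) by (intro open_vimage) (auto intro!: continuous_on_Pair continuous_on_const continuous_on_scaleR continuous_on_id)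
    moreover have "0 \<in> (\<lambda>s::real. (c q, s *\<^sub>R a)) -` \<Omega>" using q by simp
    ultimately obtain \<delta> where d: "\<delta> > 0" "ball 0 \<delta> \<subseteq> (\<lambda>s::real. (c q, s *\<^sub>R a)) -` \<Omega>" using openE by blast
    have "f q + s *\<^sub>R normal \<nu> q a \<in> W \<and>
      \<phi> (f q + s *\<^sub>R normal \<nu> q a) = s * (a \<bullet> e) + s\<^sup>2 * (a \<bullet> a) / 2" if "\<bar>s\<bar> < \<delta>" for s
    proof -
      have "(c q, s *\<^sub>R a) \<in> \<Omega>" using d that by auto
      from val[OF q(1) this] show ?thesis
        by (simp add: linear_scale[OF normal_linear] power2_eq_square mult.assoc)
    qed
    then show ?thesis using d by blast
  qed
  show ?thesis
  proof (rule that[OF \<Omega>(4) \<phi> U])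
    show "x \<in> U" using c \<Omega>(3) by (simp add: U_def)
    have zero: "f q \<in> W \<and> \<phi> (f q) = 0" if "q \<in> U" for q
      using val[of q 0] that linear_0[OF normal_linear, of \<nu> q] by (simp add: U_def)
    then show "f ` U \<subseteq> W" "\<forall>q\<in>U. \<phi> (f q) = 0" by auto
    have "pd \<phi> (normal \<nu> q a) (f q) = a \<bullet> e" "pd (pd \<phi> (normal \<nu> q a)) (normal \<nu> q a) (f q) = a \<bullet> a"
      if q: "q \<in> U" for q a
    proof -
      obtain \<delta> where "\<delta> > 0" and d: "\<forall>s. \<bar>s\<bar> < \<delta> \<longrightarrow> f q + s *\<^sub>R normal \<nu> q a \<in> W \<and>
          \<phi> (f q + s *\<^sub>R normal \<nu> q a) = s * (a \<bullet> e) + s\<^sup>2 * (a \<bullet> a) / 2"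
        using line[OF q, of a] by (elim exE conjE)
      from second_order_along_line[OF \<phi> this(1) d[rule_format, THEN conjunct1] d[rule_format, THEN conjunct2]]
      show "pd \<phi> (normal \<nu> q a) (f q) = a \<bullet> e" "pd (pd \<phi> (normal \<nu> q a)) (normal \<nu> q a) (f q) = a \<bullet> a" by blast+
    qed
    then show "\<forall>q\<in>U. \<forall>a. pd \<phi> (normal \<nu> q a) (f q) = a \<bullet> e"
      "\<forall>q\<in>U. \<forall>a. pd (pd \<phi> (normal \<nu> q a)) (normal \<nu> q a) (f q) = a \<bullet> a" by simp_all
  qed
qed

section \<open>Statistical embeddings from affine embeddings\<close>

text \<open>A common form of both codimensions. The basis vector \<open>e\<close> reads the
  \<xi>-component: \<open>gauss\<close> fixes it in the second derivatives by g, and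
  \<open>weingarten\<close> says that derivatives of frame fields have none, which is \<tau> = 0 for
  \<xi> and tangency of the derivative for the position vector. Tangency and locality of
  \<open>nab\<close> are separate hypotheses because in the application it is the connection of a
  larger manifold.\<close>

lemma affine_embedding_flat:
  fixes M :: "('a, 'e::euclidean_space) manifold" and f :: "'a \<Rightarrow> 'f::euclidean_space"
    and \<nu> :: "'n::euclidean_space \<Rightarrow> 'a \<Rightarrow> 'f"
  assumes M: "smooth_manifold M" and emb: "embedding M euclid f"
    and \<nu>: "\<And>b. b \<in> Basis \<Longrightarrow> smooth_map M euclid (\<nu> b)"
    and e: "e \<in> Basis" and dim: "DIM('f) = DIM('e) + DIM('n)"
    and span: "\<And>p w. p \<in> points M \<Longrightarrow> \<exists>v\<in>tangent_space M p. \<exists>a. w = deriv_along v f + normal \<nu> p a"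
    and gauss: "\<And>X Y p. X \<in> vector_fields M \<Longrightarrow> Y \<in> vector_fields M \<Longrightarrow> p \<in> points M \<Longrightarrow>
      \<exists>k. k \<bullet> e = g p (X p) (Y p) \<and>
        deriv_along (X p) (\<lambda>q. deriv_along (Y q) f) = deriv_along (nab p (X p) Y) f - normal \<nu> p k"
    and weingarten: "\<And>X p b. X \<in> vector_fields M \<Longrightarrow> p \<in> points M \<Longrightarrow> b \<in> Basis \<Longrightarrow>
      \<exists>u\<in>tangent_space M p. \<exists>m. m \<bullet> e = 0 \<and> deriv_along (X p) (\<nu> b) = deriv_along u f + normal \<nu> p m"
    and g_pos: "\<And>p v. p \<in> points M \<Longrightarrow> v \<in> tangent_space M p \<Longrightarrow> v \<noteq> (\<lambda>h. 0) \<Longrightarrow> g p v v > 0"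
    and nab_tangent: "\<And>p v N Y. p \<in> N \<Longrightarrow> v \<in> tangent_space M p \<Longrightarrow> smooth_vf M N Y \<Longrightarrow>
      nab p v Y \<in> tangent_space M p"
    and nab_local: "\<And>p v N N' Y Y'. p \<in> N' \<Longrightarrow> v \<in> tangent_space M p \<Longrightarrow> smooth_vf M N Y \<Longrightarrow>
      openin (mtop M) N' \<Longrightarrow> N' \<subseteq> N \<Longrightarrow> \<forall>q\<in>N'. Y' q = Y q \<Longrightarrow> nab p v Y' = nab p v Y"
    and x: "x \<in> points M"
  obtains U and S :: "('f, 'f) manifold" and G D where "openin (mtop M) U" "x \<in> U"
    "flat_statistical_manifold S G D" "statistical_embedding (restrict_manifold M U) g nab S G D f"
proof -
  have fsm: "smooth_map M euclid f" using emb by (simp add: embedding_def)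
  obtain W \<phi> U where W: "open W" and \<phi>: "smooth_on \<phi> W" and U: "openin (mtop M) U" "x \<in> U" "f ` U \<subseteq> W"
    and pot: "\<forall>q\<in>U. \<phi> (f q) = 0" "\<forall>q\<in>U. \<forall>a. pd \<phi> (normal \<nu> q a) (f q) = a \<bullet> e"
      "\<forall>q\<in>U. \<forall>a. pd (pd \<phi> (normal \<nu> q a)) (normal \<nu> q a) (f q) = a \<bullet> a"
  proof (rule potential_exists[OF M fsm _ dim x span[OF x], of e])
    show "smooth_map M euclid (\<nu> b)" if "b \<in> Basis" for b by (rule \<nu>[OF that])
  qed (rule that)
  note \<phi>f = pot(1)[rule_format] and \<phi>1 = pot(2)[rule_format] and \<phi>2 = pot(3)[rule_format]
  have UM: "U \<subseteq> points M" using U(1) by (rule openin_subset)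
  have fW: "f q \<in> W" if "q \<in> U" for q using U(3) that by blast
  let ?H = "\<lambda>q w v. pd (pd \<phi> w) v (f q)"
  \<comment> \<open>The potential composed with f vanishes on U, so the chain rule applies.\<close>
  have tang: "pd \<phi> (deriv_along v f) (f q) = 0" if q: "q \<in> U" and v: "v \<in> tangent_space M q" for q v
  proof -
    have qM: "q \<in> points M" using q UM by blast
    have "pd \<phi> (deriv_along v f) (f q) = v (\<lambda>x. \<phi> (f x))"
      by (rule tangent_chain[OF M fsm qM v \<phi> W fW[OF q], symmetric])
    also have "\<dots> = v (\<lambda>x. 0)" by (rule tangent_local[OF M v U(1) q \<phi>f])
    also have "\<dots> = 0" by (rule tangent_const[OF M qM v])
    finally show ?thesis .
  qed
  note lin\<phi> = smooth_on_linear_pd[OF \<phi> fW]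
  \<comment> \<open>Differentiate d\<phi>(\<nu> b) = b \<bullet> e along v. The right side is
    constant, and d\<phi> kills the derivative of the frame field, which is tangent up to a normal
    part with m \<bullet> e = 0. So the Hessian term vanishes.\<close>
  have cross: "?H q (normal \<nu> q a) (deriv_along v f) = 0" if q: "q \<in> U" and v: "v \<in> tangent_space M q" for q v a
  proof -
    have qM: "q \<in> points M" using q UM by blast
    obtain X where X: "X \<in> vector_fields M" "X q = v" using extend_tangent_vector[OF M emb qM v] .
    have "?H q (\<nu> b q) (deriv_along v f) = 0" if b: "b \<in> Basis" for b
    proof -
      obtain u m where um: "u \<in> tangent_space M q" "m \<bullet> e = 0" "deriv_along v (\<nu> b) = deriv_along u f + normal \<nu> q m"
        using weingarten[OF X(1) qM b] X(2) by blast
      have "v (\<lambda>x. pd \<phi> (\<nu> b x) (f x)) = pd \<phi> (deriv_along v (\<nu> b)) (f q) + ?H q (\<nu> b q) (deriv_along v f)"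
        by (rule tangent_pd[OF M fsm qM v \<phi> W fW[OF q]])
           (rule smooth_fun_atI[OF smooth_map_euclid_components[OF M \<nu>[OF b]] qM])
      moreover have "v (\<lambda>x. pd \<phi> (\<nu> b x) (f x)) = v (\<lambda>x. b \<bullet> e)"
        by (rule tangent_local[OF M v U(1) q]) (rule \<phi>1[of _ b, unfolded normal_Basis[OF b]])
      moreover have "v (\<lambda>x. b \<bullet> e) = 0" by (rule tangent_const[OF M qM v])
      moreover have "pd \<phi> (deriv_along v (\<nu> b)) (f q) = 0"
        unfolding um(3) linear_add[OF lin\<phi>[OF q]] tang[OF q um(1)] \<phi>1[OF q] um(2) by simp
      ultimately show ?thesis by simp
    qed
    then show ?thesis
      unfolding normal_def
      by (simp add: linear_sum[OF hess_linear_right[OF \<phi> W fW[OF q]]] linear_scale[OF hess_linear_right[OF \<phi> W fW[OF q]]])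
  qed
  \<comment> \<open>Differentiate the vanishing of d\<phi> on the image of Y along v. By the Gauss
    formula with k \<bullet> e = g, d\<phi> of the second derivative is -g, so the Hessian term is
    g.\<close>
  have iso: "?H q (deriv_along w f) (deriv_along v f) = g q v w"
    if q: "q \<in> U" and v: "v \<in> tangent_space M q" and w: "w \<in> tangent_space M q" for q v w
  proof -
    have qM: "q \<in> points M" using q UM by blast
    obtain X where X: "X \<in> vector_fields M" "X q = v" using extend_tangent_vector[OF M emb qM v] .
    obtain Y where Y: "Y \<in> vector_fields M" "Y q = w" using extend_tangent_vector[OF M emb qM w] .
    have Yvf: "smooth_vf M (points M) Y" using Y(1) by (simp add: vector_fields_def)
    obtain k where k: "k \<bullet> e = g q v w"
      "deriv_along v (\<lambda>q. deriv_along (Y q) f) = deriv_along (nab q v Y) f - normal \<nu> q k"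
      using gauss[OF X(1) Y(1) qM] X(2) Y(2) by auto
    have s: "smooth_fun_at M q (\<lambda>x. deriv_along (Y x) f \<bullet> b)" if b: "b \<in> Basis" for b
      using smooth_vfD(3)[OF Yvf smooth_map_euclid_components[OF M fsm, of b]] qM
      by (intro smooth_fun_atI[of M "points M \<inter> points M"]) (simp_all add: deriv_along_inner[OF b])
    have "v (\<lambda>x. pd \<phi> (deriv_along (Y x) f) (f x)) =
        pd \<phi> (deriv_along v (\<lambda>x. deriv_along (Y x) f)) (f q) + ?H q (deriv_along (Y q) f) (deriv_along v f)"
      by (rule tangent_pd[OF M fsm qM v \<phi> W fW[OF q] s])
    moreover have "v (\<lambda>x. pd \<phi> (deriv_along (Y x) f) (f x)) = v (\<lambda>x. 0)"
      by (rule tangent_local[OF M v U(1) q]) (use tang smooth_vfD(2)[OF Yvf] UM in blast)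
    moreover have "v (\<lambda>x. 0) = 0" by (rule tangent_const[OF M qM v])
    moreover have "pd \<phi> (deriv_along v (\<lambda>x. deriv_along (Y x) f)) (f q) = - g q v w"
      unfolding k(2) linear_diff[OF lin\<phi>[OF q]] \<phi>1[OF q] k(1)
      using tang[OF q nab_tangent[OF qM v Yvf]] by simp
    ultimately show ?thesis using Y(2) by simp
  qed
  have zero: "deriv_along (\<lambda>h. 0) f = 0" by (simp add: deriv_along_def)
  have "?H x w w > 0" if w: "w \<noteq> 0" for w
  proof -
    obtain v a where v: "v \<in> tangent_space M x" and wva: "w = deriv_along v f + normal \<nu> x a" using span[OF x] by blast
    note fx = fW[OF U(2)]
    \<comment> \<open>As the mixed terms vanish, the Hessian is the orthogonal sum of g and the
      standard inner product on the coefficients a.\<close>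
    have "?H x w w = ?H x (deriv_along v f) (deriv_along v f) + ?H x (normal \<nu> x a) (deriv_along v f)
        + (?H x (deriv_along v f) (normal \<nu> x a) + ?H x (normal \<nu> x a) (normal \<nu> x a))"
      unfolding wva linear_add[OF hess_linear_left[OF \<phi> fx]] linear_add[OF hess_linear_right[OF \<phi> W fx]] by simp
    also have "\<dots> = g x v v + a \<bullet> a"
      unfolding cross[OF U(2) v] iso[OF U(2) v v] \<phi>2[OF U(2)]
        trans[OF pd_commute[OF W \<phi> fx, of "deriv_along v f" "normal \<nu> x a"] cross[OF U(2) v]] by simp
    finally have eq: "?H x w w = g x v v + a \<bullet> a" .
    show ?thesis
    proof (cases "v = (\<lambda>h. 0)")
      case True
      \<comment> \<open>The value of g at the zero vector is read off from the Hessian.\<close>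
      have "g x v v = 0"
        using iso[OF U(2) v v] linear_0[OF hess_linear_left[OF \<phi> fx]] unfolding True zero by simp
      moreover have "a \<noteq> 0" using w wva True zero linear_0[OF normal_linear, of \<nu> x] by auto
      ultimately show ?thesis using eq by simp
    next
      case False
      then show ?thesis using eq g_pos[OF x v] inner_ge_zero[of a] by linarith
    qed
  qed
  note posx = this
  obtain W' where W': "open W'" "f x \<in> W'" "W' \<subseteq> W"
    and "\<forall>z\<in>W'. \<forall>w. w \<noteq> 0 \<longrightarrow> pd (pd \<phi> w) w z > 0"
    by (rule positive_definite_open[OF W \<phi> fW[OF U(2)] posx])
  note pos = this(4)[rule_format]
  have \<phi>': "smooth_on \<phi> W'" by (rule smooth_on_subset[OF \<phi> W'(3)])
  \<comment> \<open>A second shrinking: all of W' is the target manifold, so the Hessian must be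
    positive definite on it, and the image has to stay inside.\<close>
  define U' where "U' = U \<inter> {q \<in> points M. f q \<in> W'}"
  have "openin (mtop M) {q \<in> points M. f q \<in> W'}"
    using openin_continuous_map_preimage[of "mtop M" euclidean f W'] fsm W'(1)
    by (simp add: smooth_map_def euclid_def)
  then have U': "openin (mtop M) U'" "x \<in> U'" "U' \<subseteq> U" "f ` U' \<subseteq> W'"
    using U x W' by (auto simp: U'_def)
  have U'M: "U' \<subseteq> points M" using U'(1) by (rule openin_subset)
  let ?M' = "restrict_manifold M U'" and ?S = "restrict_manifold euclid W'"
  have M': "smooth_manifold ?M'" by (rule smooth_manifold_restrict[OF M U'(1)])
  have pM': "points ?M' = U'" by (rule points_restrict[OF U'M])
  have emb': "embedding ?M' ?S f" by (rule embedding_restrict[OF M emb U'(1) W'(1) U'(4)])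
  have "embedding ?M' (restrict_manifold euclid UNIV) f" by (rule embedding_restrict[OF M emb U'(1) open_UNIV]) simp
  then have fsm': "smooth_map ?M' euclid f" by (simp add: embedding_def restrict_euclid_UNIV)
  have "statistical_embedding ?M' g nab ?S (hess_metric \<phi>) (flat_conn (\<lambda>y. y)) f"
    unfolding statistical_embedding_def
  proof (intro conjI emb' exI[of _ "flat_conn f"] ballI)
    show "pullback_connection ?M' ?S f (flat_conn (\<lambda>y. y)) (flat_conn f)"
      by (rule pullback_flat_conn[OF M' W'(1) fsm']) (use U'(4) pM' in simp)
    fix X Y Z p
    assume X: "X \<in> vector_fields ?M'" and Y: "Y \<in> vector_fields ?M'" and Z: "Z \<in> vector_fields ?M'"
      and "p \<in> points ?M'"
    then have p: "p \<in> U'" by (simp add: pM')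
    then have pU: "p \<in> U" and pM: "p \<in> points M" using U'(3) U'M by auto
    note vf = vector_fields_restrict[OF M U'(1), THEN iffD1]
    have tX: "X p \<in> tangent_space M p" and tY: "Y p \<in> tangent_space M p" and tZ: "Z p \<in> tangent_space M p"
      using smooth_vfD(2)[OF vf[OF X] p] smooth_vfD(2)[OF vf[OF Y] p] smooth_vfD(2)[OF vf[OF Z] p] by auto
    have push: "vec_of (pushforward ?S f q v) = deriv_along v f" if "q \<in> U'" for q v
      using pushforward_open[of W' f q v] W'(1) U'(4) that vec_of_pushforward[of f q v] by auto
    show "g p (X p) (Y p) = hess_metric \<phi> (f p) (pushforward ?S f p (X p)) (pushforward ?S f p (Y p))"
      unfolding hess_metric_def push[OF p] by (rule iso[OF pU tX tY, symmetric])
    \<comment> \<open>X and Y are fields on U', whereas \<open>gauss\<close> speaks of fields on M.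
      Only the value of X at p and Y near p enter, so both are replaced by extensions with the same
      data.\<close>
    obtain X' where X': "X' \<in> vector_fields M" "X' p = X p" using extend_tangent_vector[OF M emb pM tX] .
    obtain Y' N where Y': "Y' \<in> vector_fields M" and N: "openin (mtop M) N" "p \<in> N" "N \<subseteq> U'" "\<forall>q\<in>N. Y' q = Y q"
      using extend_vector_field[OF M emb vf[OF Y] p] .
    have nabY: "nab p (X p) Y' = nab p (X p) Y"
      by (rule nab_local[OF N(2) tX vf[OF Y] N(1,3,4)])
    obtain k where k: "deriv_along (X p) (\<lambda>q. deriv_along (Y' q) f) = deriv_along (nab p (X p) Y) f - normal \<nu> p k"
      using gauss[OF X'(1) Y' pM] X'(2) nabY by auto
    have "deriv_along (X p) (\<lambda>q. vec_of (pushforward ?S f q (Y q))) = deriv_along (X p) (\<lambda>q. deriv_along (Y' q) f)"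
      by (rule deriv_along_local[OF M tX N(1,2)]) (use N(3,4) push in auto)
    also note k
    finally have hat: "vec_of (flat_conn f p (X p) (\<lambda>q. pushforward ?S f q (Y q))) =
        deriv_along (nab p (X p) Y) f - normal \<nu> p k"
      by (simp add: flat_conn_def vec_of_flat_vec)
    note fp = fW[OF pU]
    \<comment> \<open>The normal part of the second derivative is orthogonal to the image, so the
      metric sees only the part coming from \<open>nab\<close>.\<close>
    have "pd (pd \<phi> (deriv_along (Z p) f)) (normal \<nu> p k) (f p) = 0"
      by (rule trans[OF pd_commute[OF W \<phi> fp] cross[OF pU tZ]])
    then show "g p (nab p (X p) Y) (Z p) = hess_metric \<phi> (f p)
        (flat_conn f p (X p) (\<lambda>q. pushforward ?S f q (Y q))) (pushforward ?S f p (Z p))"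
      unfolding hess_metric_def push[OF p] hat linear_diff[OF hess_linear_left[OF \<phi> fp]]
      using iso[OF pU nab_tangent[OF p tX vf[OF Y]] tZ] by simp
  qed
  with flat_statistical_hess[OF W'(1) \<phi>' pos] show ?thesis
    by (rule that[OF U'(1,2)])
qed

lemma affine_codim1_flat:
  fixes M :: "('a, 'e::euclidean_space) manifold" and f :: "'a \<Rightarrow> 'f::euclidean_space"
  assumes M: "smooth_manifold M" and dim: "DIM('f) = DIM('e) + 1"
    and aff: "affine_embedding_codim1 M g nab f \<xi>"
    and g_pos: "\<And>p v. p \<in> points M \<Longrightarrow> v \<in> tangent_space M p \<Longrightarrow> v \<noteq> (\<lambda>h. 0) \<Longrightarrow> g p v v > 0"
    and nab_tangent: "\<And>p v N Y. p \<in> N \<Longrightarrow> v \<in> tangent_space M p \<Longrightarrow> smooth_vf M N Y \<Longrightarrow>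
      nab p v Y \<in> tangent_space M p"
    and nab_local: "\<And>p v N N' Y Y'. p \<in> N' \<Longrightarrow> v \<in> tangent_space M p \<Longrightarrow> smooth_vf M N Y \<Longrightarrow>
      openin (mtop M) N' \<Longrightarrow> N' \<subseteq> N \<Longrightarrow> \<forall>q\<in>N'. Y' q = Y q \<Longrightarrow> nab p v Y' = nab p v Y"
    and x: "x \<in> points M"
  obtains U and S :: "('f, 'f) manifold" and G D where "openin (mtop M) U" "x \<in> U"
    "flat_statistical_manifold S G D" "statistical_embedding (restrict_manifold M U) g nab S G D f"
proof -
  \<comment> \<open>The only basis vector of \<open>real\<close> is 1, so the frame is constant in
    its index.\<close>
  let ?\<nu> = "\<lambda>b::real. \<xi>"
  have normal: "normal ?\<nu> p a = a *\<^sub>R \<xi> p" for p a by (simp add: normal_def)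
  note parts = aff[unfolded affine_embedding_codim1_def]
  note emb = parts[THEN conjunct1] and \<xi> = parts[THEN conjunct2, THEN conjunct1]
    and ex = parts[THEN conjunct2, THEN conjunct2, THEN conjunct1]
  obtain S \<tau> where S: "endomorphism M S"
    and "\<forall>X\<in>vector_fields M. \<forall>Y\<in>vector_fields M. \<forall>p\<in>points M.
      deriv_along (X p) (\<lambda>q. deriv_along (Y q) f) = deriv_along (nab p (X p) Y) f - g p (X p) (Y p) *\<^sub>R \<xi> p \<and>
      deriv_along (X p) \<xi> = deriv_along (S p (X p)) f + \<tau> p (X p) *\<^sub>R \<xi> p \<and>
      \<tau> p (X p) = 0"
    using parts by (elim exE conjE)
  note eqs = this(2)[rule_format]
  have St: "S p v \<in> tangent_space M p" if "p \<in> points M" "v \<in> tangent_space M p" for p v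
    using S that unfolding endomorphism_def by blast
  have Xt: "X p \<in> tangent_space M p" if "X \<in> vector_fields M" "p \<in> points M" for X p
    using that smooth_vfD(2) by (auto simp: vector_fields_def)
  show ?thesis
  proof (rule affine_embedding_flat[where \<nu> = ?\<nu> and e = 1, OF M emb \<xi> _ _ _ _ _ g_pos nab_tangent nab_local x])
    show "\<exists>v\<in>tangent_space M p. \<exists>a. w = deriv_along v f + normal ?\<nu> p a" if p: "p \<in> points M" for p w
    proof -
      obtain t where t: "case t of (u, a) \<Rightarrow> u \<in> tangent_image M f p \<and> w = u + a *\<^sub>R \<xi> p"
        using ex[rule_format, OF p, of w] by (rule ex1E)
      obtain u a where "t = (u, a)" by (cases t)
      then have "u \<in> tangent_image M f p" "w = u + normal ?\<nu> p a"
        using t unfolding normal by simp_all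
      then show ?thesis by blast
    qed
    show "\<exists>k. k \<bullet> 1 = g p (X p) (Y p) \<and>
        deriv_along (X p) (\<lambda>q. deriv_along (Y q) f) = deriv_along (nab p (X p) Y) f - normal ?\<nu> p k"
      if "X \<in> vector_fields M" "Y \<in> vector_fields M" "p \<in> points M" for X Y p
      unfolding normal using eqs[OF that] by (intro exI[of _ "g p (X p) (Y p)"]) simp
    show "\<exists>u\<in>tangent_space M p. \<exists>m. m \<bullet> 1 = 0 \<and> deriv_along (X p) \<xi> = deriv_along u f + normal ?\<nu> p m"
      if "X \<in> vector_fields M" "p \<in> points M" for X p
      \<comment> \<open>The equations are stated for two fields, and X fills both places. The
        witness m is 0 because \<tau> vanishes.\<close>
      unfolding normal using eqs[OF that(1,1,2)] St[OF that(2) Xt[OF that]]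
      by (intro bexI[of _ "S p (X p)"] exI[of _ 0]) simp_all
  qed (use dim that in simp_all)
qed

lemma affine_codim2_flat:
  fixes M :: "('a, 'e::euclidean_space) manifold" and f :: "'a \<Rightarrow> 'f::euclidean_space"
  assumes M: "smooth_manifold M" and dim: "DIM('f) = DIM('e) + 2"
    and aff: "affine_embedding_codim2 M g nab f \<xi>"
    and g_pos: "\<And>p v. p \<in> points M \<Longrightarrow> v \<in> tangent_space M p \<Longrightarrow> v \<noteq> (\<lambda>h. 0) \<Longrightarrow> g p v v > 0"
    and nab_tangent: "\<And>p v N Y. p \<in> N \<Longrightarrow> v \<in> tangent_space M p \<Longrightarrow> smooth_vf M N Y \<Longrightarrow>
      nab p v Y \<in> tangent_space M p"
    and nab_local: "\<And>p v N N' Y Y'. p \<in> N' \<Longrightarrow> v \<in> tangent_space M p \<Longrightarrow> smooth_vf M N Y \<Longrightarrow>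
      openin (mtop M) N' \<Longrightarrow> N' \<subseteq> N \<Longrightarrow> \<forall>q\<in>N'. Y' q = Y q \<Longrightarrow> nab p v Y' = nab p v Y"
    and x: "x \<in> points M"
  obtains U and S :: "('f, 'f) manifold" and G D where "openin (mtop M) U" "x \<in> U"
    "flat_statistical_manifold S G D" "statistical_embedding (restrict_manifold M U) g nab S G D f"
proof -
  \<comment> \<open>The basis consists of (1, 0) and (0, 1), so the default branch is the position
    vector, which along f is f itself.\<close>
  let ?\<nu> = "\<lambda>b::real \<times> real. if b = (1, 0) then \<xi> else f"
  have Basis: "(Basis :: (real \<times> real) set) = {(1, 0), (0, 1)}" by (auto simp: Basis_prod_def)
  have normal: "normal ?\<nu> p (a, b) = a *\<^sub>R \<xi> p + b *\<^sub>R f p" for p a b by (simp add: normal_def Basis)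
  note parts = aff[unfolded affine_embedding_codim2_def]
  note emb = parts[THEN conjunct1] and \<xi> = parts[THEN conjunct2, THEN conjunct1]
    and ex = parts[THEN conjunct2, THEN conjunct2, THEN conjunct2, THEN conjunct1]
  obtain k S \<tau> \<mu> where S: "endomorphism M S"
    and "\<forall>X\<in>vector_fields M. \<forall>Y\<in>vector_fields M. \<forall>p\<in>points M.
      deriv_along (X p) (\<lambda>q. deriv_along (Y q) f) =
        deriv_along (nab p (X p) Y) f - g p (X p) (Y p) *\<^sub>R \<xi> p - k p (X p) (Y p) *\<^sub>R f p \<and>
      deriv_along (X p) \<xi> = deriv_along (S p (X p)) f + \<tau> p (X p) *\<^sub>R \<xi> p + \<mu> p (X p) *\<^sub>R f p \<and>
      \<tau> p (X p) = 0"
    using parts by (elim exE conjE)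
  note eqs = this(2)[rule_format]
  have St: "S p v \<in> tangent_space M p" if "p \<in> points M" "v \<in> tangent_space M p" for p v
    using S that unfolding endomorphism_def by blast
  have Xt: "X p \<in> tangent_space M p" if "X \<in> vector_fields M" "p \<in> points M" for X p
    using that smooth_vfD(2) by (auto simp: vector_fields_def)
  show ?thesis
  proof (rule affine_embedding_flat[where \<nu> = ?\<nu> and e = "(1, 0)", OF M emb _ _ _ _ _ _ g_pos nab_tangent nab_local x])
    show "smooth_map M euclid (?\<nu> b)" for b
      using emb[unfolded embedding_def, THEN conjunct1] \<xi> by (cases "b = (1, 0)") simp_all
    show "\<exists>v\<in>tangent_space M p. \<exists>a. w = deriv_along v f + normal ?\<nu> p a" if p: "p \<in> points M" for p w
    proof -
      obtain t where t: "case t of (u, a, b) \<Rightarrow> u \<in> tangent_image M f p \<and> w = u + a *\<^sub>R \<xi> p + b *\<^sub>R f p"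
        using ex[rule_format, OF p, of w] by (rule ex1E)
      obtain u a b where "t = (u, a, b)" by (cases t)
      then have "u \<in> tangent_image M f p" "w = u + normal ?\<nu> p (a, b)"
        using t unfolding normal by (simp_all add: add.assoc)
      then show ?thesis by blast
    qed
    show "\<exists>l. l \<bullet> (1, 0) = g p (X p) (Y p) \<and>
        deriv_along (X p) (\<lambda>q. deriv_along (Y q) f) = deriv_along (nab p (X p) Y) f - normal ?\<nu> p l"
      if "X \<in> vector_fields M" "Y \<in> vector_fields M" "p \<in> points M" for X Y p
      \<comment> \<open>The second entry is the coefficient of the position vector in the Gauss
        formula; pairing with (1, 0) leaves g.\<close>
      using eqs[OF that] by (intro exI[of _ "(g p (X p) (Y p), k p (X p) (Y p))"]) (simp only: normal, simp)
    show "\<exists>u\<in>tangent_space M p. \<exists>m. m \<bullet> (1, 0) = 0 \<and> deriv_along (X p) (?\<nu> b) = deriv_along u f + normal ?\<nu> p m"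
      if X: "X \<in> vector_fields M" and p: "p \<in> points M" for X p b
    proof (cases "b = (1, 0)")
      case True
      \<comment> \<open>The \<eta>-component \<mu> is unrestricted: it sits in the entry that
        pairing with (1, 0) does not see.\<close>
      have "deriv_along (X p) (?\<nu> b) = deriv_along (S p (X p)) f + normal ?\<nu> p (0, \<mu> p (X p))"
        unfolding normal using eqs[OF X X p] True by simp
      moreover have "(0, \<mu> p (X p)) \<bullet> (1 :: real, 0 :: real) = 0" by simp
      ultimately show ?thesis using St[OF p Xt[OF X p]] by blast
    next
      case False
      \<comment> \<open>The derivative of the position vector along X is the image of X, so its
        normal part is zero.\<close>
      have "deriv_along (X p) (?\<nu> b) = deriv_along (X p) f + normal ?\<nu> p (0, 0)"
        unfolding normal using False by simp
      moreover have "(0, 0) \<bullet> (1 :: real, 0 :: real) = 0" by simp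
      ultimately show ?thesis using Xt[OF X p] by blast
    qed
    show "(1 :: real, 0 :: real) \<in> Basis" unfolding Basis by simp
  qed (use dim that in simp_all)
qed

theorem theorem1p2:
  fixes M :: "('a, 'e::euclidean_space) manifold"
    and g :: "'a \<Rightarrow> 'a tvec \<Rightarrow> 'a tvec \<Rightarrow> real"
    and nab :: "('a, 'a) conn"
    and n r :: nat
  assumes "r = 1 \<or> r = 2"
    and "DIM('e) = n"
    and "DIM('f::euclidean_space) = n + r"
    and "statistical_manifold M g nab"
    and "admits_local_affine_embedding TYPE('f) r M g nab"
  shows "locally_embeddable_flat TYPE('f) M g nab"
  unfolding locally_embeddable_flat_def
proof
  fix x assume x: "x \<in> points M"
  have M: "smooth_manifold M" and g: "riemannian_metric M g" and nab: "connection_along M M (\<lambda>p. p) nab"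
    using assms(4) by (auto simp: statistical_manifold_def affine_connection_def)
  obtain U where U: "openin (mtop M) U" "x \<in> U"
    and aff: "admits_affine_embedding TYPE('f) r (restrict_manifold M U) g nab"
    using assms(5) x unfolding admits_local_affine_embedding_def by blast
  let ?N = "restrict_manifold M U"
  have UM: "U \<subseteq> points M" using U(1) by (rule openin_subset)
  have N: "smooth_manifold ?N" by (rule smooth_manifold_restrict[OF M U(1)])
  have xN: "x \<in> points ?N" using U(2) points_restrict[OF UM] by simp
  have g_pos: "g p v v > 0" if "p \<in> points ?N" "v \<in> tangent_space ?N p" "v \<noteq> (\<lambda>h. 0)" for p v
  proof -
    have p: "p \<in> U" using that(1) points_restrict[OF UM] by simp
    then have "v \<in> tangent_space M p" using that(2) tangent_space_restrict[OF M U(1) p] by simp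
    then show ?thesis using g p UM that(3) unfolding riemannian_metric_def by blast
  qed
  \<comment> \<open>The affine embedding is one of U, while \<open>nab\<close> satisfies the
    connection axioms on M. A field near a point of U is also a section near that point for M, so
    tangency and locality carry over.\<close>
  have sec: "p \<in> U \<and> p \<in> points M \<and> v \<in> tangent_space M p \<and> smooth_section_at M M (\<lambda>p. p) p Y"
    if "p \<in> P" "v \<in> tangent_space ?N p" "smooth_vf ?N P Y" for p v P Y
  proof -
    have P: "P \<subseteq> U" "smooth_vf M P Y" using that(3) smooth_vf_restrict[OF M U(1)] by auto
    then have p: "p \<in> U" using that(1) by blast
    then show ?thesis
      using P that(1,2) UM tangent_space_restrict[OF M U(1) p] by (auto simp: smooth_section_at_def smooth_vf_def)
  qed
  have nab_tangent: "nab p v Y \<in> tangent_space ?N p"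
    if "p \<in> P" "v \<in> tangent_space ?N p" "smooth_vf ?N P Y" for p v P Y
  proof -
    have "nab p v Y \<in> tangent_space M p" using nab sec[OF that] unfolding connection_along_def by blast
    then show ?thesis using sec[OF that] tangent_space_restrict[OF M U(1)] by blast
  qed
  have nab_local: "nab p v Y' = nab p v Y"
    if "p \<in> P'" "v \<in> tangent_space ?N p" "smooth_vf ?N P Y" "openin (mtop ?N) P'" "P' \<subseteq> P" "\<forall>q\<in>P'. Y' q = Y q"
    for p v P P' Y Y'
  proof -
    have "openin (mtop M) P'" using that(4) openin_restrict[OF U(1)] by blast
    moreover have "p \<in> P" using that(1,5) by blast
    ultimately show ?thesis
      using nab sec[OF _ that(2,3)] that(1,6) unfolding connection_along_def by blast
  qed
  have "\<exists>U'. \<exists>(S :: ('f, 'f) manifold) G D f. openin (mtop ?N) U' \<and> x \<in> U' \<and>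
      flat_statistical_manifold S G D \<and> statistical_embedding (restrict_manifold ?N U') g nab S G D f"
    using aff unfolding admits_affine_embedding_def
  proof (elim disjE conjE exE)
    fix f :: "'a \<Rightarrow> 'f" and \<xi> assume r: "r = 1" and a: "affine_embedding_codim1 ?N g nab f \<xi>"
    have "DIM('f) = DIM('e) + 1" using assms(2,3) r by simp
    show ?thesis
    proof (rule affine_codim1_flat[OF N \<open>DIM('f) = DIM('e) + 1\<close> a g_pos nab_tangent nab_local xN])
      fix U' G D and S :: "('f, 'f) manifold"
      assume "openin (mtop ?N) U'" "x \<in> U'" "flat_statistical_manifold S G D"
        "statistical_embedding (restrict_manifold ?N U') g nab S G D f"
      then show ?thesis by (intro exI conjI)
    qed
  next
    fix f :: "'a \<Rightarrow> 'f" and \<xi> assume r: "r = 2" and a: "affine_embedding_codim2 ?N g nab f \<xi>"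
    have "DIM('f) = DIM('e) + 2" using assms(2,3) r by simp
    show ?thesis
    proof (rule affine_codim2_flat[OF N \<open>DIM('f) = DIM('e) + 2\<close> a g_pos nab_tangent nab_local xN])
      fix U' G D and S :: "('f, 'f) manifold"
      assume "openin (mtop ?N) U'" "x \<in> U'" "flat_statistical_manifold S G D"
        "statistical_embedding (restrict_manifold ?N U') g nab S G D f"
      then show ?thesis by (intro exI conjI)
    qed
  qed
  then obtain U' and S :: "('f, 'f) manifold" and G D f where U': "openin (mtop ?N) U'" "x \<in> U'"
    and S: "flat_statistical_manifold S G D" "statistical_embedding (restrict_manifold ?N U') g nab S G D f"
    by (elim exE conjE)
  \<comment> \<open>A set open in U is open in M, and the two successive restrictions merge into
    one.\<close>
  have "U' \<subseteq> U" "openin (mtop M) U'" using U'(1) openin_restrict[OF U(1)] by auto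
  then show "\<exists>U. openin (mtop M) U \<and> x \<in> U \<and> (\<exists>(S :: ('f, 'f) manifold) G D f.
      flat_statistical_manifold S G D \<and> statistical_embedding (restrict_manifold M U) g nab S G D f)"
    using U'(2) S restrict_restrict[of U' U M] by (intro exI conjI) simp_all
qed

end
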